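(* Let $(X,T)$ and $(Y,S)$ be subshifts over finite alphabets $\mathcal A$ and $\mathcal D$ respectively, and let $\pi:X\to Y$ be a one-block factor map. Let $\mathbf a=(a,b)\in\mathbb R^2$ with $a>0$ and $b\ge 0$. Let $\Phi=(\log\phi_n)_{n=1}^\infty$ be an asymptotically sub-additive potential on $X$, i.e. $\Phi\in\mathcal C_{ass}(X,T)$. Define a sequence $\Psi=(\log\psi_n)_{n=1}^\infty$ of functions on $Y$ by $$\psi_n(y)=\sum_{I\in\mathcal A^n:\ [I]\cap\pi^{-1}(y)\ne\emptyset}\ \sup_{x\in[I]\cap\pi^{-1}(y)}\phi_n(x)^{1/a},\qquad y\in Y,$$ and set $\frac{a}{a+b}\Psi=\big(\log(\psi_n^{a/(a+b)})\big)_{n=1}^\infty$. Then $\Psi$ and $\frac{a}{a+b}\Psi$ are in $\mathcal C_{ass}(Y,S)$; moreover $$P^{\mathbf a}(T,\Phi)=(a+b)\,P\Big(S,\frac{a}{a+b}\Psi\Big)=\lim_{n\to\infty}\frac{a+b}{n}\log\sum_{J\in\mathcal D^n}\ \sup_{y\in[J]\cap Y}\psi_n(y)^{\frac{a}{a+b}}.$$ Furthermore, $\mu\in\mathcal M(X,T)$ is an $\mathbf a$-weighted equilibrium state of $\Phi$ if and only if $\nu=\mu\circ\pi^{-1}$ is an equilibrium state of $\frac{a}{a+b}\Psi$ and $\mu$ is a conditional equilibrium state of $\frac1a\Phi$ with respect to $\nu$, where $\frac1a\Phi$ denotes the potential $(\log(\phi_n^{1/a}))_{n=1}^\infty$.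
   Context: Subshifts: $(X,T)$ is a subshift over the finite alphabet $\mathcal A$ if $X\subseteq\mathcal A^{\mathbb N}$ is compact (product of discrete topologies) and $T(X)\subseteq X$, where $T$ is the left shift. For $I\in\mathcal A^n$, $[I]=\{(x_i)\in\mathcal A^{\mathbb N}: x_1\dots x_n=I\}$; similarly $[J]\subset\mathcal D^{\mathbb N}$ for $J\in\mathcal D^n$. A factor map $\pi:X\to Y$ is a continuous surjection with $\pi T=S\pi$; it is one-block if there is a map $\pi:\mathcal A\to\mathcal D$ with $\pi((x_i)_{i\ge1})=(\pi(x_i))_{i\ge1}$. $\mathcal M(X,T)$ is the set of $T$-invariant Borel probability measures, and $h_\mu(T)$ is measure-theoretic entropy. Potentials: a sequence $\Phi=(\log\phi_n)_{n\ge1}$ is a sub-additive potential on $X$ if each $\phi_n:X\to[0,\infty)$ is continuous (the value $0$ is allowed) and there is $c>0$ with $\phi_{n+m}(x)\le c\,\phi_n(x)\phi_m(T^nx)$ for all $x\in X$, $n,m\in\mathbb N$. $\Phi=(\log\phi_n)_{n\ge1}$ is asymptotically sub-additive, written $\Phi\in\mathcal C_{ass}(X,T)$, if for every $\varepsilon>0$ there is a sub-additive potential $(\log\tilde\phi_n)_{n\ge1}$ on $X$ with $\limsup_{n\to\infty}\frac1n\sup_{x\in X}|\log\phi_n(x)-\log\tilde\phi_n(x)|\le\varepsilon$ (convention $\log0-\log0=0$). For $\mu\in\mathcal M(X,T)$, $\Phi_*(\mu)=\lim_{n\to\infty}\frac1n\int\log\phi_n\,d\mu\in[-\infty,\infty)$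 (the limit exists). Pressure and equilibrium states: $P^{\mathbf a}(T,\Phi)=\sup\{\Phi_*(\eta)+a h_\eta(T)+b h_{\eta\circ\pi^{-1}}(S):\eta\in\mathcal M(X,T)\}$, and $\eta$ is an $\mathbf a$-weighted equilibrium state of $\Phi$ if the supremum is attained at $\eta$. For $\Theta\in\mathcal C_{ass}(Y,S)$, $P(S,\Theta)=\sup\{\Theta_*(\nu)+h_\nu(S):\nu\in\mathcal M(Y,S)\}$, and $\nu$ is an equilibrium state of $\Theta$ if this supremum is attained at $\nu$. Given $\nu\in\mathcal M(Y,S)$, $\mu\in\mathcal M(X,T)$ is a conditional equilibrium state of $\Phi$ with respect to $\nu$ if $\mu\circ\pi^{-1}=\nu$ and $\Phi_*(\mu)+h_\mu(T)-h_\nu(S)=\sup\{\Phi_*(\eta)+h_\eta(T)-h_\nu(S):\eta\in\mathcal M(X,T),\ \eta\circ\pi^{-1}=\nu\}$.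
   Formalization: The claim that Ψ and (a/(a+b))Ψ lie in C_ass(Y,S) is false with continuous approximating sub-additive potentials (ψ_n can jump); it is proved with upper semicontinuous approximating potentials in place of continuous ones. *)

theory Defs
  imports "HOL-Probability.Probability"
begin

section \<open>Subshifts and factor maps\<close>

text \<open>
  Sequences are indexed from 0, so the \<open>n\<close>-th coordinate of \<open>x\<close> is \<open>x (n - 1)\<close> in the convention
  that starts at 1. The type \<open>nat \<Rightarrow> 'a\<close> carries the product topology of the discrete topology
  on \<open>'a\<close>.
\<close>

definition left_shift :: "(nat \<Rightarrow> 'a) \<Rightarrow> (nat \<Rightarrow> 'a)" where
  "left_shift x = (\<lambda>i. x (Suc i))"

definition subshift :: "(nat \<Rightarrow> 'a::{finite, discrete_topology}) set \<Rightarrow> bool" where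
  "subshift X \<longleftrightarrow> compact X \<and> left_shift ` X \<subseteq> X"

definition cylinder :: "'a list \<Rightarrow> (nat \<Rightarrow> 'a) set" where
  "cylinder I = {x. \<forall>i<length I. x i = I ! i}"

definition factor_map ::
  "(nat \<Rightarrow> 'a::{finite, discrete_topology}) set \<Rightarrow> (nat \<Rightarrow> 'd::{finite, discrete_topology}) set
    \<Rightarrow> ((nat \<Rightarrow> 'a) \<Rightarrow> (nat \<Rightarrow> 'd)) \<Rightarrow> bool" where
  "factor_map X Y \<pi> \<longleftrightarrow>
     continuous_on X \<pi> \<and> \<pi> ` X = Y \<and> (\<forall>x\<in>X. \<pi> (left_shift x) = left_shift (\<pi> x))"

definition one_block :: "(nat \<Rightarrow> 'a) set \<Rightarrow> ((nat \<Rightarrow> 'a) \<Rightarrow> (nat \<Rightarrow> 'd)) \<Rightarrow> bool" where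
  "one_block X \<pi> \<longleftrightarrow> (\<exists>p. \<forall>x\<in>X. \<pi> x = (\<lambda>i. p (x i)))"

definition fiber :: "(nat \<Rightarrow> 'a) set \<Rightarrow> ((nat \<Rightarrow> 'a) \<Rightarrow> (nat \<Rightarrow> 'd)) \<Rightarrow> (nat \<Rightarrow> 'd) \<Rightarrow> (nat \<Rightarrow> 'a) set"
  where "fiber X \<pi> y = {x \<in> X. \<pi> x = y}"

section \<open>Invariant measures and entropy\<close>

text \<open>Borel probability measures live on the Borel \<open>\<sigma>\<close>-algebra of the subspace \<open>X\<close>.\<close>

definition invariant_measures ::
  "(nat \<Rightarrow> 'a::{finite, discrete_topology}) set \<Rightarrow> (nat \<Rightarrow> 'a) measure set" where
  "invariant_measures X =
     {\<mu>. prob_space \<mu> \<and> sets \<mu> = sets (restrict_space borel X) \<and> distr \<mu> \<mu> left_shift = \<mu>}"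

definition push_measure ::
  "(nat \<Rightarrow> 'd::{finite, discrete_topology}) set \<Rightarrow> ((nat \<Rightarrow> 'a) \<Rightarrow> (nat \<Rightarrow> 'd))
    \<Rightarrow> (nat \<Rightarrow> 'a) measure \<Rightarrow> (nat \<Rightarrow> 'd) measure" where
  "push_measure Y \<pi> \<mu> = distr \<mu> (restrict_space borel Y) \<pi>"

definition finite_measurable_partition :: "'x measure \<Rightarrow> 'x set set \<Rightarrow> bool" where
  "finite_measurable_partition M P \<longleftrightarrow> finite P \<and> P \<subseteq> sets M \<and> partition_on (space M) P"

text \<open>The convention \<open>0 log 0 = 0\<close> is built into \<open>0 * ln 0 = (0::real)\<close>.\<close>

definition partition_entropy :: "'x measure \<Rightarrow> 'x set set \<Rightarrow> real" where
  "partition_entropy M P = - (\<Sum>A\<in>P. measure M A * ln (measure M A))"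

text \<open>
  The join of \<open>P, T\<^sup>-\<^sup>1P, \<dots>, T\<^bsup>-(n-1)\<^esup>P\<close>. Distinct choices \<open>c\<close> can produce
  the same cell only if that cell is empty, which does not affect the entropy.
\<close>

definition iterated_join :: "'x measure \<Rightarrow> ('x \<Rightarrow> 'x) \<Rightarrow> 'x set set \<Rightarrow> nat \<Rightarrow> 'x set set" where
  "iterated_join M T P n =
     (\<lambda>c. {x \<in> space M. \<forall>i<n. (T ^^ i) x \<in> c i}) ` ({..<n} \<rightarrow>\<^sub>E P)"

text \<open>Kolmogorov--Sinai entropy.\<close>

definition ks_entropy :: "'x measure \<Rightarrow> ('x \<Rightarrow> 'x) \<Rightarrow> ereal" where
  "ks_entropy M T =
     (SUP P\<in>{P. finite_measurable_partition M P}.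
        ereal (lim (\<lambda>n. partition_entropy M (iterated_join M T P n) / real n)))"

section \<open>Potentials\<close>

text \<open>
  A potential \<open>(log \<phi>\<^sub>n)\<^sub>n\<^sub>\<ge>\<^sub>1\<close> is represented by the sequence \<open>\<phi>\<close>; the entry \<open>\<phi> 0\<close> is never
  relevant. Values are in \<open>[0, \<infinity>]\<close> so that suprema of \<open>\<phi>\<^sub>n\<close> are always meaningful: asymptotic
  sub-additivity says nothing about finitely many \<open>n\<close>, for which \<open>\<phi>\<^sub>n\<close> may be unbounded.
\<close>

type_synonym 'a potential = "nat \<Rightarrow> (nat \<Rightarrow> 'a) \<Rightarrow> ennreal"

definition eln :: "ennreal \<Rightarrow> ereal" where
  "eln u = (if u = 0 then -\<infinity> else if u = \<top> then \<infinity> else ereal (ln (enn2real u)))"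

text \<open>Only used with a positive exponent \<open>p\<close>; then \<open>epowr 0 p = 0\<close>.\<close>

definition epowr :: "ennreal \<Rightarrow> real \<Rightarrow> ennreal" where
  "epowr u p = (if u = \<top> then \<top> else ennreal (enn2real u powr p))"

text \<open>The potential \<open>p \<Phi> = (log (\<phi>\<^sub>n\<^sup>p))\<^sub>n\<close>.\<close>

definition scale_potential :: "real \<Rightarrow> 'a potential \<Rightarrow> 'a potential" where
  "scale_potential p \<phi> = (\<lambda>n x. epowr (\<phi> n x) p)"

definition submultiplicative_up_to_const :: "(nat \<Rightarrow> 'a) set \<Rightarrow> 'a potential \<Rightarrow> bool" where
  "submultiplicative_up_to_const X \<phi> \<longleftrightarrow>
     (\<exists>c::real. c > 0 \<and> (\<forall>n\<ge>1. \<forall>m\<ge>1. \<forall>x\<in>X.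
        \<phi> (n + m) x \<le> ennreal c * \<phi> n x * \<phi> m ((left_shift ^^ n) x)))"

definition subadditive_potential ::
  "(nat \<Rightarrow> 'a::{finite, discrete_topology}) set \<Rightarrow> 'a potential \<Rightarrow> bool" where
  "subadditive_potential X \<phi> \<longleftrightarrow>
     (\<forall>n\<ge>1. continuous_on X (\<phi> n) \<and> (\<forall>x\<in>X. \<phi> n x < \<top>)) \<and>
     submultiplicative_up_to_const X \<phi>"

text \<open>\<open>\<bar>log u - log v\<bar>\<close> with the convention \<open>log 0 - log 0 = 0\<close>.\<close>

definition log_distance :: "ennreal \<Rightarrow> ennreal \<Rightarrow> ereal" where
  "log_distance u v = (if u = 0 \<and> v = 0 then 0 else \<bar>eln u - eln v\<bar>)"

definition asymptotic_log_distance ::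
  "(nat \<Rightarrow> 'a) set \<Rightarrow> 'a potential \<Rightarrow> 'a potential \<Rightarrow> ereal" where
  "asymptotic_log_distance X \<phi> \<theta> =
     limsup (\<lambda>n. (SUP x\<in>X. log_distance (\<phi> n x) (\<theta> n x)) / ereal (real n))"

text \<open>The class \<open>\<C>\<^sub>a\<^sub>s\<^sub>s(X,T)\<close>.\<close>

definition asymptotically_subadditive ::
  "(nat \<Rightarrow> 'a::{finite, discrete_topology}) set \<Rightarrow> 'a potential \<Rightarrow> bool" where
  "asymptotically_subadditive X \<phi> \<longleftrightarrow>
     (\<forall>\<epsilon>::real. \<epsilon> > 0 \<longrightarrow>
        (\<exists>\<theta>. subadditive_potential X \<theta> \<and> asymptotic_log_distance X \<phi> \<theta> \<le> ereal \<epsilon>))"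

text \<open>
  The same class with continuity of the approximating functions relaxed to upper
  semicontinuity. This is the class that is closed under passing from \<open>\<Phi>\<close> to the fibrewise
  potential \<open>\<Psi>\<close> defined below; the class with continuous approximants is not. For instance, let
  \<open>Y = {0\<^sup>\<infinity>} \<union> {0\<^sup>k10\<^sup>\<infinity> | k \<ge> 0}\<close>, \<open>X = Y \<union> {2\<^sup>\<infinity>}\<close>, let \<open>\<pi>\<close> replace the symbol 2 by 0, \<open>a = 1\<close>, and
  \<open>\<phi>\<^sub>n(x) = 2\<^sup>n\<close> if \<open>x = 2\<^sup>\<infinity>\<close>, \<open>\<phi>\<^sub>n(x) = 1\<close> otherwise. Then \<open>\<psi>\<^sub>n(0\<^sup>\<infinity>) = 2\<^sup>n + 1\<close> but
  \<open>\<psi>\<^sub>n(0\<^sup>k10\<^sup>\<infinity>) = 1\<close> for every \<open>k\<close>, so for \<open>\<epsilon> < (log 2)/2\<close> and large \<open>n\<close> no function on \<open>Y\<close> that is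
  continuous at \<open>0\<^sup>\<infinity>\<close> is within \<open>n\<epsilon>\<close> of \<open>log \<psi>\<^sub>n\<close>.
\<close>

definition upper_semicontinuous_on ::
  "'x::topological_space set \<Rightarrow> ('x \<Rightarrow> ennreal) \<Rightarrow> bool" where
  "upper_semicontinuous_on X f \<longleftrightarrow> (\<forall>t. closedin (top_of_set X) {x \<in> X. t \<le> f x})"

definition usc_subadditive_potential ::
  "(nat \<Rightarrow> 'a::{finite, discrete_topology}) set \<Rightarrow> 'a potential \<Rightarrow> bool" where
  "usc_subadditive_potential X \<phi> \<longleftrightarrow>
     (\<forall>n\<ge>1. upper_semicontinuous_on X (\<phi> n) \<and> (\<forall>x\<in>X. \<phi> n x < \<top>)) \<and>
     submultiplicative_up_to_const X \<phi>"

definition usc_asymptotically_subadditive ::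
  "(nat \<Rightarrow> 'a::{finite, discrete_topology}) set \<Rightarrow> 'a potential \<Rightarrow> bool" where
  "usc_asymptotically_subadditive X \<phi> \<longleftrightarrow>
     (\<forall>\<epsilon>::real. \<epsilon> > 0 \<longrightarrow>
        (\<exists>\<theta>. usc_subadditive_potential X \<theta> \<and> asymptotic_log_distance X \<phi> \<theta> \<le> ereal \<epsilon>))"

text \<open>
  The integral of an extended-real function. Functions \<open>\<phi>\<^sub>n\<close> of an asymptotically sub-additive
  potential need not be measurable; for such functions the library's nonnegative integral
  is a lower integral. As it is monotone and compatible with adding constants to measurable
  functions, the limit below still exists, being determined by the measurable approximants.
\<close>

definition ereal_integral :: "'x measure \<Rightarrow> ('x \<Rightarrow> ereal) \<Rightarrow> ereal" where
  "ereal_integral M f =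
     enn2ereal (\<integral>\<^sup>+ x. e2ennreal (f x) \<partial>M) - enn2ereal (\<integral>\<^sup>+ x. e2ennreal (- f x) \<partial>M)"

text \<open>\<open>\<Phi>\<^sub>*(\<mu>)\<close>.\<close>

definition potential_mean :: "'a potential \<Rightarrow> (nat \<Rightarrow> 'a) measure \<Rightarrow> ereal" where
  "potential_mean \<phi> \<mu> = lim (\<lambda>n. ereal_integral \<mu> (\<lambda>x. eln (\<phi> n x)) / ereal (real n))"

text \<open>
  The fibrewise potential \<open>\<Psi>\<close> on \<open>Y\<close>.
\<close>

definition fiber_potential ::
  "(nat \<Rightarrow> 'a::finite) set \<Rightarrow> ((nat \<Rightarrow> 'a) \<Rightarrow> (nat \<Rightarrow> 'd)) \<Rightarrow> real \<Rightarrow> 'a potential \<Rightarrow> 'd potential"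
  where
  "fiber_potential X \<pi> a \<phi> = (\<lambda>n y.
     \<Sum>I\<in>{I. length I = n \<and> cylinder I \<inter> fiber X \<pi> y \<noteq> {}}.
       SUP x\<in>cylinder I \<inter> fiber X \<pi> y. epowr (\<phi> n x) (1 / a))"

section \<open>Pressure and equilibrium states\<close>

definition weighted_functional ::
  "(nat \<Rightarrow> 'd::{finite, discrete_topology}) set \<Rightarrow> ((nat \<Rightarrow> 'a) \<Rightarrow> (nat \<Rightarrow> 'd))
    \<Rightarrow> real \<Rightarrow> real \<Rightarrow> 'a potential \<Rightarrow> (nat \<Rightarrow> 'a) measure \<Rightarrow> ereal" where
  "weighted_functional Y \<pi> a b \<phi> \<eta> =
     potential_mean \<phi> \<eta> + ereal a * ks_entropy \<eta> left_shift
       + ereal b * ks_entropy (push_measure Y \<pi> \<eta>) left_shift"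

definition weighted_pressure ::
  "(nat \<Rightarrow> 'a::{finite, discrete_topology}) set \<Rightarrow> (nat \<Rightarrow> 'd::{finite, discrete_topology}) set
    \<Rightarrow> ((nat \<Rightarrow> 'a) \<Rightarrow> (nat \<Rightarrow> 'd)) \<Rightarrow> real \<Rightarrow> real \<Rightarrow> 'a potential \<Rightarrow> ereal" where
  "weighted_pressure X Y \<pi> a b \<phi> =
     (SUP \<eta>\<in>invariant_measures X. weighted_functional Y \<pi> a b \<phi> \<eta>)"

definition weighted_equilibrium_state ::
  "(nat \<Rightarrow> 'a::{finite, discrete_topology}) set \<Rightarrow> (nat \<Rightarrow> 'd::{finite, discrete_topology}) set
    \<Rightarrow> ((nat \<Rightarrow> 'a) \<Rightarrow> (nat \<Rightarrow> 'd)) \<Rightarrow> real \<Rightarrow> real \<Rightarrow> 'a potential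
    \<Rightarrow> (nat \<Rightarrow> 'a) measure \<Rightarrow> bool" where
  "weighted_equilibrium_state X Y \<pi> a b \<phi> \<eta> \<longleftrightarrow>
     \<eta> \<in> invariant_measures X \<and>
     weighted_functional Y \<pi> a b \<phi> \<eta> = weighted_pressure X Y \<pi> a b \<phi>"

definition pressure ::
  "(nat \<Rightarrow> 'd::{finite, discrete_topology}) set \<Rightarrow> 'd potential \<Rightarrow> ereal" where
  "pressure Y \<theta> = (SUP \<nu>\<in>invariant_measures Y. potential_mean \<theta> \<nu> + ks_entropy \<nu> left_shift)"

definition equilibrium_state ::
  "(nat \<Rightarrow> 'd::{finite, discrete_topology}) set \<Rightarrow> 'd potential \<Rightarrow> (nat \<Rightarrow> 'd) measure \<Rightarrow> bool"
  where
  "equilibrium_state Y \<theta> \<nu> \<longleftrightarrow>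
     \<nu> \<in> invariant_measures Y \<and> potential_mean \<theta> \<nu> + ks_entropy \<nu> left_shift = pressure Y \<theta>"

definition conditional_equilibrium_state ::
  "(nat \<Rightarrow> 'a::{finite, discrete_topology}) set \<Rightarrow> (nat \<Rightarrow> 'd::{finite, discrete_topology}) set
    \<Rightarrow> ((nat \<Rightarrow> 'a) \<Rightarrow> (nat \<Rightarrow> 'd)) \<Rightarrow> 'a potential
    \<Rightarrow> (nat \<Rightarrow> 'd) measure \<Rightarrow> (nat \<Rightarrow> 'a) measure \<Rightarrow> bool" where
  "conditional_equilibrium_state X Y \<pi> \<phi> \<nu> \<mu> \<longleftrightarrow>
     \<mu> \<in> invariant_measures X \<and> push_measure Y \<pi> \<mu> = \<nu> \<and>
     potential_mean \<phi> \<mu> + ks_entropy \<mu> left_shift - ks_entropy \<nu> left_shift =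
       (SUP \<eta>\<in>{\<eta> \<in> invariant_measures X. push_measure Y \<pi> \<eta> = \<nu>}.
          potential_mean \<phi> \<eta> + ks_entropy \<eta> left_shift - ks_entropy \<nu> left_shift)"

end

theory Submission
  imports Defs
begin

text \<open>
  Everything reduces to a relative variational principle: for invariant \<open>\<nu>\<close> on \<open>Y\<close>, the supremum of
  \<open>\<Phi>\<^sub>*(\<mu>) + h\<^sub>\<mu>(T)\<close> over the invariant \<open>\<mu>\<close> above \<open>\<nu>\<close> is \<open>\<Psi>\<^sub>*(\<nu>) + h\<^sub>\<nu>(S)\<close>, where \<open>\<Psi>\<close> is the fibrewise potential
  with \<open>a = 1\<close>. Applied to \<open>\<Phi>/a\<close> and combined with the absolute variational principle on \<open>Y\<close>, it
  gives the theorem; the absolute principle is itself the relative one over a one-point factor, which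
  is why the relative principle is proved for upper semicontinuous potentials.

  Upper bound: \<open>n (h\<^sub>\<mu> - h\<^sub>\<nu>)\<close> is at most the entropy of the \<open>n\<close>-prefix of \<open>x\<close> given the \<open>N\<close>-prefix of
  \<open>\<pi> x\<close>, and Gibbs' inequality bounds this entropy plus \<open>\<integral> log \<phi>\<^sub>n d\<mu>\<close> by the integral of the logarithm of
  a sum over words that decreases to \<open>\<psi>\<^sub>n\<close> as \<open>N\<close> grows, by compactness and upper semicontinuity.

  Lower bound: choose for every word of length \<open>2n\<close> of \<open>Y\<close> a point \<open>y\<close> almost maximizing \<open>\<psi>\<^sub>n\<close>, and for
  every word of length \<open>n\<close> a point of the fibre over \<open>y\<close> almost maximizing \<open>\<phi>\<^sub>n\<close>. Weighted by \<open>\<nu>\<close> and by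
  the values of \<open>\<phi>\<^sub>n\<close>, these points carry a finitely supported measure; every limit of its averages
  under the shift projects to \<open>\<nu>\<close> and attains the bound.
\<close>

text \<open>Two features of the setting shape the argument. A supremum over a fibre is in general
  only upper semicontinuous in the base point, so no limit of measures may rest on continuity of a
  potential: the potential is first majorized by cylinder functions of fixed depth, for which the
  limit is legitimate, and the depth grows afterwards. Potentials may also vanish. Truncating
  \<open>log \<phi>\<^sub>n\<close> at \<open>-k n\<close> gives finite means for every
  \<open>k\<close>, with error constants that do not depend on \<open>k\<close>; this uniformity
  lets the lower bound use level \<open>n\<close> at length \<open>n\<close>, so that one limit
  measure serves all levels. In the upper bound truncation costs a fixed shift of \<open>k\<close>,
  large enough to outweigh the exponential number of words. The length 2n leaves room for the n
  shifts that are averaged: every window of length at most n stays among the prescribed coordinates,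
  so short words get exactly their \<nu>-probabilities. Asymptotically sub-additive potentials are
  handled through approximants, whose errors pass unchanged to the fibre sums. Entropy is computed
  from prefixes, by the Kolmogorov-Sinai theorem.\<close>

section \<open>Sub-additive arrays and Fekete's lemma\<close>

text \<open>Sub-additivity bounds the increment \<open>a 0 (i + l) - a 0 i\<close> by
  \<open>a i (i + l)\<close>, and for \<open>i < N - l\<close> the increments telescope to
  \<open>l\<close> terms near the end minus \<open>l\<close> terms near the start. Up to
  \<open>K\<close> apiece the former are at least \<open>a 0 N\<close> and the latter at most 0;
  restoring the last \<open>l\<close> blocks to the sum costs the third \<open>l * K\<close>. The
  bound serves Fekete's lemma, entropies of segments, and truncated potentials along orbits.\<close>

lemma subadditive_block_bound:
  fixes a :: "nat \<Rightarrow> nat \<Rightarrow> real"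
  assumes sub: "\<And>s t u. s \<le> t \<Longrightarrow> t \<le> u \<Longrightarrow> a s u \<le> a s t + a t u"
    and K: "\<And>s t. s \<le> t \<Longrightarrow> t \<le> s + l \<Longrightarrow> \<bar>a s t\<bar> \<le> K"
    and "l \<le> N"
  shows "real l * a 0 N \<le> (\<Sum>i<N. a i (i + l)) + 3 * real l * K"
proof -
  let ?m = "N - l"
  have tele: "(\<Sum>i<m. a 0 (i + l) - a 0 i) = (\<Sum>j<l. a 0 (m + j)) - (\<Sum>j<l. a 0 j)" for m
  proof (induction m)
    case (Suc m)
    have "(\<Sum>j<l. a 0 (Suc m + j)) + a 0 m = (\<Sum>j<Suc l. a 0 (m + j))"
      by (subst sum.lessThan_Suc_shift) simp
    with Suc show ?case by (simp add: add.commute)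
  qed simp
  have "(\<Sum>i<?m. a 0 (i + l) - a 0 i) \<le> (\<Sum>i<?m. a i (i + l))"
    using sub[of 0 _ ] by (intro sum_mono) (smt (verit) le_add1 zero_le)
  moreover have "real l * (a 0 N - K) \<le> (\<Sum>j<l. a 0 (?m + j))"
  proof -
    have "a 0 N - K \<le> a 0 (?m + j)" if "j < l" for j
    proof -
      have "?m + j \<le> N" "N \<le> ?m + j + l" using that \<open>l \<le> N\<close> by auto
      then show ?thesis using sub[of 0 "?m + j" N] K[of "?m + j" N] by (simp add: abs_le_iff)
    qed
    then have "(\<Sum>j<l. a 0 N - K) \<le> (\<Sum>j<l. a 0 (?m + j))" by (intro sum_mono) auto
    then show ?thesis by simp
  qed
  moreover have "(\<Sum>j<l. a 0 j) \<le> (\<Sum>j<l. K)"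
    using K[of 0] by (intro sum_mono) (auto simp: abs_le_iff)
  moreover have "(\<Sum>i<N. a i (i + l)) \<ge> (\<Sum>i<?m. a i (i + l)) - real l * K"
  proof -
    have "(\<Sum>i<N. a i (i + l)) = (\<Sum>i<?m. a i (i + l)) + (\<Sum>i=?m..<N. a i (i + l))"
      by (simp add: lessThan_atLeast0 sum.atLeastLessThan_concat)
    moreover have "(\<Sum>i=?m..<N. - K) \<le> (\<Sum>i=?m..<N. a i (i + l))"
      using K[of _ "_ + l"] by (intro sum_mono) (smt (verit) le_add1 le_refl)
    ultimately show ?thesis using \<open>l \<le> N\<close> by simp
  qed
  ultimately show ?thesis using tele[of ?m] by (simp add: algebra_simps)
qed

lemma real_div_const_tendsto_0: "(\<lambda>n. (c::real) / real n) \<longlonglongrightarrow> 0"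
  using tendsto_divide_0[OF tendsto_const filterlim_at_top_imp_at_infinity[OF filterlim_real_sequentially]] .

text \<open>The linear lower bound keeps the infimum of \<open>a n / n\<close> finite. For
  convergence, one \<open>l\<close> whose quotient is below the target suffices:
  \<open>subadditive_block_bound\<close> spreads it to all large \<open>N\<close> with an error of
  order \<open>1 / N\<close>.\<close>

lemma fekete:
  fixes a :: "nat \<Rightarrow> real"
  assumes sub: "\<And>m n. m \<ge> 1 \<Longrightarrow> n \<ge> 1 \<Longrightarrow> a (m + n) \<le> a m + a n"
    and low: "\<And>n. n \<ge> 1 \<Longrightarrow> L * real n \<le> a n"
  shows "\<exists>h. (\<lambda>n. a n / real n) \<longlonglongrightarrow> h \<and> (\<forall>n\<ge>1. h * real n \<le> a n)"
proof -
  define S where "S = (\<lambda>n. a n / real n) ` {1..}"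
  define h where "h = Inf S"
  have bdd: "bdd_below S"
    unfolding S_def by (rule bdd_belowI[of _ L]) (use low in \<open>auto simp: field_simps\<close>)
  have ne: "S \<noteq> {}" by (auto simp: S_def)
  have hle: "h \<le> a n / real n" if "n \<ge> 1" for n
    unfolding h_def by (rule cInf_lower[OF _ bdd]) (use that in \<open>auto simp: S_def\<close>)
  have "(\<lambda>n. a n / real n) \<longlonglongrightarrow> h"
  proof (rule order_tendstoI)
    fix c assume "c < h"
    then show "eventually (\<lambda>n. c < a n / real n) sequentially"
      using hle by (intro eventually_sequentiallyI[of 1]) (metis less_le_trans)
  next
    fix c assume "h < c"
    then obtain l where l: "l \<ge> 1" "a l / real l < c"
      using cInf_less_iff[OF ne bdd, of c] by (auto simp: h_def S_def)
    \<comment> \<open>\<open>a 0\<close> is unconstrained, so empty intervals get the value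
      0.\<close>
    define b where "b s t = (if s = t then 0 else a (t - s))" for s t :: nat
    define K where "K = (\<Sum>j\<le>l. \<bar>a j\<bar>)"
    have K: "\<bar>b s t\<bar> \<le> K" if "s \<le> t" "t \<le> s + l" for s t
    proof (cases "s = t")
      case False
      with that show ?thesis unfolding b_def K_def
        by (auto intro!: member_le_sum[of "t - s" "{..l}" "\<lambda>j. \<bar>a j\<bar>"])
    qed (auto simp: b_def K_def intro!: sum_nonneg)
    have bsub: "b s u \<le> b s t + b t u" if "s \<le> t" "t \<le> u" for s t u
      using that sub[of "t - s" "u - t"] by (auto simp: b_def)
    have bound: "a N / real N \<le> a l / real l + 3 * K / real N" if "N \<ge> l" for N
    proof -
      have "N \<ge> 1" using that l by simp
      have "real l * b 0 N \<le> (\<Sum>i<N. b i (i + l)) + 3 * real l * K"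
        by (rule subadditive_block_bound) (use bsub K that in auto)
      also have "(\<Sum>i<N. b i (i + l)) = real N * a l" using l by (simp add: b_def)
      finally have "real l * a N \<le> real N * a l + 3 * real l * K"
        using \<open>N \<ge> 1\<close> by (simp add: b_def)
      then show ?thesis using l \<open>N \<ge> 1\<close> by (simp add: field_simps)
    qed
    have "(\<lambda>N. a l / real l + 3 * K / real N) \<longlonglongrightarrow> a l / real l + 0"
      by (intro tendsto_intros real_div_const_tendsto_0)
    then have "eventually (\<lambda>N. a l / real l + 3 * K / real N < c) sequentially"
      using l(2) by (auto dest: order_tendstoD)
    then show "eventually (\<lambda>n. a n / real n < c) sequentially"
      using eventually_ge_at_top[of l] by eventually_elim (use bound in force)
  qed
  moreover have "h * real n \<le> a n" if "n \<ge> 1" for n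
    using hle[OF that] that by (simp add: field_simps)
  ultimately show ?thesis by blast
qed

section \<open>Entropy of finitely valued functions\<close>

definition eta :: "real \<Rightarrow> real" where "eta t = - (t * ln t)"

lemma eta_0 [simp]: "eta 0 = 0" and eta_1 [simp]: "eta 1 = 0"
  by (simp_all add: eta_def)

lemma eta_nonneg: "0 \<le> t \<Longrightarrow> t \<le> 1 \<Longrightarrow> 0 \<le> eta t"
  unfolding eta_def by (cases "t = 0") (auto simp: mult_nonneg_nonpos ln_le_zero_iff)

text \<open>The tangent at \<open>s\<close> of the concave function \<open>eta\<close>. Gibbs'
  inequality, strong sub-additivity and the smallness of conditional entropy all come from choosing
  \<open>s\<close> suitably and summing.\<close>

lemma eta_tangent:
  assumes "0 \<le> t" "0 < s" shows "eta t \<le> s - t - t * ln s"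
proof (cases "t = 0")
  case False
  with assms have "t > 0" by simp
  have "ln (s / t) \<le> s / t - 1" using \<open>t > 0\<close> assms by (intro ln_le_minus_one) auto
  then have "t * (ln s - ln t) \<le> t * (s / t - 1)"
    using \<open>t > 0\<close> assms by (simp add: ln_div)
  then show ?thesis using \<open>t > 0\<close> by (simp add: eta_def algebra_simps)
qed (use assms in auto)

lemma eta_sum_le:
  assumes "finite A" "\<And>i. i \<in> A \<Longrightarrow> 0 \<le> p i"
  shows "eta (\<Sum>i\<in>A. p i) \<le> (\<Sum>i\<in>A. eta (p i))"
proof -
  have "p i * ln (p i) \<le> p i * ln (\<Sum>i\<in>A. p i)" if "i \<in> A" for i
  proof (cases "p i = 0")
    case False
    then have "0 < p i" using assms that by force
    moreover have "p i \<le> (\<Sum>i\<in>A. p i)" using assms that by (intro member_le_sum) auto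
    ultimately show ?thesis by (intro mult_left_mono) auto
  qed simp
  then have "(\<Sum>i\<in>A. p i * ln (p i)) \<le> (\<Sum>i\<in>A. p i * ln (\<Sum>i\<in>A. p i))" by (rule sum_mono)
  then show ?thesis by (simp add: eta_def sum_negf sum_distrib_right)
qed

text \<open>The tangent of \<open>eta\<close> at the barycentre lies above its graph.\<close>

lemma eta_concave:
  assumes "finite A" "\<And>i. i \<in> A \<Longrightarrow> 0 \<le> w i" "(\<Sum>i\<in>A. w i) = 1" "\<And>i. i \<in> A \<Longrightarrow> 0 \<le> p i"
  shows "(\<Sum>i\<in>A. w i * eta (p i)) \<le> eta (\<Sum>i\<in>A. w i * p i)"
proof -
  define s where "s = (\<Sum>i\<in>A. w i * p i)"
  have "s \<ge> 0" unfolding s_def using assms by (intro sum_nonneg) auto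
  show ?thesis
  proof (cases "s = 0")
    case True
    then have "w i * p i = 0" if "i \<in> A" for i
      using that assms by (subst (asm) s_def, subst (asm) sum_nonneg_eq_0_iff) auto
    then have "(\<Sum>i\<in>A. w i * eta (p i)) = 0" by (intro sum.neutral) (auto simp: eta_def)
    then show ?thesis using True by (simp add: s_def)
  next
    case False
    with \<open>s \<ge> 0\<close> have "s > 0" by simp
    have "(\<Sum>i\<in>A. w i * eta (p i)) \<le> (\<Sum>i\<in>A. w i * (s - p i - p i * ln s))"
      using assms \<open>s > 0\<close> by (intro sum_mono mult_left_mono eta_tangent) auto
    also have "\<dots> = (\<Sum>i\<in>A. w i * s - w i * p i - (w i * p i) * ln s)"
      by (simp add: algebra_simps)
    also have "\<dots> = (\<Sum>i\<in>A. w i) * s - s - s * ln s"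
      by (simp only: sum_subtractf sum_distrib_right[symmetric] s_def[symmetric])
    also have "\<dots> = eta s" using assms by (simp add: eta_def)
    finally show ?thesis by (simp add: s_def)
  qed
qed

text \<open>\<open>eta_tangent\<close> at \<open>R * W i / Z\<close>, the multiple of
  \<open>W\<close> with the same total mass \<open>R\<close> as \<open>r\<close>; the linear terms
  then cancel in the sum. The masses need not add up to 1, which is what allows applying it to each
  level set of a conditioning function.\<close>

lemma gibbs:
  assumes "finite A" "\<And>i. i \<in> A \<Longrightarrow> 0 \<le> r i" "\<And>i. i \<in> A \<Longrightarrow> 0 < W i"
  shows "(\<Sum>i\<in>A. r i * ln (W i) + eta (r i)) \<le>
    (\<Sum>i\<in>A. r i) * ln (\<Sum>i\<in>A. W i) + eta (\<Sum>i\<in>A. r i)"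
proof (cases "(\<Sum>i\<in>A. r i) = 0")
  case True
  then have "r i = 0" if "i \<in> A" for i
    using that assms by (subst (asm) sum_nonneg_eq_0_iff) auto
  then show ?thesis by simp
next
  case False
  define R where "R = (\<Sum>i\<in>A. r i)"
  define Z where "Z = (\<Sum>i\<in>A. W i)"
  have "A \<noteq> {}" using False by auto
  have "Z > 0" unfolding Z_def using assms \<open>A \<noteq> {}\<close> by (intro sum_pos) auto
  have "R > 0" using False assms unfolding R_def by (simp add: order_less_le sum_nonneg)
  have "r i * ln (W i) + eta (r i) \<le> R * W i / Z - r i - r i * (ln R - ln Z)" if "i \<in> A" for i
  proof -
    have "W i > 0" using assms that by auto
    then have "ln (R * W i / Z) = ln R + ln (W i) - ln Z"
      using \<open>R > 0\<close> \<open>Z > 0\<close> by (simp add: ln_div ln_mult)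
    then have "r i * ln (R * W i / Z) = r i * ln R + r i * ln (W i) - r i * ln Z"
      by (simp only: distrib_left right_diff_distrib)
    moreover have "eta (r i) \<le> R * W i / Z - r i - r i * ln (R * W i / Z)"
      using assms(2)[OF that] \<open>W i > 0\<close> \<open>R > 0\<close> \<open>Z > 0\<close> by (intro eta_tangent) auto
    ultimately show ?thesis by (simp only: right_diff_distrib)
  qed
  then have "(\<Sum>i\<in>A. r i * ln (W i) + eta (r i)) \<le> (\<Sum>i\<in>A. R * W i / Z - r i - r i * (ln R - ln Z))"
    by (intro sum_mono) auto
  also have "\<dots> = R / Z * (\<Sum>i\<in>A. W i) - R - R * (ln R - ln Z)"
    by (simp add: sum_subtractf sum_distrib_left[symmetric] sum_distrib_right[symmetric]
        sum_divide_distrib[symmetric] R_def)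
  also have "\<dots> = R * ln Z + eta R"
    using \<open>Z > 0\<close> by (simp add: Z_def[symmetric] eta_def algebra_simps)
  finally show ?thesis by (simp add: R_def Z_def)
qed

text \<open>Nonnegativity of conditional mutual information. The tangent point
  \<open>q i j * r j k / s j\<close> is the law that makes the outer indices independent given
  \<open>j\<close>; for each \<open>j\<close> it has the same total mass as \<open>p\<close>, so
  nothing linear survives.\<close>

lemma strong_subadditivity_sums:
  fixes p :: "'i \<Rightarrow> 'j \<Rightarrow> 'k \<Rightarrow> real"
  assumes "finite A" "finite B" "finite C" and p: "\<And>i j k. 0 \<le> p i j k"
  shows "(\<Sum>i\<in>A. \<Sum>j\<in>B. \<Sum>k\<in>C. eta (p i j k)) + (\<Sum>j\<in>B. eta (\<Sum>i\<in>A. \<Sum>k\<in>C. p i j k))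
    \<le> (\<Sum>i\<in>A. \<Sum>j\<in>B. eta (\<Sum>k\<in>C. p i j k)) + (\<Sum>j\<in>B. \<Sum>k\<in>C. eta (\<Sum>i\<in>A. p i j k))"
proof -
  define q where "q i j = (\<Sum>k\<in>C. p i j k)" for i j
  define r where "r j k = (\<Sum>i\<in>A. p i j k)" for j k
  define s where "s j = (\<Sum>i\<in>A. \<Sum>k\<in>C. p i j k)" for j
  have s_q: "(\<Sum>i\<in>A. q i j) = s j" and s_r: "(\<Sum>k\<in>C. r j k) = s j" for j
    by (simp_all add: q_def s_def r_def sum.swap[of _ C A])
  have nn: "0 \<le> q i j" "0 \<le> r j k" "0 \<le> s j" for i j k
    unfolding q_def r_def s_def using p by (auto intro!: sum_nonneg)
  have key: "p i j k * (ln (q i j) + ln (r j k) - ln (s j)) + eta (p i j k)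
      \<le> q i j * r j k / s j - p i j k" if "i \<in> A" "k \<in> C" for i j k
  proof (cases "p i j k = 0")
    case False
    then have "0 < p i j k" using p[of i j k] by simp
    moreover have "p i j k \<le> q i j" unfolding q_def using assms that by (intro member_le_sum) auto
    moreover have "p i j k \<le> r j k" unfolding r_def
      using assms that by (intro member_le_sum[of i A "\<lambda>i. p i j k"]) auto
    moreover have "q i j \<le> s j" unfolding s_q[symmetric]
      using assms that nn by (intro member_le_sum[of i A "\<lambda>i. q i j"]) auto
    ultimately have pos: "0 < q i j" "0 < r j k" "0 < s j" by linarith+
    then show ?thesis using eta_tangent[of "p i j k" "q i j * r j k / s j"] p
      by (simp add: ln_div ln_mult algebra_simps)
  qed (use nn in simp)
  have eq1: "(\<Sum>i\<in>A. \<Sum>j\<in>B. \<Sum>k\<in>C. p i j k * ln (q i j)) = - (\<Sum>i\<in>A. \<Sum>j\<in>B. eta (q i j))"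
    by (simp add: eta_def q_def sum_distrib_right sum_negf)
  have eq2: "(\<Sum>i\<in>A. \<Sum>j\<in>B. \<Sum>k\<in>C. p i j k * ln (r j k)) = - (\<Sum>j\<in>B. \<Sum>k\<in>C. eta (r j k))"
  proof -
    have "(\<Sum>i\<in>A. \<Sum>j\<in>B. \<Sum>k\<in>C. p i j k * ln (r j k)) = (\<Sum>j\<in>B. \<Sum>k\<in>C. \<Sum>i\<in>A. p i j k * ln (r j k))"
      by (subst sum.swap) (intro sum.cong refl, subst sum.swap, simp)
    then show ?thesis by (simp add: eta_def r_def sum_distrib_right sum_negf)
  qed
  have eq3: "(\<Sum>i\<in>A. \<Sum>j\<in>B. \<Sum>k\<in>C. p i j k * ln (s j)) = - (\<Sum>j\<in>B. eta (s j))"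
    by (subst sum.swap) (simp add: eta_def s_def sum_distrib_right sum_negf)
  have "(\<Sum>i\<in>A. \<Sum>j\<in>B. \<Sum>k\<in>C. p i j k * (ln (q i j) + ln (r j k) - ln (s j)) + eta (p i j k))
      \<le> (\<Sum>i\<in>A. \<Sum>j\<in>B. \<Sum>k\<in>C. q i j * r j k / s j - p i j k)"
    by (intro sum_mono key) auto
  also have "\<dots> = (\<Sum>j\<in>B. (\<Sum>i\<in>A. q i j) * (\<Sum>k\<in>C. r j k) / s j - s j)"
    unfolding s_def
    by (subst sum.swap, intro sum.cong refl)
       (simp add: sum_subtractf sum_product sum_divide_distrib)
  also have "\<dots> = 0" by (intro sum.neutral) (simp add: s_q s_r)
  finally show ?thesis
    unfolding s_def[symmetric]
    unfolding q_def[symmetric] r_def[symmetric]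
    using eq1 eq2 eq3
    by (simp only: sum.distrib sum_subtractf distrib_left right_diff_distrib)
qed

section \<open>Shannon entropy of simple functions\<close>

text \<open>Functions instead of partitions: a join becomes a pair, and refinement becomes
  functional dependence.\<close>

definition ent :: "'x measure \<Rightarrow> ('x \<Rightarrow> 'b) \<Rightarrow> real" where
  "ent M f = (\<Sum>b\<in>f ` space M. eta (measure M {x\<in>space M. f x = b}))"

lemma ent_superset:
  assumes "finite B" "f ` space M \<subseteq> B"
  shows "ent M f = (\<Sum>b\<in>B. eta (measure M {x\<in>space M. f x = b}))"
  unfolding ent_def
proof (rule sum.mono_neutral_left[OF assms], intro ballI)
  fix b assume "b \<in> B - f ` space M"
  then have "{x\<in>space M. f x = b} = {}" by auto
  then show "eta (measure M {x\<in>space M. f x = b}) = 0" by (simp only: measure_empty eta_0)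
qed

lemma ent_distr:
  assumes "f \<in> measurable M N" "simple_function N g" "\<And>x. x \<in> space N \<Longrightarrow> x \<in> space N"
  shows "ent (distr M N f) g = ent M (\<lambda>x. g (f x))"
proof -
  have fin: "finite (g ` space N)" using assms(2) by (rule simple_functionD)
  have sub: "(\<lambda>x. g (f x)) ` space M \<subseteq> g ` space N"
    using measurable_space[OF assms(1)] by auto
  have "measure (distr M N f) {x\<in>space N. g x = b} = measure M {x\<in>space M. g (f x) = b}" for b
  proof -
    have "{x\<in>space N. g x = b} = g -` {b} \<inter> space N" by auto
    then have "{x\<in>space N. g x = b} \<in> sets N" using simple_functionD(2)[OF assms(2)] by metis
    then have "measure (distr M N f) {x\<in>space N. g x = b} = measure M (f -` {x\<in>space N. g x = b} \<inter> space M)"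
      using assms(1) by (simp add: measure_distr)
    also have "f -` {x\<in>space N. g x = b} \<inter> space M = {x\<in>space M. g (f x) = b}"
      using measurable_space[OF assms(1)] by auto
    finally show ?thesis .
  qed
  then show ?thesis unfolding ent_superset[OF fin sub] by (simp add: ent_def)
qed

lemma simple_function_level_set: "simple_function M f \<Longrightarrow> {x\<in>space M. f x = b} \<in> sets M"
  using simple_functionD(2)[of M f "{b}"] by (simp add: vimage_def Int_def conj_commute)

context prob_space
begin

lemma sum_marginal:
  assumes "simple_function M f" "simple_function M g" "finite B" "f ` space M \<subseteq> B"
  shows "(\<Sum>b\<in>B. prob {x\<in>space M. f x = b \<and> g x = c}) = prob {x\<in>space M. g x = c}"
proof -
  have "{x\<in>space M. f x = b \<and> g x = c} = {x\<in>space M. f x = b} \<inter> {x\<in>space M. g x = c}" for b by auto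
  then have meas: "{x\<in>space M. f x = b \<and> g x = c} \<in> events" for b
    using simple_function_level_set[OF assms(1)] simple_function_level_set[OF assms(2)] by auto
  have "prob (\<Union>b\<in>B. {x\<in>space M. f x = b \<and> g x = c}) = (\<Sum>b\<in>B. prob {x\<in>space M. f x = b \<and> g x = c})"
    by (rule finite_measure_finite_Union) (use assms meas in \<open>auto simp: disjoint_family_on_def\<close>)
  moreover have "(\<Union>b\<in>B. {x\<in>space M. f x = b \<and> g x = c}) = {x\<in>space M. g x = c}"
    using assms(4) by auto
  ultimately show ?thesis by simp
qed

lemma sum_prob_level:
  assumes "simple_function M f" "finite B" "f ` space M \<subseteq> B"
  shows "(\<Sum>b\<in>B. prob {x\<in>space M. f x = b}) = 1"
  using sum_marginal[OF assms(1) simple_function_const[of M "()"] assms(2,3), of "()"]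
  by (simp add: prob_space)

lemma ent_nonneg: "0 \<le> ent M f"
  unfolding ent_def by (intro sum_nonneg eta_nonneg) auto

lemma ent_le_ln_card:
  assumes "simple_function M f" "finite B" "f ` space M \<subseteq> B"
  shows "ent M f \<le> ln (real (card B))"
proof -
  have "(\<Sum>b\<in>B. prob {x\<in>space M. f x = b} * ln 1 + eta (prob {x\<in>space M. f x = b})) \<le> ln (real (card B))"
    using gibbs[of B "\<lambda>b. prob {x\<in>space M. f x = b}" "\<lambda>_. 1"] assms by (simp add: sum_prob_level)
  then show ?thesis by (simp add: ent_superset[OF assms(2,3)])
qed

text \<open>On a level set of \<open>g\<close> only one value of \<open>f\<close> occurs. Splitting
  the level sets of \<open>f\<close> by \<open>g\<close> therefore yields just the level sets of
  \<open>g\<close>, and splitting never lowers the sum of \<open>eta\<close>.\<close>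

lemma ent_mono:
  assumes f: "simple_function M f" and g: "simple_function M g"
    and det: "\<And>x y. x \<in> space M \<Longrightarrow> y \<in> space M \<Longrightarrow> g x = g y \<Longrightarrow> f x = f y"
  shows "ent M f \<le> ent M g"
proof -
  let ?P = "\<lambda>b c. prob {x\<in>space M. f x = b \<and> g x = c}"
  note fin = simple_functionD(1)[OF f] simple_functionD(1)[OF g]
  have "ent M f = (\<Sum>b\<in>f ` space M. eta (\<Sum>c\<in>g ` space M. ?P b c))"
    unfolding ent_def using sum_marginal[OF g f fin(2) order_refl] by (simp add: conj_commute)
  also have "\<dots> \<le> (\<Sum>b\<in>f ` space M. \<Sum>c\<in>g ` space M. eta (?P b c))"
    using fin by (intro sum_mono eta_sum_le) auto
  also have "\<dots> = (\<Sum>c\<in>g ` space M. \<Sum>b\<in>f ` space M. eta (?P b c))" by (rule sum.swap)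
  also have "\<dots> = (\<Sum>c\<in>g ` space M. eta (prob {x\<in>space M. g x = c}))"
  proof (intro sum.cong refl)
    fix c assume "c \<in> g ` space M"
    then obtain z where z: "z \<in> space M" "c = g z" by auto
    have "eta (?P b c) = (if b = f z then eta (prob {x\<in>space M. g x = c}) else 0)" for b
    proof (cases "b = f z")
      case True
      have "{x\<in>space M. f x = b \<and> g x = c} = {x\<in>space M. g x = c}"
        using det[OF _ z(1)] z True by blast
      with True show ?thesis by simp
    next
      case False
      then have "{x\<in>space M. f x = b \<and> g x = c} = {}" using det[OF _ z(1)] z by blast
      then have "?P b c = 0" by (simp only: measure_empty)
      with False show ?thesis by simp
    qed
    then show "(\<Sum>b\<in>f ` space M. eta (?P b c)) = eta (prob {x\<in>space M. g x = c})"
      using fin z by (simp add: sum.delta)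
  qed
  finally show ?thesis by (simp add: ent_def)
qed

lemma ent_eq:
  assumes "simple_function M f" "simple_function M g"
    and "\<And>x y. x \<in> space M \<Longrightarrow> y \<in> space M \<Longrightarrow> g x = g y \<longleftrightarrow> f x = f y"
  shows "ent M f = ent M g"
  using assms by (intro antisym ent_mono) auto

lemma ent_strong_subadditive:
  assumes f: "simple_function M f" and g: "simple_function M g" and k: "simple_function M k"
  shows "ent M (\<lambda>x. (f x, g x, k x)) + ent M g \<le> ent M (\<lambda>x. (f x, g x)) + ent M (\<lambda>x. (g x, k x))"
proof -
  define A where "A = f ` space M"
  define B where "B = g ` space M"
  define C where "C = k ` space M"
  have fin: "finite A" "finite B" "finite C"
    using f g k by (auto simp: A_def B_def C_def dest: simple_functionD)
  define p where "p a b c = prob {x\<in>space M. f x = a \<and> g x = b \<and> k x = c}" for a b c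
  note sp = simple_function_Pair
  have pc: "(\<Sum>c\<in>C. p a b c) = prob {x\<in>space M. f x = a \<and> g x = b}" for a b
    using sum_marginal[OF k sp[OF f g] fin(3), of "(a, b)"] by (simp add: p_def C_def conj_ac)
  have pa: "(\<Sum>a\<in>A. p a b c) = prob {x\<in>space M. g x = b \<and> k x = c}" for b c
    using sum_marginal[OF f sp[OF g k] fin(1), of "(b, c)"] by (simp add: p_def A_def conj_ac)
  have pac: "(\<Sum>a\<in>A. \<Sum>c\<in>C. p a b c) = prob {x\<in>space M. g x = b}" for b
    using sum_marginal[OF f g fin(1), of b] by (simp add: pc A_def)
  have "ent M (\<lambda>x. (f x, g x, k x)) = (\<Sum>a\<in>A. \<Sum>b\<in>B. \<Sum>c\<in>C. eta (p a b c))"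
    by (subst ent_superset[of "A \<times> B \<times> C"])
       (use fin in \<open>auto simp: A_def B_def C_def p_def sum.cartesian_product split_beta prod_eq_iff\<close>)
  moreover have "ent M g = (\<Sum>b\<in>B. eta (\<Sum>a\<in>A. \<Sum>c\<in>C. p a b c))"
    by (simp add: pac ent_def B_def)
  moreover have "ent M (\<lambda>x. (f x, g x)) = (\<Sum>a\<in>A. \<Sum>b\<in>B. eta (\<Sum>c\<in>C. p a b c))"
    by (subst ent_superset[of "A \<times> B"])
       (use fin in \<open>auto simp: A_def B_def pc sum.cartesian_product split_beta prod_eq_iff\<close>)
  moreover have "ent M (\<lambda>x. (g x, k x)) = (\<Sum>b\<in>B. \<Sum>c\<in>C. eta (\<Sum>a\<in>A. p a b c))"
    by (subst ent_superset[of "B \<times> C"])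
       (use fin in \<open>auto simp: B_def C_def pa sum.cartesian_product split_beta prod_eq_iff\<close>)
  ultimately show ?thesis
    using strong_subadditivity_sums[OF fin, of p] by (simp add: p_def)
qed

lemma ent_Pair_le:
  assumes "simple_function M f" "simple_function M g"
  shows "ent M (\<lambda>x. (f x, g x)) \<le> ent M f + ent M g"
proof -
  have s: "simple_function M (\<lambda>x. ())" by simp
  have "ent M (\<lambda>x. (f x, (), g x)) + ent M (\<lambda>x. ()) \<le> ent M (\<lambda>x. (f x, ())) + ent M (\<lambda>x. ((), g x))"
    by (rule ent_strong_subadditive) (use assms in auto)
  moreover have "ent M (\<lambda>x. (f x, (), g x)) = ent M (\<lambda>x. (f x, g x))"
    "ent M (\<lambda>x. (f x, ())) = ent M f" "ent M (\<lambda>x. ((), g x)) = ent M g"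
    using assms by (auto intro!: ent_eq)
  ultimately show ?thesis using ent_nonneg[of "\<lambda>x. ()"] by simp
qed

end

section \<open>Conditional entropy\<close>

definition cond_ent :: "'x measure \<Rightarrow> ('x \<Rightarrow> 'b) \<Rightarrow> ('x \<Rightarrow> 'c) \<Rightarrow> real" where
  "cond_ent M f g = ent M (\<lambda>x. (f x, g x)) - ent M g"

context prob_space
begin

text \<open>Strong sub-additivity for \<open>f\<close>, \<open>g\<close>, \<open>k\<close>, where
  the pair \<open>(g, k)\<close> carries no more information than \<open>k\<close>.\<close>

lemma cond_ent_mono:
  assumes f: "simple_function M f" and g: "simple_function M g" and k: "simple_function M k"
    and det: "\<And>x y. x \<in> space M \<Longrightarrow> y \<in> space M \<Longrightarrow> k x = k y \<Longrightarrow> g x = g y"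
  shows "cond_ent M f k \<le> cond_ent M f g"
proof -
  have "ent M (\<lambda>x. (f x, g x, k x)) = ent M (\<lambda>x. (f x, k x))"
    using f g k by (intro ent_eq) (auto, metis det)
  moreover have "ent M (\<lambda>x. (g x, k x)) = ent M k"
    using f g k by (intro ent_eq) (auto, metis det)
  ultimately show ?thesis
    using ent_strong_subadditive[OF f g k] by (simp add: cond_ent_def)
qed

text \<open>The chain rule, adding one \<open>f j\<close> at a time. Its cost given all earlier
  entries and \<open>G\<close> is at most its cost given \<open>g j\<close>, because
  \<open>G\<close> determines \<open>g j\<close>. Simplicity of the list-valued map is proved along
  in the same induction.\<close>

lemma ent_blocks_le:
  fixes f :: "nat \<Rightarrow> 'a \<Rightarrow> 'b"
  assumes f: "\<And>j. j < k \<Longrightarrow> simple_function M (f j)"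
    and g: "\<And>j. j < k \<Longrightarrow> simple_function M (g j)" and G: "simple_function M G"
    and det: "\<And>j x y. j < k \<Longrightarrow> x \<in> space M \<Longrightarrow> y \<in> space M \<Longrightarrow> G x = G y \<Longrightarrow> g j x = g j y"
  shows "simple_function M (\<lambda>x. map (\<lambda>j. f j x) [0..<k]) \<and>
    ent M (\<lambda>x. (map (\<lambda>j. f j x) [0..<k], G x)) \<le> ent M G + (\<Sum>j<k. cond_ent M (f j) (g j))"
  using f g det
proof (induction k)
  case 0
  have "ent M (\<lambda>x. ([] :: 'b list, G x)) = ent M G" by (rule ent_eq) (use G in auto)
  then show ?case by simp
next
  case (Suc k)
  let ?F = "\<lambda>k x. map (\<lambda>j. f j x) [0..<k]"
  have IH: "simple_function M (?F k)"
    "ent M (\<lambda>x. (?F k x, G x)) \<le> ent M G + (\<Sum>j<k. cond_ent M (f j) (g j))"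
    using Suc.IH[OF Suc.prems(1)[OF less_SucI] Suc.prems(2)[OF less_SucI] Suc.prems(3)[OF less_SucI]]
    by blast+
  have fk: "simple_function M (f k)" and gk: "simple_function M (g k)" using Suc.prems by auto
  have FS: "simple_function M (?F (Suc k))"
  proof -
    have "simple_function M (\<lambda>x. ?F k x @ [f k x])"
      by (rule simple_function_compose2[where h="\<lambda>l a. l @ [a]", OF IH(1) fk])
    then show ?thesis by simp
  qed
  have FG: "simple_function M (\<lambda>x. (?F k x, G x))" using IH G by auto
  have e1: "ent M (\<lambda>x. (?F (Suc k) x, G x)) = ent M (\<lambda>x. (f k x, (?F k x, G x)))"
    by (intro ent_eq simple_function_Pair FS FG G fk) auto
  have e2: "cond_ent M (f k) (\<lambda>x. (?F k x, G x)) \<le> cond_ent M (f k) (g k)"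
    by (rule cond_ent_mono[OF fk gk FG], rule Suc.prems(3)[of k]) simp_all
  have "ent M (\<lambda>x. (?F (Suc k) x, G x)) \<le> ent M G + (\<Sum>j<Suc k. cond_ent M (f j) (g j))"
    unfolding sum.lessThan_Suc e1 using e2[unfolded cond_ent_def[of M "f k" "\<lambda>x. (?F k x, G x)"]] IH(2)
    by linarith
  with FS show ?case by (rule conjI)
qed

end

section \<open>Prefixes and cylinders\<close>

definition pre :: "nat \<Rightarrow> (nat \<Rightarrow> 'a) \<Rightarrow> 'a list" where "pre n x = map x [0..<n]"

lemma length_pre [simp]: "length (pre n x) = n" and nth_pre [simp]: "i < n \<Longrightarrow> pre n x ! i = x i"
  by (simp_all add: pre_def)

lemma pre_eq_iff: "pre n x = pre n y \<longleftrightarrow> (\<forall>i<n. x i = y i)"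
  by (auto simp: pre_def)

lemma pre_eq_mono: "pre n x = pre n y \<Longrightarrow> m \<le> n \<Longrightarrow> pre m x = pre m y"
  by (simp add: pre_eq_iff)

lemma in_cylinder_iff: "x \<in> cylinder I \<longleftrightarrow> pre (length I) x = I"
  unfolding cylinder_def list_eq_iff_nth_eq[of "pre (length I) x"] by simp

lemma shift_pow_apply: "(left_shift ^^ i) x j = x (i + j)"
  by (induction i arbitrary: j) (simp_all add: left_shift_def[of "(left_shift ^^ _) x"])

lemma finite_words: "finite {I :: 'a::finite list. length I = n}"
  using finite_lists_length_eq[of "UNIV :: 'a set" n] by (simp only: finite subset_UNIV simp_thms)

lemma card_words: "card {I :: 'a::finite list. length I = n} = CARD('a) ^ n"
  using card_lists_length_eq[of "UNIV :: 'a set" n] by (simp only: finite subset_UNIV simp_thms)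

lemma pre_shift_eq: "pre l ((left_shift ^^ i) x) = pre l ((left_shift ^^ i) y)" if "pre n x = pre n y" "i + l \<le> n"
  using that by (auto simp: pre_eq_iff shift_pow_apply)

lemma continuous_on_shift_pow: "continuous_on S (left_shift ^^ i)"
  by (rule continuous_on_coordinatewise_then_product)
     (use continuous_on_subset[OF continuous_on_product_coordinates] in \<open>simp add: shift_pow_apply\<close>)

lemma continuous_on_left_shift: "continuous_on S left_shift"
  using continuous_on_shift_pow[of S 1] by simp

lemma open_pre:
  fixes P :: "'a::{finite, discrete_topology} list \<Rightarrow> bool"
  shows "open {x. P (pre n x)}"
proof -
  have *: "open {x :: nat \<Rightarrow> 'a. pre n x = pre n z}" for z
  proof -
    have "{x :: nat \<Rightarrow> 'a. pre n x = pre n z} = (\<Inter>i\<in>{..<n}. (\<lambda>x. x i) -` {z i})"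
      by (auto simp: pre_eq_iff)
    moreover have "open ((\<lambda>x. x i) -` {z i})" for i
      using continuous_on_open_vimage[OF open_UNIV, THEN iffD1, OF continuous_on_product_coordinates[of i],
        rule_format, OF discrete_topology_class.open_discrete[of "{z i}"]] by simp
    ultimately show ?thesis by auto
  qed
  have eq: "{x. P (pre n x)} = (\<Union>z\<in>{z. P (pre n z)}. {x. pre n x = pre n z})" by auto
  show ?thesis by (rule ssubst[OF eq]) (intro open_UN ballI *)
qed

lemma closed_pre:
  fixes P :: "'a::{finite, discrete_topology} list \<Rightarrow> bool"
  shows "closed {x. P (pre n x)}"
proof -
  have "- {x. P (pre n x)} = {x. \<not> P (pre n x)}" by auto
  then show ?thesis using open_pre[of "\<lambda>I. \<not> P I" n] by (simp add: closed_def)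
qed

lemma open_contains_cylinder:
  fixes U :: "(nat \<Rightarrow> 'a::{finite, discrete_topology}) set"
  assumes "open U" "x \<in> U"
  shows "\<exists>n. \<forall>y. pre n y = pre n x \<longrightarrow> y \<in> U"
proof -
  have "openin (product_topology (\<lambda>i. euclidean) UNIV) U"
    using assms by (simp add: euclidean_product_topology)
  from product_topology_open_contains_basis[OF this assms(2)]
  obtain V where V: "x \<in> PiE UNIV V" "finite {i. V i \<noteq> (UNIV :: 'a set)}" "PiE UNIV V \<subseteq> U"
    by auto
  obtain n where n: "\<And>i. V i \<noteq> UNIV \<Longrightarrow> i < n"
    using finite_nat_set_iff_bounded[THEN iffD1, OF V(2)] by auto
  have "y \<in> U" if "pre n y = pre n x" for y
  proof -
    have "y i \<in> V i" for i
      using n[of i] that V(1) by (cases "V i = UNIV") (auto simp: pre_eq_iff PiE_iff)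
    then show ?thesis using V(3) by (auto simp: PiE_iff)
  qed
  then show ?thesis by blast
qed

text \<open>There are countably many words, so an open set is a countable union of
  cylinders.\<close>

lemma borel_seq_eq:
  "sets (borel :: (nat \<Rightarrow> 'a::{finite, discrete_topology}) measure) = sigma_sets UNIV (range cylinder)"
proof -
  have 1: "U \<in> sigma_sets UNIV (range cylinder)" if "open U" for U :: "(nat \<Rightarrow> 'a) set"
  proof -
    have "U = (\<Union>I\<in>{I. cylinder I \<subseteq> U}. cylinder I)"
    proof (intro equalityI subsetI)
      fix x assume "x \<in> U"
      from open_contains_cylinder[OF that this] obtain n where "\<And>y. pre n y = pre n x \<Longrightarrow> y \<in> U" by blast
      then have "cylinder (pre n x) \<subseteq> U" "x \<in> cylinder (pre n x)" by (auto simp: in_cylinder_iff)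
      then show "x \<in> (\<Union>I\<in>{I. cylinder I \<subseteq> U}. cylinder I)" by blast
    qed auto
    moreover have "(\<Union>I\<in>{I. cylinder I \<subseteq> U}. cylinder I) \<in> sigma_sets UNIV (range cylinder)"
      by (rule sigma_sets_UNION) (blast intro: sigma_sets.Basic countableI_type countable_image)+
    ultimately show ?thesis
      by (rule ssubst[where P="\<lambda>V. V \<in> sigma_sets UNIV (range cylinder)"])
  qed
  have 2: "open (cylinder I)" for I :: "'a list"
  proof -
    have "cylinder I = {x. pre (length I) x = I}" using in_cylinder_iff by blast
    then show ?thesis using open_pre[of "\<lambda>J. J = I" "length I"] by (rule ssubst)
  qed
  have "sigma_sets (UNIV :: (nat \<Rightarrow> 'a) set) {S. open S} = sigma_sets UNIV (range cylinder)"
    by (intro sigma_sets_eqI) (simp add: 1, metis 2 imageE mem_Collect_eq sigma_sets.Basic)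
  then show ?thesis by (simp only: sets_borel)
qed

text \<open>Sets decided by the first \<open>n\<close> coordinates are clopen and form an algebra
  that generates the Borel sets. They are the test sets for approximation, for equality of measures
  and for limits.\<close>

definition cyl_set :: "nat \<Rightarrow> (nat \<Rightarrow> 'a) set \<Rightarrow> bool" where
  "cyl_set n C \<longleftrightarrow> (\<forall>x y. pre n x = pre n y \<longrightarrow> x \<in> C \<longrightarrow> y \<in> C)"

lemma cyl_setI: "(\<And>x y. pre n x = pre n y \<Longrightarrow> x \<in> C \<Longrightarrow> y \<in> C) \<Longrightarrow> cyl_set n C"
  unfolding cyl_set_def by (intro allI impI)

lemma cyl_setD: "cyl_set n C \<Longrightarrow> pre n x = pre n y \<Longrightarrow> x \<in> C \<longleftrightarrow> y \<in> C"
  unfolding cyl_set_def by (intro iffI) (metis+)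

lemma cyl_set_mono: "cyl_set n C \<Longrightarrow> n \<le> m \<Longrightarrow> cyl_set m C"
  by (rule cyl_setI) (drule pre_eq_mono, assumption, drule cyl_setD, assumption, simp)

lemma cyl_set_Compl: "cyl_set n C \<Longrightarrow> cyl_set n (- C)"
  by (rule cyl_setI) (drule cyl_setD, assumption, simp)

lemma cyl_set_UN:
  assumes "\<And>i. i \<in> A \<Longrightarrow> cyl_set n (C i)"
  shows "cyl_set n (\<Union>i\<in>A. C i)"
proof (rule cyl_setI)
  fix x y :: "nat \<Rightarrow> 'b"
  assume xy: "pre n x = pre n y" "x \<in> (\<Union>i\<in>A. C i)"
  then obtain i where "i \<in> A" "x \<in> C i" by auto
  then show "y \<in> (\<Union>i\<in>A. C i)" using cyl_setD[OF assms xy(1)] by auto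
qed

lemma cyl_set_Int:
  assumes "cyl_set n C" "cyl_set n D"
  shows "cyl_set n (C \<inter> D)"
  by (rule cyl_setI) (frule cyl_setD[OF assms(1)], drule cyl_setD[OF assms(2)], simp)

lemma cyl_set_Collect: "cyl_set n {x. P (pre n x)}"
  by (rule cyl_setI) simp

lemma cyl_set_pre: "cyl_set n C \<Longrightarrow> x \<in> C \<longleftrightarrow> pre n x \<in> pre n ` C"
  by (rule iffI, erule imageI, erule imageE, drule cyl_setD, assumption, simp)

lemma
  fixes C :: "(nat \<Rightarrow> 'a::{finite, discrete_topology}) set"
  assumes "cyl_set n C"
  shows open_cyl_set: "open C" and closed_cyl_set: "closed C"
proof -
  have eq: "C = {x. pre n x \<in> pre n ` C}" using cyl_set_pre[OF assms] by blast
  show "open C" by (rule ssubst[OF eq, where P="open"]) (rule open_pre)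
  show "closed C" by (rule ssubst[OF eq, where P=closed]) (rule closed_pre)
qed

section \<open>Borel measures on sets of sequences\<close>

locale seq_prob = prob_space M
  for X :: "(nat \<Rightarrow> 'a::{finite, discrete_topology}) set" and M :: "(nat \<Rightarrow> 'a) measure" +
  assumes sets_M: "sets M = sets (restrict_space borel X)"
begin

lemma space_M: "space M = X"
  using sets_eq_imp_space_eq[OF sets_M] by (simp add: space_restrict_space)

lemma borel_Int_in_sets: "A \<in> sets borel \<Longrightarrow> X \<inter> A \<in> sets M"
  by (simp add: sets_M sets_restrict_space)

lemma measurable_continuous_on:
  "continuous_on X f \<Longrightarrow> f \<in> M \<rightarrow>\<^sub>M borel"
  using borel_measurable_continuous_on_restrict[of X f] measurable_cong_sets[OF sets_M refl] by auto

lemma simple_function_pre: "simple_function M (\<lambda>x. f (pre n x))"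
proof -
  have "finite (f ` {I. length I = n})" using finite_words by blast
  then have "finite ((\<lambda>x. f (pre n x)) ` space M)" by (rule finite_subset[rotated]) auto
  moreover have "(\<lambda>x. f (pre n x)) -` {b} \<inter> space M \<in> sets M" for b
  proof -
    have "(\<lambda>x. f (pre n x)) -` {b} \<inter> space M = X \<inter> {x. f (pre n x) = b}" by (auto simp: space_M)
    then show ?thesis using open_pre[of "\<lambda>I. f I = b" n] by (auto intro!: borel_Int_in_sets)
  qed
  ultimately show ?thesis by (simp add: simple_function_def)
qed

text \<open>The sets that can be approximated form a \<sigma>-algebra. For a union, half of the
  tolerance pays for cutting to finitely many sets, and the other half is divided among their
  approximations.\<close>

lemma approx_by_cyl_set:
  assumes "B \<in> sets borel" "\<delta> > 0"
  shows "\<exists>n C. cyl_set n C \<and> measure M (X \<inter> (sym_diff B C)) < \<delta>"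
proof -
  have "B \<in> sigma_sets UNIV (range cylinder)" using assms(1) by (simp add: borel_seq_eq)
  then show ?thesis using assms(2)
  proof (induction arbitrary: \<delta> rule: sigma_sets.induct)
    case (Basic a)
    then obtain I where "a = cylinder I" by auto
    then have "cyl_set (length I) a" by (auto simp: cyl_set_def in_cylinder_iff)
    then show ?case using Basic(2) by (intro exI[of _ "length I"] exI[of _ a]) auto
  next
    case Empty
    then show ?case by (intro exI[of _ 0] exI[of _ "{}"]) (auto simp: cyl_set_def)
  next
    case (Compl a)
    then obtain n C where "cyl_set n C" "measure M (X \<inter> (sym_diff a C)) < \<delta>" by blast
    moreover have "sym_diff (UNIV - a) (- C) = sym_diff a C" by auto
    ultimately show ?case by (intro exI[of _ n] exI[of _ "- C"]) (auto simp: cyl_set_Compl)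
  next
    case (Union a)
    have a: "a i \<in> sets borel" for i using Union.hyps by (simp add: borel_seq_eq)
    define A where "A k = X \<inter> (\<Union>i<k. a i)" for k :: nat
    have A: "A k \<in> sets M" for k unfolding A_def using a by (intro borel_Int_in_sets) auto
    have U: "(\<Union>k. A k) = X \<inter> (\<Union>i. a i)" by (auto simp: A_def)
    have XU: "X \<inter> (\<Union>i. a i) \<in> sets M" using a by (intro borel_Int_in_sets) auto
    have "(\<lambda>k. measure M (A k)) \<longlonglongrightarrow> measure M (\<Union>k. A k)"
    proof (rule finite_Lim_measure_incseq)
      show "incseq A" unfolding incseq_def A_def by (intro allI impI Int_mono UN_mono) auto
    qed (use A in auto)
    then have "eventually (\<lambda>k. measure M (A k) > measure M (X \<inter> (\<Union>i. a i)) - \<delta> / 2) sequentially"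
      using Union.prems by (intro order_tendstoD(1)) (auto simp: U)
    then obtain k where k: "measure M (A k) > measure M (X \<inter> (\<Union>i. a i)) - \<delta> / 2"
      by (auto simp: eventually_sequentially)
    \<comment> \<open>\<open>Suc k\<close> keeps the tolerance meaningful when \<open>k\<close> is
      0.\<close>
    have "\<exists>n C. cyl_set n C \<and> measure M (X \<inter> (sym_diff (a i) C)) < \<delta> / (2 * real (Suc k))" for i
      by (rule Union.IH) (use Union.prems in simp)
    then obtain n C where nC: "\<And>i. cyl_set (n i) (C i)"
      "\<And>i. measure M (X \<inter> (sym_diff (a i) (C i))) < \<delta> / (2 * real (Suc k))"
      by metis
    define N where "N = Max (n ` {..k})"
    define D where "D = (\<Union>i<k. C i)"
    have "cyl_set N D" unfolding D_def
      by (intro cyl_set_UN cyl_set_mono[OF nC(1)]) (auto simp: N_def)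
    have Cb: "C i \<in> sets borel" for i using open_cyl_set[OF nC(1)] by auto
    have sd: "X \<inter> sym_diff (a i) (C i) \<in> sets M" for i
      using a Cb by (intro borel_Int_in_sets) auto
    have "X \<inter> sym_diff (\<Union>i. a i) D \<subseteq> (X \<inter> (\<Union>i. a i) - A k) \<union> (\<Union>i<k. X \<inter> sym_diff (a i) (C i))"
      by (auto simp: A_def D_def)
    then have "measure M (X \<inter> sym_diff (\<Union>i. a i) D) \<le>
        measure M ((X \<inter> (\<Union>i. a i) - A k) \<union> (\<Union>i<k. X \<inter> sym_diff (a i) (C i)))"
      by (intro finite_measure_mono sets.Un sets.Diff sets.finite_UN A XU sd) auto
    also have "\<dots> \<le> measure M (X \<inter> (\<Union>i. a i) - A k) + measure M (\<Union>i<k. X \<inter> sym_diff (a i) (C i))"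
      by (intro measure_Un_le sets.Diff sets.finite_UN A XU sd) auto
    also have "measure M (X \<inter> (\<Union>i. a i) - A k) = measure M (X \<inter> (\<Union>i. a i)) - measure M (A k)"
      using A XU by (intro finite_measure_Diff) (auto simp: A_def)
    also have "measure M (\<Union>i<k. X \<inter> sym_diff (a i) (C i)) \<le> (\<Sum>i<k. measure M (X \<inter> sym_diff (a i) (C i)))"
      using sd by (intro finite_measure_subadditive_finite) auto
    also have "\<dots> \<le> (\<Sum>i<k. \<delta> / (2 * real (Suc k)))"
      by (intro sum_mono less_imp_le nC)
    also have "\<dots> \<le> \<delta> / 2" using Union.prems by (simp add: field_simps)
    finally have "measure M (X \<inter> sym_diff (\<Union>i. a i) D) < \<delta>" using k by linarith
    with \<open>cyl_set N D\<close> show ?case by blast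
  qed
qed

end

text \<open>If each event \<open>f x = b\<close> almost coincides with an event
  \<open>g x \<in> S b\<close>, then little information on \<open>f\<close> is missing once
  \<open>g\<close> is known. On a level set of \<open>g\<close> with mass \<open>P c\<close> the
  tangent is taken at \<open>P c\<close> when \<open>c \<in> S b\<close> and at
  \<open>s * P c\<close> otherwise; \<open>s \<le> exp (- 1)\<close> makes \<open>- ln s\<close> at
  least 1, so that both cases obey the same bound.\<close>

lemma (in prob_space) cond_ent_le:
  assumes f: "simple_function M f" and g: "simple_function M g" and s: "0 < s" "s \<le> exp (- 1)"
  shows "cond_ent M f g \<le>
    (\<Sum>b\<in>f ` space M. s - ln s * prob {x\<in>space M. (f x = b) \<noteq> (g x \<in> S b)})"
proof -
  define B where "B = f ` space M"
  define C where "C = g ` space M"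
  have fin: "finite B" "finite C" using f g by (auto simp: B_def C_def dest: simple_functionD)
  define p where "p b c = prob {x\<in>space M. f x = b \<and> g x = c}" for b c
  define P where "P c = prob {x\<in>space M. g x = c}" for c
  have pc: "(\<Sum>b\<in>B. p b c) = P c" for c
    using sum_marginal[OF f g fin(1), of c] by (simp add: p_def B_def P_def)
  have lns: "ln s \<le> - 1" using s by (metis exp_le_cancel_iff exp_ln)
  have p_le: "0 \<le> p b c" "p b c \<le> P c" for b c
  proof -
    show "0 \<le> p b c" by (simp add: p_def)
    show "p b c \<le> P c" unfolding p_def P_def
      using simple_function_level_set[OF g] by (intro finite_measure_mono) auto
  qed
  define e where "e b c = prob {x\<in>space M. g x = c \<and> ((f x = b) \<noteq> (g x \<in> S b))}" for b c
  have e1: "e b c = p b c" if "c \<notin> S b" for b c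
    unfolding e_def p_def using that by (intro arg_cong[where f=prob]) auto
  have e2: "e b c = P c - p b c" if "c \<in> S b" for b c
  proof -
    have m: "{x\<in>space M. f x = b \<and> g x = c} \<in> events"
      using simple_function_level_set[OF simple_function_Pair[OF f g], of "(b, c)"] by simp
    have "e b c = prob ({x\<in>space M. g x = c} - {x\<in>space M. f x = b \<and> g x = c})"
      unfolding e_def using that by (intro arg_cong[where f=prob]) auto
    also have "\<dots> = P c - p b c" unfolding P_def p_def
      using simple_function_level_set[OF g] m by (intro finite_measure_Diff) auto
    finally show ?thesis .
  qed
  have e_nn: "0 \<le> e b c" for b c by (simp add: e_def)
  have cell_le: "eta (p b c) + p b c * ln (P c) \<le> s * P c - ln s * e b c" for b c
  proof (cases "p b c = 0")
    case True
    have "ln s * e b c \<le> 0" using lns e_nn[of b c] by (intro mult_nonpos_nonneg) auto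
    moreover have "0 \<le> s * P c" using s p_le[of b c] by simp
    ultimately show ?thesis using True by simp
  next
    case False
    then have pos: "0 < p b c" "0 < P c" using p_le[of b c] by auto
    show ?thesis
    proof (cases "c \<in> S b")
      case True
      have "eta (p b c) \<le> P c - p b c - p b c * ln (P c)" using pos by (intro eta_tangent) auto
      moreover have "e b c \<le> - (ln s * e b c)"
        using mult_right_mono[of 1 "- ln s" "e b c"] lns e_nn by simp
      moreover have "0 \<le> s * P c" using s pos by simp
      ultimately show ?thesis using e2[OF True] by linarith
    next
      case False
      have "eta (p b c) \<le> s * P c - p b c - p b c * ln (s * P c)" using pos s by (intro eta_tangent) auto
      also have "ln (s * P c) = ln s + ln (P c)" using pos s by (simp add: ln_mult)
      finally show ?thesis using e1[OF False] pos by (simp add: algebra_simps)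
    qed
  qed
  have "ent M (\<lambda>x. (f x, g x)) = (\<Sum>b\<in>B. \<Sum>c\<in>C. eta (p b c))"
    by (subst ent_superset[of "B \<times> C"])
       (use fin in \<open>auto simp: B_def C_def p_def sum.cartesian_product split_beta prod_eq_iff\<close>)
  moreover have "ent M g = - (\<Sum>b\<in>B. \<Sum>c\<in>C. p b c * ln (P c))"
  proof -
    have "(\<Sum>b\<in>B. \<Sum>c\<in>C. p b c * ln (P c)) = (\<Sum>c\<in>C. P c * ln (P c))"
      by (subst sum.swap) (simp add: sum_distrib_right[symmetric] pc)
    then show ?thesis by (simp add: ent_def C_def P_def eta_def sum_negf)
  qed
  ultimately have "cond_ent M f g = (\<Sum>b\<in>B. \<Sum>c\<in>C. eta (p b c) + p b c * ln (P c))"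
    by (simp add: cond_ent_def sum.distrib)
  also have "\<dots> \<le> (\<Sum>b\<in>B. \<Sum>c\<in>C. s * P c - ln s * e b c)"
    by (intro sum_mono cell_le)
  also have "\<dots> = (\<Sum>b\<in>B. s * (\<Sum>c\<in>C. P c) - ln s * (\<Sum>c\<in>C. e b c))"
    by (simp add: sum_subtractf sum_distrib_left)
  finally have bound: "cond_ent M f g \<le> (\<Sum>b\<in>B. s * (\<Sum>c\<in>C. P c) - ln s * (\<Sum>c\<in>C. e b c))" .
  have "(\<Sum>c\<in>C. P c) = 1"
    using sum_prob_level[OF g fin(2)] by (simp add: P_def C_def)
  moreover have "(\<Sum>c\<in>C. e b c) = prob {x\<in>space M. (f x = b) \<noteq> (g x \<in> S b)}" for b
  proof -
    have "simple_function M (\<lambda>x. (f x = b) \<noteq> (g x \<in> S b))"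
      using simple_function_compose2[OF f g, of "\<lambda>u v. (u = b) \<noteq> (v \<in> S b)"] .
    from sum_marginal[OF g this fin(2), of True] show ?thesis by (simp add: e_def C_def)
  qed
  ultimately show ?thesis using bound by (simp add: B_def)
qed

section \<open>The entropy of an invariant measure\<close>

locale seq_invariant = seq_prob X M
  for X :: "(nat \<Rightarrow> 'a::{finite, discrete_topology}) set" and M :: "(nat \<Rightarrow> 'a) measure" +
  assumes shift_X: "left_shift ` X \<subseteq> X" and distr_shift: "distr M M left_shift = M"

lemma invariant_measures_iff:
  assumes "subshift X"
  shows "M \<in> invariant_measures X \<longleftrightarrow> seq_invariant X M"
  using assms
  by (auto simp: invariant_measures_def seq_invariant_def seq_prob_def seq_prob_axioms_def
      seq_invariant_axioms_def subshift_def)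

context seq_invariant
begin

lemma shift_pow_X: "x \<in> X \<Longrightarrow> (left_shift ^^ i) x \<in> X"
  using shift_X by (induction i) auto

lemma measurable_shift_pow: "(left_shift ^^ i) \<in> M \<rightarrow>\<^sub>M M"
proof -
  have "(left_shift ^^ i) \<in> restrict_space borel X \<rightarrow>\<^sub>M restrict_space borel X"
    using shift_pow_X continuous_on_shift_pow[of X i]
    by (intro measurable_restrict_space2 borel_measurable_continuous_on_restrict)
       (auto simp: space_restrict_space)
  then show ?thesis using measurable_cong_sets[OF sets_M sets_M] by simp
qed

lemma distr_shift_pow: "distr M M (left_shift ^^ i) = M"
proof (induction i)
  case 0
  show ?case using distr_id2[of M M] by (simp add: id_def)
next
  case (Suc i)
  have "distr M M (left_shift ^^ Suc i) = distr (distr M M (left_shift ^^ i)) M left_shift"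
    using measurable_shift_pow[of i] measurable_shift_pow[of 1] by (simp add: distr_distr)
  then show ?case using Suc distr_shift by (simp add: comp_def)
qed

lemma ent_shift_pow:
  assumes "simple_function M f" shows "ent M (\<lambda>x. f ((left_shift ^^ i) x)) = ent M f"
  using ent_distr[OF measurable_shift_pow assms, of i] by (simp add: distr_shift_pow)

lemma simple_function_shift_pow:
  assumes "simple_function M f" shows "simple_function M (\<lambda>x. f ((left_shift ^^ i) x))"
  using simple_function_comp[OF measurable_shift_pow assms, of i] by (simp add: comp_def)

lemma cond_ent_shift_pow:
  assumes "simple_function M f" "simple_function M g"
  shows "cond_ent M (\<lambda>x. f ((left_shift ^^ i) x)) (\<lambda>x. g ((left_shift ^^ i) x)) = cond_ent M f g"
  using ent_shift_pow[OF simple_function_Pair[OF assms], of i] ent_shift_pow[OF assms(2), of i]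
  by (simp add: cond_ent_def)

section \<open>Itineraries and their entropy rate\<close>

text \<open>Plays the role of the iterated join; lists give one type for all lengths.\<close>

definition orbit_code :: "((nat \<Rightarrow> 'a) \<Rightarrow> 'b) \<Rightarrow> nat \<Rightarrow> (nat \<Rightarrow> 'a) \<Rightarrow> 'b list" where
  "orbit_code f n x = map (\<lambda>i. f ((left_shift ^^ i) x)) [0..<n]"

lemma orbit_code_eq_iff:
  "orbit_code f n x = orbit_code f n y \<longleftrightarrow> (\<forall>i<n. f ((left_shift ^^ i) x) = f ((left_shift ^^ i) y))"
  by (auto simp: orbit_code_def)

lemma length_orbit_code [simp]: "length (orbit_code f n x) = n"
  by (simp add: orbit_code_def)

lemma simple_function_orbit_code:
  assumes "simple_function M f" shows "simple_function M (orbit_code f n)"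
proof (induction n)
  case (Suc n)
  have "simple_function M (\<lambda>x. orbit_code f n x @ [f ((left_shift ^^ n) x)])"
    by (rule simple_function_compose2[where h="\<lambda>l a. l @ [a]", OF Suc simple_function_shift_pow[OF assms]])
  then show ?case by (simp add: orbit_code_def[abs_def])
qed (simp add: orbit_code_def[abs_def])

lemma ent_orbit_code_add:
  assumes "simple_function M f"
  shows "ent M (orbit_code f (m + n)) \<le> ent M (orbit_code f m) + ent M (orbit_code f n)"
proof -
  note s = simple_function_orbit_code[OF assms]
  have *: "orbit_code f (m + n) x = orbit_code f m x @ orbit_code f n ((left_shift ^^ m) x)" for x
  proof -
    have "f ((left_shift ^^ (i - m)) ((left_shift ^^ m) x)) = f ((left_shift ^^ i) x)" if "\<not> i < m" for i
      using that by (intro arg_cong[where f=f] ext) (simp add: shift_pow_apply)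
    then show ?thesis by (intro nth_equalityI) (auto simp: orbit_code_def nth_append)
  qed
  have "ent M (orbit_code f (m + n)) = ent M (\<lambda>x. (orbit_code f m x, orbit_code f n ((left_shift ^^ m) x)))"
    by (intro ent_eq simple_function_Pair s simple_function_shift_pow)
       (simp add: *)
  also have "\<dots> \<le> ent M (orbit_code f m) + ent M (\<lambda>x. orbit_code f n ((left_shift ^^ m) x))"
    by (intro ent_Pair_le s simple_function_shift_pow)
  finally show ?thesis by (simp only: ent_shift_pow[OF s])
qed

lemma orbit_code_rate:
  assumes "simple_function M f"
  shows "\<exists>h. (\<lambda>n. ent M (orbit_code f n) / real n) \<longlonglongrightarrow> h \<and> (\<forall>n\<ge>1. h * real n \<le> ent M (orbit_code f n))"
  by (rule fekete[where L=0]) (use ent_orbit_code_add[OF assms] ent_nonneg in auto)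

lemma pre_eq_iff_orbit_code: "pre n x = pre n y \<longleftrightarrow> orbit_code (\<lambda>x. x 0) n x = orbit_code (\<lambda>x. x 0) n y"
  by (simp add: pre_eq_iff orbit_code_eq_iff shift_pow_apply)

lemma simple_function_coord0: "simple_function M (\<lambda>x. x 0)"
proof -
  have "(\<lambda>x :: nat \<Rightarrow> 'a. x 0) = (\<lambda>x. hd (pre 1 x))" by (simp add: pre_def fun_eq_iff)
  then show ?thesis using simple_function_pre[of hd 1] by simp
qed

lemma simple_function_pre': "simple_function M (pre n)"
  using simple_function_pre[of "\<lambda>x. x" n] by simp

lemma ent_pre_eq: "ent M (pre n) = ent M (orbit_code (\<lambda>x. x 0) n)"
  by (intro ent_eq simple_function_pre' simple_function_orbit_code simple_function_coord0)
     (simp add: pre_eq_iff_orbit_code)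

lemma ent_pre_add: "ent M (pre (m + n)) \<le> ent M (pre m) + ent M (pre n)"
  using ent_orbit_code_add[OF simple_function_coord0] by (simp add: ent_pre_eq)

definition entropy_rate :: real where
  "entropy_rate = lim (\<lambda>n. ent M (pre n) / real n)"

lemma entropy_rate_tendsto: "(\<lambda>n. ent M (pre n) / real n) \<longlonglongrightarrow> entropy_rate"
  and entropy_rate_le: "n \<ge> 1 \<Longrightarrow> entropy_rate * real n \<le> ent M (pre n)"
proof -
  obtain h where h: "(\<lambda>n. ent M (pre n) / real n) \<longlonglongrightarrow> h" "\<forall>n\<ge>1. h * real n \<le> ent M (pre n)"
    using orbit_code_rate[OF simple_function_coord0] by (auto simp: ent_pre_eq)
  moreover from h(1) have "entropy_rate = h" by (simp add: entropy_rate_def limI)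
  ultimately show "(\<lambda>n. ent M (pre n) / real n) \<longlonglongrightarrow> entropy_rate"
    "n \<ge> 1 \<Longrightarrow> entropy_rate * real n \<le> ent M (pre n)" by simp_all
qed

text \<open>A prefix of length \<open>n + m\<close> shows the window \<open>pre m\<close> at each of
  the first \<open>n\<close> times. Given that prefix, each of the \<open>n\<close> letters of the
  itinerary costs at most \<open>cond_ent M f (pre m)\<close>, and the \<open>m\<close> extra
  coordinates disappear after division by \<open>n\<close>.\<close>

lemma rate_le_cond_ent:
  assumes f: "simple_function M f"
    and h: "(\<lambda>n. ent M (orbit_code f n) / real n) \<longlonglongrightarrow> h"
  shows "h \<le> entropy_rate + cond_ent M f (pre m)"
proof -
  have bound: "ent M (orbit_code f n) / real n \<le>
      ent M (pre n) / real n + ent M (pre m) / real n + cond_ent M f (pre m)" if "n \<ge> 1" for n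
  proof -
    let ?g = "\<lambda>j x. pre m ((left_shift ^^ j) x)"
    have eb: "simple_function M (\<lambda>x. map (\<lambda>j. f ((left_shift ^^ j) x)) [0..<n]) \<and>
      ent M (\<lambda>x. (map (\<lambda>j. f ((left_shift ^^ j) x)) [0..<n], pre (n + m) x)) \<le>
        ent M (pre (n + m)) + (\<Sum>j<n. cond_ent M (\<lambda>x. f ((left_shift ^^ j) x)) (?g j))"
      by (rule ent_blocks_le[OF simple_function_shift_pow[OF f]
            simple_function_shift_pow[OF simple_function_pre'] simple_function_pre'])
         (erule pre_shift_eq, simp)
    have "ent M (orbit_code f n) \<le> ent M (\<lambda>x. (orbit_code f n x, pre (n + m) x))"
      by (intro ent_mono simple_function_Pair simple_function_orbit_code f simple_function_pre') simp
    also have "\<dots> \<le> ent M (pre (n + m)) + real n * cond_ent M f (pre m)"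
      using eb by (simp add: orbit_code_def[abs_def] cond_ent_shift_pow[OF f simple_function_pre'])
    also have "\<dots> \<le> ent M (pre n) + ent M (pre m) + real n * cond_ent M f (pre m)"
      using ent_pre_add[of n m] by simp
    finally show ?thesis using that by (simp add: field_simps)
  qed
  have "(\<lambda>n. ent M (pre n) / real n + ent M (pre m) / real n + cond_ent M f (pre m)) \<longlonglongrightarrow>
      entropy_rate + 0 + cond_ent M f (pre m)"
    by (intro tendsto_intros entropy_rate_tendsto real_div_const_tendsto_0)
  from LIMSEQ_le[OF h this] bound show ?thesis by auto
qed

text \<open>Approximate the finitely many level sets of \<open>f\<close> by cylinder sets of a
  common depth and let \<open>cond_ent_le\<close> account for the error.\<close>

lemma cond_ent_pre_small:
  assumes f: "simple_function M f" and "\<epsilon> > 0"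
  shows "\<exists>m. cond_ent M f (pre m) \<le> \<epsilon>"
proof -
  define B where "B = f ` space M"
  have fin: "finite B" using f by (auto simp: B_def dest: simple_functionD)
  \<comment> \<open>One more than the number of values, to keep denominators positive. Each summand
    is allowed \<open>\<epsilon> / k\<close>: half bounds \<open>s\<close>, which has to be fixed
    first, and half bounds the error term through \<open>\<delta>\<close>.\<close>
  define k where "k = real (card B) + 1"
  have "k \<ge> 1" by (simp add: k_def)
  define s where "s = min (exp (- 1)) (\<epsilon> / (2 * k))"
  have s: "0 < s" "s \<le> exp (- 1)" "s \<le> \<epsilon> / (2 * k)" using \<open>k \<ge> 1\<close> \<open>\<epsilon> > 0\<close> by (auto simp: s_def)
  define \<delta> where "\<delta> = \<epsilon> / (2 * k * (1 - ln s))"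
  have lns: "ln s \<le> - 1" using s by (metis exp_le_cancel_iff exp_ln)
  have "\<delta> > 0" using lns \<open>k \<ge> 1\<close> \<open>\<epsilon> > 0\<close> by (simp add: \<delta>_def)
  have "\<exists>n C. cyl_set n C \<and> prob {x\<in>space M. (f x = b) \<noteq> (x \<in> C)} < \<delta>" for b
  proof -
    have "{x\<in>space M. f x = b} \<in> sets (restrict_space borel X)"
      using simple_function_level_set[OF f] sets_M by simp
    then obtain A where A: "A \<in> sets borel" "{x\<in>space M. f x = b} = X \<inter> A"
      by (auto simp: sets_restrict_space)
    obtain n C where C: "cyl_set n C" "prob (X \<inter> sym_diff A C) < \<delta>"
      using approx_by_cyl_set[OF A(1) \<open>\<delta> > 0\<close>] by blast
    have "X \<inter> sym_diff A C = {x\<in>space M. (f x = b) \<noteq> (x \<in> C)}"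
      using A(2) unfolding space_M by blast
    then show ?thesis using C by (intro exI[of _ n] exI[of _ C]) simp
  qed
  then have "\<forall>b. \<exists>p. cyl_set (fst p) (snd p) \<and> prob {x\<in>space M. (f x = b) \<noteq> (x \<in> snd p)} < \<delta>"
    by simp
  from choice[OF this] obtain p where
    p: "\<And>b. cyl_set (fst (p b)) (snd (p b)) \<and> prob {x\<in>space M. (f x = b) \<noteq> (x \<in> snd (p b))} < \<delta>"
    by blast
  define n where "n b = fst (p b)" for b
  define C where "C b = snd (p b)" for b
  have C: "cyl_set (n b) (C b)" "prob {x\<in>space M. (f x = b) \<noteq> (x \<in> C b)} < \<delta>" for b
    using p[of b] by (simp_all add: n_def C_def)
  \<comment> \<open>The largest of the depths, so that \<open>pre m\<close> decides membership in
    every \<open>C b\<close>.\<close>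
  define m where "m = Max (insert 0 (n ` B))"
  have err: "prob {x\<in>space M. (f x = b) \<noteq> (pre m x \<in> pre m ` C b)} < \<delta>" if "b \<in> B" for b
  proof -
    have "n b \<le> m" using that fin by (simp add: m_def)
    from C(2)[of b] show ?thesis by (simp only: cyl_set_pre[OF cyl_set_mono[OF C(1) \<open>n b \<le> m\<close>]])
  qed
  have "cond_ent M f (pre m) \<le>
      (\<Sum>b\<in>B. s - ln s * prob {x\<in>space M. (f x = b) \<noteq> (pre m x \<in> pre m ` C b)})"
    unfolding B_def by (rule cond_ent_le[OF f simple_function_pre' s(1,2)])
  also have "\<dots> \<le> (\<Sum>b\<in>B. \<epsilon> / (2 * k) + \<epsilon> / (2 * k))"
  proof (intro sum_mono)
    fix b assume "b \<in> B"
    have "- ln s * prob {x\<in>space M. (f x = b) \<noteq> (pre m x \<in> pre m ` C b)} \<le> (1 - ln s) * \<delta>"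
      using err[OF \<open>b \<in> B\<close>] lns by (intro mult_mono) auto
    also have "\<dots> = \<epsilon> / (2 * k)" using lns \<open>k \<ge> 1\<close> by (simp add: \<delta>_def field_simps)
    finally show "s - ln s * prob {x\<in>space M. (f x = b) \<noteq> (pre m x \<in> pre m ` C b)} \<le>
        \<epsilon> / (2 * k) + \<epsilon> / (2 * k)" using s(3) by linarith
  qed
  also have "\<epsilon> / (2 * k) + \<epsilon> / (2 * k) = \<epsilon> / k" using \<open>k \<ge> 1\<close> by (simp add: field_simps)
  also have "(\<Sum>b\<in>B. \<epsilon> / k) = (k - 1) * (\<epsilon> / k)" by (simp add: k_def)
  also have "\<dots> \<le> \<epsilon>" using \<open>k \<ge> 1\<close> \<open>\<epsilon> > 0\<close> by (simp add: field_simps)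
  finally show ?thesis by blast
qed

lemma rate_le_entropy_rate:
  assumes f: "simple_function M f"
    and h: "(\<lambda>n. ent M (orbit_code f n) / real n) \<longlonglongrightarrow> h"
  shows "h \<le> entropy_rate"
proof (rule field_le_epsilon)
  fix e :: real assume "e > 0"
  from cond_ent_pre_small[OF f this] obtain m where "cond_ent M f (pre m) \<le> e" by blast
  then show "h \<le> entropy_rate + e" using rate_le_cond_ent[OF f h, of m] by linarith
qed

section \<open>From measurable partitions to itineraries\<close>

definition cell :: "(nat \<Rightarrow> 'a) set set \<Rightarrow> (nat \<Rightarrow> 'a) \<Rightarrow> (nat \<Rightarrow> 'a) set" where
  "cell P x = (THE A. A \<in> P \<and> x \<in> A)"

lemma cell_eq_iff:
  assumes "finite_measurable_partition M P" "x \<in> X" "A \<in> P"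
  shows "cell P x = A \<longleftrightarrow> x \<in> A"
proof -
  have part: "partition_on X P" using assms by (simp add: finite_measurable_partition_def space_M)
  obtain B where B: "B \<in> P" "x \<in> B" using part assms(2) unfolding partition_on_def by auto
  have uniq: "C = B" if "C \<in> P \<and> x \<in> C" for C
    using that B part unfolding partition_on_def disjoint_def by blast
  then have "cell P x = B" unfolding cell_def using B by (intro the_equality conjI) blast+
  then show ?thesis using B uniq[of A] assms(3) by blast
qed

lemma cell_in:
  assumes "finite_measurable_partition M P" "x \<in> X" shows "cell P x \<in> P" "x \<in> cell P x"
proof -
  have "X = \<Union>P" using assms by (simp add: finite_measurable_partition_def space_M partition_on_def)
  then obtain B where B: "B \<in> P" "x \<in> B" using assms(2) by auto
  then have "cell P x = B" using cell_eq_iff[OF assms B(1)] by simp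
  with B show "cell P x \<in> P" "x \<in> cell P x" by auto
qed

lemma simple_function_cell:
  assumes P: "finite_measurable_partition M P" shows "simple_function M (cell P)"
proof -
  have sub: "cell P ` space M \<subseteq> P" using cell_in[OF P] by (auto simp: space_M)
  moreover have "finite P" using P by (simp add: finite_measurable_partition_def)
  moreover have "cell P -` {A} \<inter> space M \<in> sets M" if "A \<in> P" for A
  proof -
    have "A \<in> sets M" using that P by (auto simp: finite_measurable_partition_def)
    moreover from this have "A \<subseteq> X" using sets.sets_into_space space_M by blast
    then have "cell P -` {A} \<inter> space M = A" using cell_eq_iff[OF P _ that] by (auto simp: space_M)
    ultimately show ?thesis by simp
  qed
  ultimately show ?thesis unfolding simple_function_def by (auto intro: finite_subset)
qed

text \<open>The nonempty cells of the join are exactly the level sets of the itinerary, each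
  occurring once, and the empty cell contributes \<open>eta 0 = 0\<close>.\<close>

lemma partition_entropy_iterated_join:
  assumes P: "finite_measurable_partition M P"
  shows "partition_entropy M (iterated_join M left_shift P n) = ent M (orbit_code (cell P) n)"
proof -
  let ?F = "orbit_code (cell P) n"
  define J where "J c = {x \<in> X. \<forall>i<n. (left_shift ^^ i) x \<in> c i}" for c :: "nat \<Rightarrow> (nat \<Rightarrow> 'a) set"
  define L where "L b = {x \<in> X. ?F x = b}" for b
  have J_eq: "J c = L (?F x)" if "c \<in> {..<n} \<rightarrow>\<^sub>E P" "x \<in> J c" for c x
  proof -
    have x: "x \<in> X" "\<And>i. i < n \<Longrightarrow> cell P ((left_shift ^^ i) x) = c i"
    proof -
      show "x \<in> X" using that(2) by (simp add: J_def)
      fix i assume "i < n"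
      then have "(left_shift ^^ i) x \<in> c i" "c i \<in> P" using that by (auto simp: J_def)
      then show "cell P ((left_shift ^^ i) x) = c i"
        using cell_eq_iff[OF P shift_pow_X[OF \<open>x \<in> X\<close>], of "c i" i] by simp
    qed
    have "(left_shift ^^ i) y \<in> c i \<longleftrightarrow> cell P ((left_shift ^^ i) y) = c i" if "y \<in> X" "i < n" for y i
      using cell_eq_iff[OF P shift_pow_X[OF that(1)], of "c i"] PiE_mem[OF \<open>c \<in> {..<n} \<rightarrow>\<^sub>E P\<close>, of i] that(2)
      by simp
    then have "y \<in> J c \<longleftrightarrow> y \<in> L (?F x)" for y
      unfolding J_def L_def mem_Collect_eq orbit_code_eq_iff using x(2) by metis
    then show ?thesis by blast
  qed
  have "iterated_join M left_shift P n - {{}} = L ` ?F ` X"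
  proof (intro equalityI subsetI)
    fix A assume "A \<in> iterated_join M left_shift P n - {{}}"
    then obtain c where c: "c \<in> {..<n} \<rightarrow>\<^sub>E P" "A = J c" "A \<noteq> {}"
      by (auto simp: iterated_join_def J_def space_M)
    then obtain x where "x \<in> J c" by auto
    moreover from this have "x \<in> X" by (simp add: J_def)
    ultimately show "A \<in> L ` ?F ` X" using J_eq[OF c(1)] c(2) by blast
  next
    fix A assume "A \<in> L ` ?F ` X"
    then obtain x where x: "x \<in> X" "A = L (?F x)" by auto
    define c where "c = (\<lambda>i\<in>{..<n}. cell P ((left_shift ^^ i) x))"
    have c: "c \<in> {..<n} \<rightarrow>\<^sub>E P" using cell_in[OF P shift_pow_X[OF x(1)]] by (auto simp: c_def)
    have "x \<in> J c" using cell_in[OF P shift_pow_X[OF x(1)]] x(1) by (auto simp: J_def c_def)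
    with J_eq[OF c] x have "A = J c" by simp
    with c \<open>x \<in> J c\<close> show "A \<in> iterated_join M left_shift P n - {{}}"
      by (auto simp: iterated_join_def J_def space_M)
  qed
  moreover have "finite (iterated_join M left_shift P n)"
    using P unfolding iterated_join_def finite_measurable_partition_def
    by (intro finite_imageI finite_PiE) auto
  then have "partition_entropy M (iterated_join M left_shift P n) =
      (\<Sum>A\<in>iterated_join M left_shift P n - {{}}. eta (measure M A))"
    unfolding partition_entropy_def sum_negf[symmetric]
    by (intro sum.mono_neutral_cong_right) (auto simp: eta_def)
  moreover have "inj_on L (?F ` X)"
    unfolding inj_on_def L_def by blast
  then have "(\<Sum>A\<in>L ` ?F ` X. eta (measure M A)) = (\<Sum>b\<in>?F ` X. eta (measure M (L b)))"
    by (simp only: sum.reindex o_def)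
  ultimately show ?thesis by (simp only: ent_def space_M L_def)
qed

text \<open>The Kolmogorov-Sinai theorem for the generating partition by coordinate 0. No partition
  exceeds the rate because cylinder sets approximate its cells; the generating one attains it
  because its itineraries are the prefixes.\<close>

theorem ks_entropy_eq: "ks_entropy M left_shift = ereal entropy_rate"
proof (rule antisym)
  show "ks_entropy M left_shift \<le> ereal entropy_rate"
    unfolding ks_entropy_def
  proof (rule SUP_least)
    fix P assume "P \<in> {P. finite_measurable_partition M P}"
    then have P: "finite_measurable_partition M P" by simp
    obtain h where h: "(\<lambda>n. ent M (orbit_code (cell P) n) / real n) \<longlonglongrightarrow> h"
      using orbit_code_rate[OF simple_function_cell[OF P]] by blast
    from rate_le_entropy_rate[OF simple_function_cell[OF P] h] limI[OF h]
    show "ereal (lim (\<lambda>n. partition_entropy M (iterated_join M left_shift P n) / real n)) \<le> ereal entropy_rate"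
      by (simp add: partition_entropy_iterated_join[OF P])
  qed
next
  define P where "P = (\<lambda>a. {x\<in>X. x 0 = a}) ` ((\<lambda>x. x 0) ` X)"
  have P: "finite_measurable_partition M P"
    unfolding finite_measurable_partition_def
  proof (intro conjI)
    show "P \<subseteq> sets M"
      using simple_function_level_set[OF simple_function_coord0] by (auto simp: P_def space_M)
    show "partition_on (space M) P"
      by (auto simp: partition_on_def disjoint_def P_def space_M)
  qed (simp add: P_def)
  have cellP: "cell P x = {y\<in>X. y 0 = x 0}" if "x \<in> X" for x
    using cell_eq_iff[OF P that, of "{y\<in>X. y 0 = x 0}"] that by (auto simp: P_def)
  have "cell P x = cell P y \<longleftrightarrow> x 0 = y 0" if "x \<in> X" "y \<in> X" for x y
    using that by (auto simp: cellP)
  then have "ent M (orbit_code (cell P) n) = ent M (pre n)" for n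
    by (intro ent_eq simple_function_orbit_code simple_function_cell[OF P] simple_function_pre')
       (auto simp: orbit_code_eq_iff pre_eq_iff shift_pow_apply shift_pow_X space_M)
  then have "lim (\<lambda>n. partition_entropy M (iterated_join M left_shift P n) / real n) = entropy_rate"
    by (simp add: partition_entropy_iterated_join[OF P] limI[OF entropy_rate_tendsto])
  then show "ereal entropy_rate \<le> ks_entropy M left_shift"
    unfolding ks_entropy_def using P by (intro SUP_upper2[of P]) auto
qed

end

section \<open>Truncated logarithms and their integrals\<close>

text \<open>Potentials may vanish; truncating \<open>log \<phi>\<^sub>n\<close> at \<open>-k n\<close> makes it bounded, keeps it sub-additive, and
  the original mean is recovered as the infimum over \<open>k\<close>.\<close>

definition trunc_ln :: "real \<Rightarrow> ennreal \<Rightarrow> real" where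
  "trunc_ln t u = ln (max (enn2real u) (exp (- t)))"

lemma max_exp_pos: "0 < max r (exp (t::real))"
  by (simp add: less_max_iff_disj)

lemma trunc_ln_ge: "- t \<le> trunc_ln t u"
  unfolding trunc_ln_def using max_exp_pos by (subst ln_ge_iff) auto

lemma exp_trunc_ln: "exp (trunc_ln t u) = max (enn2real u) (exp (- t))"
  unfolding trunc_ln_def using max_exp_pos by (rule exp_ln)

lemma trunc_ln_mono: "u \<le> v \<Longrightarrow> v < \<top> \<Longrightarrow> trunc_ln t u \<le> trunc_ln t v"
  unfolding trunc_ln_def using max_exp_pos
  by (intro ln_mono max.mono enn2real_mono) auto

lemma trunc_ln_antimono: "s \<le> t \<Longrightarrow> trunc_ln t u \<le> trunc_ln s u"
  unfolding trunc_ln_def using max_exp_pos by (intro ln_mono max.mono) auto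

text \<open>Truncation levels add under products, so a level proportional to the length respects
  sub-multiplicativity. With \<open>1 \<le> c\<close> the bound also holds where the threshold is
  the larger entry of the maximum on the left.\<close>

lemma trunc_ln_le_of_mult:
  assumes "u \<le> ennreal c * v * w" "1 \<le> c" "v < \<top>" "w < \<top>"
  shows "trunc_ln (s + t) u \<le> ln c + trunc_ln s v + trunc_ln t w"
proof -
  have "enn2real u \<le> enn2real (ennreal c * v * w)"
    using assms by (intro enn2real_mono) (auto simp: ennreal_mult_less_top)
  also have "\<dots> = c * enn2real v * enn2real w" using assms by (simp add: enn2real_mult)
  also have "\<dots> \<le> c * max (enn2real v) (exp (- s)) * max (enn2real w) (exp (- t))"
    using assms by (intro mult_mono) (auto simp: zero_le_mult_iff le_max_iff_disj)
  finally have 1: "enn2real u \<le> c * max (enn2real v) (exp (- s)) * max (enn2real w) (exp (- t))" .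
  have "1 * exp (- s) * exp (- t) \<le> c * max (enn2real v) (exp (- s)) * max (enn2real w) (exp (- t))"
    using assms by (intro mult_mono) (auto simp: zero_le_mult_iff le_max_iff_disj)
  then have "max (enn2real u) (exp (- (s + t))) \<le> c * max (enn2real v) (exp (- s)) * max (enn2real w) (exp (- t))"
    using 1 by (simp add: exp_add[symmetric] add.commute)
  then have "trunc_ln (s + t) u \<le> ln (c * max (enn2real v) (exp (- s)) * max (enn2real w) (exp (- t)))"
    unfolding trunc_ln_def using max_exp_pos by (intro ln_mono) auto
  also have "\<dots> = ln c + trunc_ln s v + trunc_ln t w"
    unfolding trunc_ln_def using max_exp_pos[of "enn2real v" "- s"] max_exp_pos[of "enn2real w" "- t"] assms
    by (subst ln_mult_pos, simp, simp, subst ln_mult_pos, auto)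
  finally show ?thesis .
qed

lemma trunc_ln_le_of_scale:
  assumes "u \<le> ennreal (exp d) * v" "0 \<le> d" "v < \<top>"
  shows "trunc_ln t u \<le> d + trunc_ln t v"
  using trunc_ln_le_of_mult[of u "exp d" v 1 t 0] assms by (simp add: trunc_ln_def)

lemma trunc_ln_bounded:
  assumes "u \<le> ennreal B"
  shows "\<bar>trunc_ln t u\<bar> \<le> \<bar>t\<bar> + \<bar>ln (max B (exp (- t)))\<bar>"
proof -
  have "enn2real u \<le> max B 0"
    using enn2real_mono[OF assms] by (cases "0 \<le> B") (auto simp: ennreal_neg)
  then have "max (enn2real u) (exp (- t)) \<le> max B (exp (- t))"
    using exp_gt_zero[of "- t"] by linarith
  then have "trunc_ln t u \<le> ln (max B (exp (- t)))"
    unfolding trunc_ln_def using max_exp_pos by (intro ln_mono) auto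
  then show ?thesis using trunc_ln_ge[of t u] by linarith
qed

lemma borel_measurable_trunc_ln [measurable]:
  "f \<in> borel_measurable M \<Longrightarrow> (\<lambda>x. trunc_ln t (f x)) \<in> borel_measurable M"
  unfolding trunc_ln_def by measurable

lemma eln_mono: "u \<le> v \<Longrightarrow> eln u \<le> eln v"
proof (cases "u = 0 \<or> v = \<top>")
  case False
  assume uv: "u \<le> v"
  have "0 < u" "v < \<top>" using False by (auto simp: zero_less_iff_neq_zero less_top)
  then have "0 < enn2real u" "enn2real u \<le> enn2real v"
    using uv by (auto simp: enn2real_positive_iff intro: enn2real_mono)
  then show "eln u \<le> eln v" using uv False by (auto simp: eln_def top_unique)
qed (auto simp: eln_def)

lemma ereal_integral_mono:
  assumes "\<And>x. x \<in> space M \<Longrightarrow> f x \<le> g x"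
  shows "ereal_integral M f \<le> ereal_integral M g"
  unfolding ereal_integral_def using assms
  by (intro ereal_minus_mono) (auto simp: less_eq_ennreal.rep_eq[symmetric] intro!: nn_integral_mono e2ennreal_mono)

lemma (in finite_measure) integrable_trunc_ln:
  assumes "u \<in> borel_measurable M" "\<And>x. x \<in> space M \<Longrightarrow> u x \<le> ennreal B"
  shows "integrable M (\<lambda>x. trunc_ln t (u x))"
  by (rule integrable_const_bound[where B="\<bar>t\<bar> + \<bar>ln (max B (exp (- t)))\<bar>"])
     (use assms in \<open>auto intro!: AE_I2 trunc_ln_bounded\<close>)

text \<open>The positive part \<open>p\<close> of the logarithm is bounded, while the negative part
  may have infinite integral. The latter is the increasing limit of the integrable
  \<open>q k\<close>, so monotone convergence evaluates it without deciding whether it is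
  finite.\<close>

lemma (in prob_space) ereal_integral_eln:
  assumes u: "u \<in> borel_measurable M" and B: "\<And>x. x \<in> space M \<Longrightarrow> u x \<le> ennreal B"
  shows ereal_integral_eln_le: "0 \<le> t \<Longrightarrow> ereal_integral M (\<lambda>x. eln (u x)) \<le> ereal (\<integral>x. trunc_ln t (u x) \<partial>M)"
    and ereal_integral_eln_ge: "(\<And>k::nat. L \<le> (\<integral>x. trunc_ln (real k) (u x) \<partial>M)) \<Longrightarrow>
      ereal L \<le> ereal_integral M (\<lambda>x. eln (u x))"
proof -
  define p where "p x = ln (max (enn2real (u x)) 1)" for x
  define q where "q t x = p x - trunc_ln t (u x)" for t x
  have fin: "u x < \<top>" if "x \<in> space M" for x using B[OF that] by (auto intro: le_less_trans)
  have p_nn: "0 \<le> p x" for x by (simp add: p_def)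
  have p_eq: "p x = trunc_ln 0 (u x)" for x by (simp add: p_def trunc_ln_def)
  have q_nn: "0 \<le> q t x" if "0 \<le> t" for t x
    using trunc_ln_antimono[OF that, of "u x"] by (simp add: q_def p_eq)
  have int_t: "integrable M (\<lambda>x. trunc_ln t (u x))" for t using integrable_trunc_ln[OF u B] .
  have int_p: "integrable M p" using int_t[of 0] by (simp add: p_eq[abs_def])
  have int_q: "integrable M (q t)" for t unfolding q_def[abs_def] using int_p int_t by simp
  have pos: "e2ennreal (eln (u x)) = ennreal (p x)" if "x \<in> space M" for x
  proof (cases "u x = 0")
    case False
    then have "0 < enn2real (u x)" using fin[OF that] by (simp add: enn2real_positive_iff zero_less_iff_neq_zero)
    then have "eln (u x) = ereal (ln (enn2real (u x)))" "ennreal (p x) = ennreal (ln (enn2real (u x)))"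
      using False fin[OF that] by (auto simp: eln_def p_def max_def ennreal_neg)
    then show ?thesis by simp
  qed (simp add: eln_def p_def e2ennreal_neg)
  have neg: "e2ennreal (- eln (u x)) = (SUP k::nat. ennreal (q (real k) x))" if x: "x \<in> space M" for x
  proof (cases "u x = 0")
    case True
    have q: "q (real k) x = real k" for k using True by (simp add: q_def p_def trunc_ln_def max_def)
    have "(SUP k::nat. ennreal (real k)) = \<top>"
      using ennreal_SUP_of_nat_eq_top by (simp only: ennreal_of_nat_eq_real_of_nat)
    moreover have "e2ennreal (- eln (u x)) = \<top>" using True by (simp add: eln_def)
    ultimately show ?thesis by (simp only: q)
  next
    case False
    define r where "r = enn2real (u x)"
    have r: "0 < r" using False fin[OF x] by (simp add: r_def enn2real_positive_iff zero_less_iff_neq_zero)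
    have e: "eln (u x) = ereal (ln r)" using False fin[OF x] by (simp add: eln_def r_def)
    have qr: "q t x = ln (max r 1) - ln (max r (exp (- t)))" for t
      by (simp add: q_def p_def trunc_ln_def r_def)
    have "(SUP k::nat. ennreal (q (real k) x)) = ennreal (max 0 (- ln r))"
    proof (rule antisym)
      show "(SUP k::nat. ennreal (q (real k) x)) \<le> ennreal (max 0 (- ln r))"
      proof (intro SUP_least ennreal_leI)
        fix k :: nat
        have "ln r \<le> ln (max r (exp (- real k)))" using r by (intro ln_mono) auto
        then show "q (real k) x \<le> max 0 (- ln r)"
          using r by (cases "r \<le> 1") (auto simp: qr max_def)
      qed
      obtain k :: nat where "- ln r \<le> real k" using real_arch_simple by blast
      then have "exp (- real k) \<le> r" using r by (subst ln_ge_iff[symmetric]) auto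
      then have "q (real k) x = max 0 (- ln r)"
        using r by (cases "r \<le> 1") (auto simp: qr max_def)
      then show "ennreal (max 0 (- ln r)) \<le> (SUP k::nat. ennreal (q (real k) x))"
        by (intro SUP_upper2[of k]) auto
    qed
    then show ?thesis by (simp add: e e2ennreal_ereal max_def ennreal_neg)
  qed
  have Ip: "(\<integral>\<^sup>+x. e2ennreal (eln (u x)) \<partial>M) = ennreal (\<integral>x. p x \<partial>M)"
    using int_p p_nn by (subst nn_integral_eq_integral[symmetric]) (auto intro!: nn_integral_cong simp: pos)
  have Iq: "(\<integral>\<^sup>+x. ennreal (q t x) \<partial>M) = ennreal (\<integral>x. q t x \<partial>M)" if "0 \<le> t" for t
    using int_q q_nn[OF that] by (intro nn_integral_eq_integral) auto
  have "(\<integral>\<^sup>+x. e2ennreal (- eln (u x)) \<partial>M) = (\<integral>\<^sup>+x. (SUP k::nat. ennreal (q (real k) x)) \<partial>M)"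
    by (intro nn_integral_cong neg)
  also have "\<dots> = (SUP k::nat. \<integral>\<^sup>+x. ennreal (q (real k) x) \<partial>M)"
  proof (rule nn_integral_monotone_convergence_SUP)
    show "incseq (\<lambda>k x. ennreal (q (real k) x))"
      by (auto simp: incseq_def le_fun_def q_def intro!: ennreal_leI trunc_ln_antimono)
    show "(\<lambda>x. ennreal (q (real k) x)) \<in> borel_measurable M" for k
      using borel_measurable_integrable[OF int_q[of "real k"]] by (rule measurable_compose[OF _ measurable_ennreal])
  qed
  finally have In: "(\<integral>\<^sup>+x. e2ennreal (- eln (u x)) \<partial>M) = (SUP k::nat. ennreal (\<integral>x. q (real k) x \<partial>M))"
    by (simp add: Iq)
  have It: "(\<integral>x. trunc_ln t (u x) \<partial>M) = (\<integral>x. p x \<partial>M) - (\<integral>x. q t x \<partial>M)" for t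
    using int_p int_t[of t] by (simp add: q_def)
  have Ip_nn: "0 \<le> (\<integral>x. p x \<partial>M)" using p_nn by simp
  have I: "ereal_integral M (\<lambda>x. eln (u x)) =
      ereal (\<integral>x. p x \<partial>M) - enn2ereal (SUP k::nat. ennreal (\<integral>x. q (real k) x \<partial>M))"
    by (simp add: ereal_integral_def Ip In enn2ereal_ennreal[OF Ip_nn])
  show "ereal_integral M (\<lambda>x. eln (u x)) \<le> ereal (\<integral>x. trunc_ln t (u x) \<partial>M)" if "0 \<le> t"
  proof -
    obtain k :: nat where k: "t \<le> real k" using real_arch_simple by blast
    have "(\<integral>x. q t x \<partial>M) \<le> (\<integral>x. q (real k) x \<partial>M)"
    proof (rule integral_mono[OF int_q int_q])
      show "q t x \<le> q (real k) x" for x using trunc_ln_antimono[OF k] by (simp add: q_def)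
    qed
    then have "ennreal (\<integral>x. q t x \<partial>M) \<le> (SUP k::nat. ennreal (\<integral>x. q (real k) x \<partial>M))"
      by (intro SUP_upper2[of k] ennreal_leI) auto
    moreover have "0 \<le> (\<integral>x. q t x \<partial>M)" using q_nn[OF that] by simp
    ultimately have "ereal (\<integral>x. q t x \<partial>M) \<le> enn2ereal (SUP k::nat. ennreal (\<integral>x. q (real k) x \<partial>M))"
      by (simp add: less_eq_ennreal.rep_eq enn2ereal_ennreal)
    then have "ereal (\<integral>x. p x \<partial>M) - enn2ereal (SUP k::nat. ennreal (\<integral>x. q (real k) x \<partial>M))
        \<le> ereal (\<integral>x. p x \<partial>M) - ereal (\<integral>x. q t x \<partial>M)"
      by (intro ereal_minus_mono) auto
    then show ?thesis by (simp add: I It)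
  qed
  show "ereal L \<le> ereal_integral M (\<lambda>x. eln (u x))" if L: "\<And>k::nat. L \<le> (\<integral>x. trunc_ln (real k) (u x) \<partial>M)"
  proof -
    have q_le: "(\<integral>x. q (real k) x \<partial>M) \<le> (\<integral>x. p x \<partial>M) - L" for k :: nat using L[of k] by (simp add: It)
    have "0 \<le> (\<integral>x. q (real 0) x \<partial>M)" using q_nn[of 0] by simp
    then have "0 \<le> (\<integral>x. p x \<partial>M) - L" using q_le[of 0] by linarith
    have "(SUP k::nat. ennreal (\<integral>x. q (real k) x \<partial>M)) \<le> ennreal ((\<integral>x. p x \<partial>M) - L)"
      using q_le by (intro SUP_least ennreal_leI) auto
    then have "enn2ereal (SUP k::nat. ennreal (\<integral>x. q (real k) x \<partial>M)) \<le> ereal ((\<integral>x. p x \<partial>M) - L)"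
      using \<open>0 \<le> (\<integral>x. p x \<partial>M) - L\<close> by (simp add: less_eq_ennreal.rep_eq enn2ereal_ennreal)
    then have "ereal (\<integral>x. p x \<partial>M) - ereal ((\<integral>x. p x \<partial>M) - L) \<le>
        ereal (\<integral>x. p x \<partial>M) - enn2ereal (SUP k::nat. ennreal (\<integral>x. q (real k) x \<partial>M))"
      by (intro ereal_minus_mono) auto
    then show ?thesis by (simp add: I)
  qed
qed

lemma (in prob_space) ereal_integral_eln_eq_INF:
  assumes u: "u \<in> borel_measurable M" and B: "\<And>x. x \<in> space M \<Longrightarrow> u x \<le> ennreal B"
  shows "ereal_integral M (\<lambda>x. eln (u x)) = (INF k::nat. ereal (\<integral>x. trunc_ln (real k) (u x) \<partial>M))"
proof (rule antisym)
  show "ereal_integral M (\<lambda>x. eln (u x)) \<le> (INF k::nat. ereal (\<integral>x. trunc_ln (real k) (u x) \<partial>M))"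
    by (intro INF_greatest ereal_integral_eln_le[OF u B]) auto
  let ?L = "INF k::nat. ereal (\<integral>x. trunc_ln (real k) (u x) \<partial>M)"
  have le: "?L \<le> ereal (\<integral>x. trunc_ln (real k) (u x) \<partial>M)" for k :: nat by (rule INF_lower) simp
  show "?L \<le> ereal_integral M (\<lambda>x. eln (u x))"
  proof (cases ?L)
    case (real l)
    then have "l \<le> (\<integral>x. trunc_ln (real k) (u x) \<partial>M)" for k :: nat using le[of k] by simp
    from ereal_integral_eln_ge[OF u B this] show ?thesis by (simp only: real)
  qed (use le[of 0] in auto)
qed

text \<open>Only \<open>u\<close> is known to be measurable. The constant \<open>d\<close> therefore
  passes through the truncated integrals of \<open>u\<close>, and \<open>v\<close> enters through
  monotonicity alone.\<close>

lemma (in prob_space) ereal_integral_eln_upper: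
  assumes u: "u \<in> borel_measurable M" and B: "\<And>x. x \<in> space M \<Longrightarrow> u x \<le> ennreal B"
    and v: "\<And>x. x \<in> space M \<Longrightarrow> v x \<le> ennreal (exp d) * u x" and d: "0 \<le> d"
  shows "ereal_integral M (\<lambda>x. eln (v x)) \<le> ereal_integral M (\<lambda>x. eln (u x)) + ereal d"
proof -
  have B': "ennreal (exp d) * u x \<le> ennreal (exp d * B)" if "x \<in> space M" for x
    using mult_left_mono[OF B[OF that], of "ennreal (exp d)"] by (simp add: ennreal_mult'[of "exp d"])
  have u': "(\<lambda>x. ennreal (exp d) * u x) \<in> borel_measurable M" using u by simp
  have fin: "u x < \<top>" if "x \<in> space M" for x using B[OF that] by (auto intro: le_less_trans)
  have "ereal_integral M (\<lambda>x. eln (v x)) - ereal d \<le> (INF k::nat. ereal (\<integral>x. trunc_ln (real k) (u x) \<partial>M))"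
  proof (rule INF_greatest)
    fix k :: nat
    have "ereal_integral M (\<lambda>x. eln (v x)) \<le> ereal_integral M (\<lambda>x. eln (ennreal (exp d) * u x))"
      by (intro ereal_integral_mono eln_mono v)
    also have "\<dots> \<le> ereal (\<integral>x. trunc_ln (real k) (ennreal (exp d) * u x) \<partial>M)"
      by (rule ereal_integral_eln_le[OF u' B']) auto
    also have "(\<integral>x. trunc_ln (real k) (ennreal (exp d) * u x) \<partial>M) \<le> (\<integral>x. d + trunc_ln (real k) (u x) \<partial>M)"
      using d fin by (intro integral_mono integrable_trunc_ln[OF u' B'] Bochner_Integration.integrable_add
          integrable_trunc_ln[OF u B] trunc_ln_le_of_scale) auto
    also have "\<dots> = d + (\<integral>x. trunc_ln (real k) (u x) \<partial>M)"
      using integrable_trunc_ln[OF u B] by (simp add: prob_space)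
    finally show "ereal_integral M (\<lambda>x. eln (v x)) - ereal d \<le> ereal (\<integral>x. trunc_ln (real k) (u x) \<partial>M)"
      by (simp add: ereal_minus_le add.commute)
  qed
  then show ?thesis by (simp add: ereal_integral_eln_eq_INF[OF u B] ereal_minus_le)
qed

text \<open>Exchanging the roles in \<open>ereal_integral_eln_upper\<close> would put the constant
  on the possibly non-measurable \<open>v\<close>. Instead the measurable function
  \<open>exp (- d) * u\<close> is placed below \<open>v\<close>.\<close>

lemma (in prob_space) ereal_integral_eln_lower:
  assumes u: "u \<in> borel_measurable M" and B: "\<And>x. x \<in> space M \<Longrightarrow> u x \<le> ennreal B"
    and v: "\<And>x. x \<in> space M \<Longrightarrow> u x \<le> ennreal (exp d) * v x" and d: "0 \<le> d"
  shows "ereal_integral M (\<lambda>x. eln (u x)) \<le> ereal_integral M (\<lambda>x. eln (v x)) + ereal d"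
proof -
  have B': "ennreal (exp (- d)) * u x \<le> ennreal (exp (- d) * B)" if "x \<in> space M" for x
    using mult_left_mono[OF B[OF that], of "ennreal (exp (- d))"] by (simp add: ennreal_mult'[of "exp (- d)"])
  have u': "(\<lambda>x. ennreal (exp (- d)) * u x) \<in> borel_measurable M" using u by simp
  have c1: "ennreal (exp d) * (ennreal (exp (- d)) * w) = w" for w
    by (simp add: mult.assoc[symmetric] ennreal_mult''[symmetric] exp_minus)
  have c2: "ennreal (exp (- d)) * (ennreal (exp d) * w) = w" for w
    by (simp add: mult.assoc[symmetric] ennreal_mult''[symmetric] exp_minus)
  have "ereal_integral M (\<lambda>x. eln (u x)) \<le>
      ereal_integral M (\<lambda>x. eln (ennreal (exp (- d)) * u x)) + ereal d"
    by (rule ereal_integral_eln_upper[OF u' B' _ d]) (simp_all add: c1)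
  also have "ereal_integral M (\<lambda>x. eln (ennreal (exp (- d)) * u x)) \<le> ereal_integral M (\<lambda>x. eln (v x))"
  proof (intro ereal_integral_mono eln_mono)
    fix x assume "x \<in> space M"
    from mult_left_mono[OF v[OF this], of "ennreal (exp (- d))"]
    show "ennreal (exp (- d)) * u x \<le> v x" by (simp add: c2)
  qed
  finally show ?thesis by (simp add: add_right_mono)
qed

section \<open>Upper semicontinuous functions on compact sets of sequences\<close>

lemma compact_decseq_Int_nonempty:
  fixes K :: "'a::topological_space set" and F :: "nat \<Rightarrow> 'a set"
  assumes "compact K" "\<And>n. closed (F n)" "decseq F" "\<And>n. K \<inter> F n \<noteq> {}"
  shows "K \<inter> (\<Inter>n. F n) \<noteq> {}"
proof (rule compact_imp_fip_image[OF assms(1)])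
  fix I :: "nat set" assume "finite I"
  then obtain m where "I \<subseteq> {..m}" using finite_nat_iff_bounded_le by auto
  then have "F m \<subseteq> (\<Inter>i\<in>I. F i)" using decseqD[OF assms(3)] by blast
  then show "K \<inter> (\<Inter>i\<in>I. F i) \<noteq> {}" using assms(4)[of m] by blast
qed (use assms in auto)

text \<open>If every neighbourhood of \<open>x\<close> met \<open>X\<close>, compactness would give
  the shrinking cylinders around \<open>x\<close> a common point in \<open>X\<close>, and that point
  is \<open>x\<close>.\<close>

lemma compact_imp_closed_seq:
  fixes X :: "(nat \<Rightarrow> 'a::{finite, discrete_topology}) set"
  assumes "compact X" shows "closed X"
proof -
  have "\<exists>U. open U \<and> x \<in> U \<and> U \<subseteq> - X" if "x \<notin> X" for x
  proof (rule ccontr)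
    assume contra: "\<not> ?thesis"
    define F where "F n = {y. pre n y = pre n x}" for n
    have "X \<inter> (\<Inter>n. F n) \<noteq> {}"
    proof (rule compact_decseq_Int_nonempty[OF assms])
      show "closed (F n)" for n unfolding F_def by (rule closed_pre)
      show "decseq F" unfolding decseq_def F_def by (auto intro: pre_eq_mono)
      show "X \<inter> F n \<noteq> {}" for n
      proof
        assume "X \<inter> F n = {}"
        then have "F n \<subseteq> - X" by blast
        moreover have "open (F n)" unfolding F_def by (rule open_pre)
        moreover have "x \<in> F n" by (simp add: F_def)
        ultimately show False using contra by blast
      qed
    qed
    then obtain y where y: "y \<in> X" "\<And>n. pre n y = pre n x" unfolding F_def by blast
    have "y i = x i" for i using y(2)[of "Suc i"] by (simp add: pre_eq_iff)
    then have "y = x" by (rule ext)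
    with y(1) that show False by simp
  qed
  then have "open (- X)" by (subst open_subopen) blast
  then show ?thesis by (simp add: closed_def)
qed

lemma usc_closed:
  fixes X :: "(nat \<Rightarrow> 'a::{finite, discrete_topology}) set"
  assumes "compact X" "upper_semicontinuous_on X f"
  shows "closed {x \<in> X. t \<le> f x}"
  using assms compact_imp_closed_seq[OF assms(1)] closedin_closed_trans
  unfolding upper_semicontinuous_on_def by blast

lemma usc_bounded:
  fixes X :: "(nat \<Rightarrow> 'a::{finite, discrete_topology}) set"
  assumes "compact X" "upper_semicontinuous_on X f" "\<And>x. x \<in> X \<Longrightarrow> f x < \<top>"
  shows "\<exists>B. 0 \<le> B \<and> (\<forall>x\<in>X. f x \<le> ennreal B)"
proof (rule ccontr)
  assume contra: "\<not> ?thesis"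
  define F where "F n = {x \<in> X. ennreal (real n) \<le> f x}" for n :: nat
  have "X \<inter> (\<Inter>n. F n) \<noteq> {}"
  proof (rule compact_decseq_Int_nonempty[OF assms(1)])
    show "closed (F n)" for n unfolding F_def by (rule usc_closed[OF assms(1,2)])
    have "ennreal (real m) \<le> ennreal (real n)" if "m \<le> n" for m n :: nat
      using that by (intro ennreal_leI) simp
    then show "decseq F" unfolding decseq_def F_def using order_trans by blast
    fix n
    from contra obtain x where "x \<in> X" "\<not> f x \<le> ennreal (real n)" by (metis of_nat_0_le_iff)
    then show "X \<inter> F n \<noteq> {}" by (auto simp: F_def)
  qed
  then obtain x where x: "x \<in> X" "\<And>n. ennreal (real n) \<le> f x" by (auto simp: F_def)
  obtain r where r: "f x = ennreal r" "0 \<le> r" using assms(3)[OF x(1)] by (cases "f x") auto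
  obtain n :: nat where "r < real n" using reals_Archimedean2 by blast
  with x(2)[of n] r show False by (simp add: ennreal_le_iff)
qed

text \<open>For \<open>t\<close> strictly between the two sides, the closed sets where
  \<open>t \<le> f\<close> inside \<open>D n\<close> are nested and nonempty, so compactness yields
  such a point in the intersection. This makes sums over shrinking neighbourhoods of a fibre
  converge to the sum over the fibre.\<close>

lemma usc_INF_SUP:
  fixes X :: "(nat \<Rightarrow> 'a::{finite, discrete_topology}) set"
  assumes "compact X" "upper_semicontinuous_on X f" "\<And>n. closed (D n)" "decseq D"
  shows "(INF n. SUP x\<in>X \<inter> D n. f x) = (SUP x\<in>X \<inter> (\<Inter>n. D n). f x)"
proof (rule antisym)
  show "(SUP x\<in>X \<inter> (\<Inter>n. D n). f x) \<le> (INF n. SUP x\<in>X \<inter> D n. f x)"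
    by (intro INF_greatest SUP_subset_mono) auto
  show "(INF n. SUP x\<in>X \<inter> D n. f x) \<le> (SUP x\<in>X \<inter> (\<Inter>n. D n). f x)"
  proof (rule ccontr)
    assume "\<not> ?thesis"
    then obtain t where t: "(SUP x\<in>X \<inter> (\<Inter>n. D n). f x) < t" "t < (INF n. SUP x\<in>X \<inter> D n. f x)"
      using dense not_le by metis
    define F where "F n = {x \<in> X. t \<le> f x} \<inter> D n" for n
    have "X \<inter> (\<Inter>n. F n) \<noteq> {}"
    proof (rule compact_decseq_Int_nonempty[OF assms(1)])
      show "closed (F n)" for n unfolding F_def by (intro closed_Int usc_closed assms)
      show "decseq F" using assms(4) unfolding decseq_def F_def by blast
      fix n
      have "t < (SUP x\<in>X \<inter> D n. f x)" using t(2) by (rule less_INF_D) simp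
      then obtain x where "x \<in> X \<inter> D n" "t < f x" by (auto simp: less_SUP_iff)
      then show "X \<inter> F n \<noteq> {}" by (auto simp: F_def)
    qed
    then obtain x where "x \<in> X \<inter> (\<Inter>n. D n)" "t \<le> f x" by (auto simp: F_def)
    then have "t \<le> (SUP x\<in>X \<inter> (\<Inter>n. D n). f x)" by (rule SUP_upper2[of x])
    with t(1) show False by simp
  qed
qed

lemma decseq_SUP:
  assumes "decseq D" shows "decseq (\<lambda>n. SUP x\<in>X \<inter> D n. f x :: 'b::complete_lattice)"
  using decseqD[OF assms] by (intro decseq_SucI SUP_subset_mono Int_mono) auto

lemma (in seq_prob) borel_measurable_usc:
  assumes "compact X" "upper_semicontinuous_on X f"
  shows "f \<in> borel_measurable M"
proof (rule borel_measurableI_ge)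
  fix t
  have "{x \<in> space M. t \<le> f x} = X \<inter> {x \<in> X. t \<le> f x}" by (auto simp: space_M)
  then show "{x \<in> space M. t \<le> f x} \<in> sets M"
    using usc_closed[OF assms, of t] by (auto intro!: borel_Int_in_sets)
qed

section \<open>Sub-additive potentials\<close>

lemma continuous_imp_usc: "continuous_on X f \<Longrightarrow> upper_semicontinuous_on X f"
  unfolding upper_semicontinuous_on_def
proof
  fix t assume "continuous_on X f"
  then have "closedin (top_of_set X) (X \<inter> f -` {t..})" by (rule continuous_closedin_preimage) simp
  moreover have "X \<inter> f -` {t..} = {x \<in> X. t \<le> f x}" by auto
  ultimately show "closedin (top_of_set X) {x \<in> X. t \<le> f x}" by simp
qed

lemma usc_subadditive_potential:
  "subadditive_potential X \<theta> \<Longrightarrow> usc_subadditive_potential X \<theta>"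
  unfolding subadditive_potential_def usc_subadditive_potential_def by (auto intro: continuous_imp_usc)

lemma usc_potential_bounded:
  assumes "compact X" "usc_subadditive_potential X \<phi>" "1 \<le> n"
  shows "\<exists>B. 0 \<le> B \<and> (\<forall>x\<in>X. \<phi> n x \<le> ennreal B)"
  by (rule usc_bounded[OF assms(1)]) (use assms in \<open>auto simp: usc_subadditive_potential_def\<close>)

section \<open>Closeness of potentials up to factors exponential in the length\<close>

text \<open>The multiplicative form of a small \<open>asymptotic_log_distance\<close>. It forces
  common zeros without any convention at 0 and passes directly through suprema and finite sums over
  words, which is how fibre sums inherit approximants.\<close>

definition near :: "real \<Rightarrow> (nat \<Rightarrow> 'a) set \<Rightarrow> 'a potential \<Rightarrow> 'a potential \<Rightarrow> bool" where
  "near \<delta> X \<phi> \<theta> \<longleftrightarrow> (\<forall>\<^sub>F n in sequentially. \<forall>x\<in>X.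
     \<phi> n x \<le> ennreal (exp (real n * \<delta>)) * \<theta> n x \<and> \<theta> n x \<le> ennreal (exp (real n * \<delta>)) * \<phi> n x)"

lemma log_distance_leD:
  assumes le: "log_distance u v \<le> ereal d" and v: "v < \<top>"
  shows "u \<le> ennreal (exp d) * v \<and> v \<le> ennreal (exp d) * u"
proof -
  consider "u = 0" "v = 0" | "u = 0" "v \<noteq> 0" | "u \<noteq> 0" "v = 0" | "u = \<top>" "v \<noteq> 0" | "u \<noteq> 0" "v \<noteq> 0" "u < \<top>"
    by (metis less_top)
  then show ?thesis
  proof cases
    case 5
    define r where "r = enn2real u"
    define s where "s = enn2real v"
    have pos: "0 < r" "0 < s" and uv: "u = ennreal r" "v = ennreal s"
      using 5 v by (auto simp: r_def s_def enn2real_positive_iff zero_less_iff_neq_zero)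
    have "\<bar>ln r - ln s\<bar> \<le> d"
      using le 5 v pos by (simp add: log_distance_def eln_def uv)
    then have "ln r \<le> ln (exp d * s)" "ln s \<le> ln (exp d * r)"
      using pos by (auto simp: ln_mult)
    then have "r \<le> exp d * s" "s \<le> exp d * r" using pos by (auto simp: ln_le_cancel_iff)
    then show ?thesis using pos by (simp add: uv ennreal_mult'[symmetric] ennreal_leI)
  qed (use le v in \<open>auto simp: log_distance_def eln_def split: if_splits\<close>)
qed

lemma log_distance_leI:
  assumes u: "u \<le> ennreal (exp d) * v" and v: "v \<le> ennreal (exp d) * u" and fin: "v < \<top>" and d: "0 \<le> d"
  shows "log_distance u v \<le> ereal d"
proof (cases "u = 0 \<or> v = 0")
  case True
  then show ?thesis using u v d by (auto simp: log_distance_def)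
next
  case False
  have "u < \<top>" using u fin by (auto simp: ennreal_mult_less_top intro: le_less_trans)
  define r where "r = enn2real u"
  define s where "s = enn2real v"
  have pos: "0 < r" "0 < s" and uv: "u = ennreal r" "v = ennreal s"
    using False fin \<open>u < \<top>\<close> by (auto simp: r_def s_def enn2real_positive_iff zero_less_iff_neq_zero)
  have "r \<le> exp d * s" "s \<le> exp d * r"
    using u v pos by (simp_all add: uv ennreal_mult'[symmetric] ennreal_le_iff)
  then have "ln r \<le> ln (exp d * s)" "ln s \<le> ln (exp d * r)" using pos by (auto intro!: ln_mono)
  then have "\<bar>ln r - ln s\<bar> \<le> d" using pos by (simp add: ln_mult)
  then show ?thesis using pos by (simp add: log_distance_def eln_def uv)
qed

lemma near_of_asymptotic_log_distance:
  assumes "asymptotic_log_distance X \<phi> \<theta> \<le> ereal \<epsilon>" "\<epsilon> < \<delta>"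
    and fin: "\<And>n x. 1 \<le> n \<Longrightarrow> x \<in> X \<Longrightarrow> \<theta> n x < \<top>"
  shows "near \<delta> X \<phi> \<theta>"
proof -
  have "limsup (\<lambda>n. (SUP x\<in>X. log_distance (\<phi> n x) (\<theta> n x)) / ereal (real n)) < ereal \<delta>"
    using assms(1,2) unfolding asymptotic_log_distance_def by (auto intro: le_less_trans)
  then have "\<forall>\<^sub>F n in sequentially. (SUP x\<in>X. log_distance (\<phi> n x) (\<theta> n x)) / ereal (real n) < ereal \<delta>"
    by (rule Limsup_lessD)
  with eventually_ge_at_top[of 1] show ?thesis
    unfolding near_def
  proof eventually_elim
    case (elim n)
    show ?case
    proof
      fix x assume x: "x \<in> X"
      have "(SUP x\<in>X. log_distance (\<phi> n x) (\<theta> n x)) \<le> ereal (real n * \<delta>)"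
        using elim by (simp add: ereal_divide_less_iff[of "ereal (real n)"] mult.commute less_imp_le)
      then have "log_distance (\<phi> n x) (\<theta> n x) \<le> ereal (real n * \<delta>)"
        using x by (auto simp: SUP_le_iff)
      with fin[OF elim(1) x] show "\<phi> n x \<le> ennreal (exp (real n * \<delta>)) * \<theta> n x \<and>
          \<theta> n x \<le> ennreal (exp (real n * \<delta>)) * \<phi> n x"
        by (intro log_distance_leD)
    qed
  qed
qed

lemma asymptotic_log_distance_of_near:
  assumes "near \<delta> X \<phi> \<theta>" "0 \<le> \<delta>" and fin: "\<And>n x. 1 \<le> n \<Longrightarrow> x \<in> X \<Longrightarrow> \<theta> n x < \<top>"
  shows "asymptotic_log_distance X \<phi> \<theta> \<le> ereal \<delta>"
  unfolding asymptotic_log_distance_def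
proof (rule Limsup_bounded)
  show "\<forall>\<^sub>F n in sequentially. (SUP x\<in>X. log_distance (\<phi> n x) (\<theta> n x)) / ereal (real n) \<le> ereal \<delta>"
    using assms(1)[unfolded near_def] eventually_ge_at_top[of 1]
  proof eventually_elim
    case (elim n)
    have "(SUP x\<in>X. log_distance (\<phi> n x) (\<theta> n x)) \<le> ereal (real n * \<delta>)"
      using elim assms(2) fin by (intro SUP_least log_distance_leI) auto
    then show ?case using elim(2) by (simp add: ereal_divide_le_pos mult.commute)
  qed
qed

lemma usc_asymptotically_subadditive_iff:
  "usc_asymptotically_subadditive X \<phi> \<longleftrightarrow>
    (\<forall>\<epsilon>>0. \<exists>\<theta>. usc_subadditive_potential X \<theta> \<and> near \<epsilon> X \<phi> \<theta>)" (is "?L \<longleftrightarrow> ?R")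
proof
  assume L: ?L
  show ?R
  proof (intro allI impI)
    fix \<epsilon> :: real assume "0 < \<epsilon>"
    \<comment> \<open>A bound on the limsup becomes an eventual bound only with some room to
      spare.\<close>
    then have "0 < \<epsilon> / 2" by simp
    with L obtain \<theta> where "usc_subadditive_potential X \<theta>" "asymptotic_log_distance X \<phi> \<theta> \<le> ereal (\<epsilon> / 2)"
      unfolding usc_asymptotically_subadditive_def by blast
    then show "\<exists>\<theta>. usc_subadditive_potential X \<theta> \<and> near \<epsilon> X \<phi> \<theta>"
      using \<open>0 < \<epsilon>\<close> by (intro exI[of _ \<theta>] conjI near_of_asymptotic_log_distance[of X \<phi> \<theta> "\<epsilon> / 2"])
        (auto simp: usc_subadditive_potential_def)
  qed
next
  assume R: ?R
  show ?L unfolding usc_asymptotically_subadditive_def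
  proof (intro allI impI)
    fix \<epsilon> :: real assume "0 < \<epsilon>"
    with R obtain \<theta> where "usc_subadditive_potential X \<theta>" "near \<epsilon> X \<phi> \<theta>" by blast
    then show "\<exists>\<theta>. usc_subadditive_potential X \<theta> \<and> asymptotic_log_distance X \<phi> \<theta> \<le> ereal \<epsilon>"
      using \<open>0 < \<epsilon>\<close> by (intro exI[of _ \<theta>] conjI asymptotic_log_distance_of_near)
        (auto simp: usc_subadditive_potential_def)
  qed
qed

lemma usc_asymptotically_subadditive:
  assumes "asymptotically_subadditive X \<phi>" shows "usc_asymptotically_subadditive X \<phi>"
  unfolding usc_asymptotically_subadditive_def
proof (intro allI impI)
  fix \<epsilon> :: real assume "0 < \<epsilon>"
  with assms obtain \<theta> where "subadditive_potential X \<theta>" "asymptotic_log_distance X \<phi> \<theta> \<le> ereal \<epsilon>"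
    unfolding asymptotically_subadditive_def by blast
  then show "\<exists>\<theta>. usc_subadditive_potential X \<theta> \<and> asymptotic_log_distance X \<phi> \<theta> \<le> ereal \<epsilon>"
    using usc_subadditive_potential[of X \<theta>] by blast
qed

section \<open>Truncated potentials and their means\<close>

text \<open>The level \<open>k * n\<close> is proportional to the length because levels add. As
  \<open>\<phi> 0\<close> is arbitrary, length 0 gets the value 0.\<close>

definition trunc_log :: "'a potential \<Rightarrow> nat \<Rightarrow> nat \<Rightarrow> (nat \<Rightarrow> 'a) \<Rightarrow> real" where
  "trunc_log \<phi> k n x = (if n = 0 then 0 else trunc_ln (real k * real n) (\<phi> n x))"

definition trunc_mean :: "'a potential \<Rightarrow> nat \<Rightarrow> (nat \<Rightarrow> 'a) measure \<Rightarrow> real" where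
  "trunc_mean \<phi> k M = lim (\<lambda>n. (\<integral>x. trunc_log \<phi> k n x \<partial>M) / real n)"

text \<open>The point is that one \<open>C\<close> works for all \<open>k\<close>: it is the
  logarithm of the sub-multiplicativity constant, raised to at least 1. The lower bound later lets
  the level grow with the length and depends on this.\<close>

lemma trunc_log_subadditive:
  assumes "usc_subadditive_potential X \<phi>" and shift: "left_shift ` X \<subseteq> X"
  shows "\<exists>C\<ge>0. \<forall>k m n. \<forall>x\<in>X.
    trunc_log \<phi> k (m + n) x \<le> C + trunc_log \<phi> k m x + trunc_log \<phi> k n ((left_shift ^^ m) x)"
proof -
  obtain c where c: "0 < c" "\<forall>n\<ge>1. \<forall>m\<ge>1. \<forall>x\<in>X.
      \<phi> (n + m) x \<le> ennreal c * \<phi> n x * \<phi> m ((left_shift ^^ n) x)"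
    using assms unfolding usc_subadditive_potential_def submultiplicative_up_to_const_def by blast
  have fin: "\<phi> n x < \<top>" if "1 \<le> n" "x \<in> X" for n x
    using assms that by (auto simp: usc_subadditive_potential_def)
  show ?thesis
  proof (intro exI[of _ "ln (max c 1)"] conjI allI ballI)
    show "0 \<le> ln (max c 1)" by simp
    fix k m n :: nat and x assume x: "x \<in> X"
    have Tx: "(left_shift ^^ m) x \<in> X" using x shift by (induction m) auto
    show "trunc_log \<phi> k (m + n) x \<le> ln (max c 1) + trunc_log \<phi> k m x + trunc_log \<phi> k n ((left_shift ^^ m) x)"
    proof (cases "m = 0 \<or> n = 0")
      case True
      then show ?thesis by (auto simp: trunc_log_def)
    next
      case False
      have "\<phi> (m + n) x \<le> ennreal c * \<phi> m x * \<phi> n ((left_shift ^^ m) x)" using False c(2) x by simp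
      also have "\<dots> \<le> ennreal (max c 1) * \<phi> m x * \<phi> n ((left_shift ^^ m) x)"
        by (intro mult_right_mono ennreal_leI) auto
      finally have "trunc_ln (real k * real m + real k * real n) (\<phi> (m + n) x) \<le>
        ln (max c 1) + trunc_ln (real k * real m) (\<phi> m x) + trunc_ln (real k * real n) (\<phi> n ((left_shift ^^ m) x))"
        using fin x Tx False by (intro trunc_ln_le_of_mult) auto
      then show ?thesis using False by (simp add: trunc_log_def distrib_left)
    qed
  qed
qed

lemma trunc_log_ge: "- (real k * real n) \<le> trunc_log \<phi> k n x"
  by (simp add: trunc_log_def trunc_ln_ge)

lemma trunc_log_antimono: "j \<le> k \<Longrightarrow> trunc_log \<phi> k n x \<le> trunc_log \<phi> j n x"
  by (simp add: trunc_log_def trunc_ln_antimono mult_right_mono)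

lemma trunc_log_bounded:
  assumes "compact X" "usc_subadditive_potential X \<phi>"
  shows "\<exists>K\<ge>0. \<forall>x\<in>X. \<bar>trunc_log \<phi> k n x\<bar> \<le> K"
proof (cases "n = 0")
  case False
  then obtain B where "\<forall>x\<in>X. \<phi> n x \<le> ennreal B"
    using usc_potential_bounded[OF assms, of n] by auto
  then have "\<bar>trunc_log \<phi> k n x\<bar> \<le> \<bar>real k * real n\<bar> + \<bar>ln (max B (exp (- (real k * real n))))\<bar>"
    if "x \<in> X" for x using trunc_ln_bounded[of "\<phi> n x" B "real k * real n"] False that
    by (simp add: trunc_log_def)
  then show ?thesis
    by (intro exI[of _ "\<bar>real k * real n\<bar> + \<bar>ln (max B (exp (- (real k * real n))))\<bar>"]) simp
qed (auto simp: trunc_log_def)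

lemma (in seq_prob) integrable_trunc_log:
  assumes "compact X" "usc_subadditive_potential X \<phi>"
  shows "integrable M (trunc_log \<phi> k n)"
proof (cases "n = 0")
  case False
  then obtain B where B: "\<forall>x\<in>X. \<phi> n x \<le> ennreal B"
    using usc_potential_bounded[OF assms, of n] by auto
  have "\<phi> n \<in> borel_measurable M"
    using assms False by (intro borel_measurable_usc) (auto simp: usc_subadditive_potential_def)
  from integrable_trunc_ln[OF this, of B] B False show ?thesis
    by (simp add: trunc_log_def[abs_def] space_M)
qed (simp add: trunc_log_def[abs_def])

context seq_invariant
begin

lemma integral_shift_pow:
  fixes f :: "(nat \<Rightarrow> 'a) \<Rightarrow> real"
  assumes "integrable M f"
  shows "integrable M (\<lambda>x. f ((left_shift ^^ i) x))" "(\<integral>x. f ((left_shift ^^ i) x) \<partial>M) = (\<integral>x. f x \<partial>M)"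
proof -
  have "integrable (distr M M (left_shift ^^ i)) f" using assms by (simp add: distr_shift_pow)
  then show "integrable M (\<lambda>x. f ((left_shift ^^ i) x))"
    using measurable_shift_pow by (subst (asm) integrable_distr_eq) (use assms in auto)
  show "(\<integral>x. f ((left_shift ^^ i) x) \<partial>M) = (\<integral>x. f x \<partial>M)"
    using integral_distr[OF measurable_shift_pow, of f i] assms by (simp add: distr_shift_pow)
qed

text \<open>Adding \<open>C\<close> to the integrals makes them sub-additive, and truncation
  supplies the linear lower bound for \<open>fekete\<close>. The error \<open>C\<close> is inherited
  from \<open>trunc_log_subadditive\<close>, hence again independent of \<open>k\<close>.\<close>

lemma trunc_mean:
  assumes X: "compact X" and \<phi>: "usc_subadditive_potential X \<phi>"
  shows trunc_mean_tendsto: "(\<lambda>n. (\<integral>x. trunc_log \<phi> k n x \<partial>M) / real n) \<longlonglongrightarrow> trunc_mean \<phi> k M"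
    and trunc_mean_le: "\<exists>C\<ge>0. \<forall>k. \<forall>n\<ge>1. real n * trunc_mean \<phi> k M \<le> (\<integral>x. trunc_log \<phi> k n x \<partial>M) + C"
proof -
  obtain C where C: "0 \<le> C" and C_all: "\<forall>k m n. \<forall>x\<in>X.
      trunc_log \<phi> k (m + n) x \<le> C + trunc_log \<phi> k m x + trunc_log \<phi> k n ((left_shift ^^ m) x)"
    using trunc_log_subadditive[OF \<phi> shift_X] by (elim exE conjE)
  note int = integrable_trunc_log[OF X \<phi>]
  define I where "I k n = (\<integral>x. trunc_log \<phi> k n x \<partial>M)" for k n
  have sub: "I k (m + n) + C \<le> (I k m + C) + (I k n + C)" for k m n
  proof -
    have "I k (m + n) \<le> (\<integral>x. C + trunc_log \<phi> k m x + trunc_log \<phi> k n ((left_shift ^^ m) x) \<partial>M)"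
      unfolding I_def
    proof (rule integral_mono[OF int])
      show "integrable M (\<lambda>x. C + trunc_log \<phi> k m x + trunc_log \<phi> k n ((left_shift ^^ m) x))"
        by (intro Bochner_Integration.integrable_add int integral_shift_pow(1)[OF int]) simp
      show "trunc_log \<phi> k (m + n) x \<le> C + trunc_log \<phi> k m x + trunc_log \<phi> k n ((left_shift ^^ m) x)"
        if "x \<in> space M" for x using C_all that by (simp add: space_M)
    qed
    also have "\<dots> = C + I k m + I k n"
      using int integral_shift_pow[OF int] by (simp add: I_def prob_space)
    finally show ?thesis by simp
  qed
  have low: "- real k * real n \<le> I k n + C" for k n
  proof -
    have "(\<integral>x. - (real k * real n) \<partial>M) \<le> I k n"
      unfolding I_def by (intro integral_mono int trunc_log_ge) auto
    then show ?thesis using C by (simp add: prob_space)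
  qed
  have fek: "\<exists>h. (\<lambda>n. (I k n + C) / real n) \<longlonglongrightarrow> h \<and> (\<forall>n\<ge>1. h * real n \<le> I k n + C)" for k
    using sub low by (intro fekete[of "\<lambda>n. I k n + C" "- real k"]) auto
  have both: "(\<lambda>n. I k n / real n) \<longlonglongrightarrow> trunc_mean \<phi> k M \<and>
    (\<forall>n\<ge>1. trunc_mean \<phi> k M * real n \<le> I k n + C)" for k
  proof -
    obtain h where h: "(\<lambda>n. (I k n + C) / real n) \<longlonglongrightarrow> h" "\<forall>n\<ge>1. h * real n \<le> I k n + C"
      using fek by blast
    have "(\<lambda>n. (I k n + C) / real n - C / real n) \<longlonglongrightarrow> h - 0"
      by (intro tendsto_diff h real_div_const_tendsto_0)
    then have lim: "(\<lambda>n. I k n / real n) \<longlonglongrightarrow> h" by (simp add: add_divide_distrib)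
    then have "trunc_mean \<phi> k M = h" unfolding trunc_mean_def I_def by (rule limI)
    with lim h show ?thesis by simp
  qed
  from both show "(\<lambda>n. (\<integral>x. trunc_log \<phi> k n x \<partial>M) / real n) \<longlonglongrightarrow> trunc_mean \<phi> k M"
    by (simp add: I_def)
  from both C show "\<exists>C\<ge>0. \<forall>k. \<forall>n\<ge>1. real n * trunc_mean \<phi> k M \<le> (\<integral>x. trunc_log \<phi> k n x \<partial>M) + C"
    unfolding I_def by (intro exI[of _ C]) (simp add: mult.commute)
qed

end

section \<open>The mean of a potential\<close>

text \<open>Convergence of the averages of an asymptotically sub-additive potential is inherited
  from approximants. Comparing limsup with liminf up to every \<open>d\<close> also covers the limit
  -infinity.\<close>

lemma eventually_le_tendsto_ereal:
  fixes x y :: "nat \<Rightarrow> ereal"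
  assumes "\<And>e::real. 0 < e \<Longrightarrow> \<exists>y t. y \<longlonglongrightarrow> t \<and>
    (\<forall>\<^sub>F n in sequentially. x n \<le> y n + ereal e \<and> y n \<le> x n + ereal e)"
  shows "\<exists>L. x \<longlonglongrightarrow> L"
proof -
  have "limsup x \<le> liminf x + ereal d" if "0 < d" for d
  proof -
    have "0 < d / 2" using that by simp
    from assms[OF this] obtain y t where y: "y \<longlonglongrightarrow> t"
      "\<forall>\<^sub>F n in sequentially. x n \<le> y n + ereal (d / 2) \<and> y n \<le> x n + ereal (d / 2)" by blast
    have "(\<lambda>n. y n + ereal (d / 2)) \<longlonglongrightarrow> t + ereal (d / 2)"
      using y(1) by (rule tendsto_add_left_ereal[rotated]) simp
    then have "limsup (\<lambda>n. y n + ereal (d / 2)) = t + ereal (d / 2)" by (intro lim_imp_Limsup) auto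
    moreover have "limsup x \<le> limsup (\<lambda>n. y n + ereal (d / 2))"
      using y(2) by (intro Limsup_mono) (auto elim: eventually_mono)
    moreover have "(\<lambda>n. y n + ereal (- d / 2)) \<longlonglongrightarrow> t + ereal (- d / 2)"
      using y(1) by (rule tendsto_add_left_ereal[rotated]) simp
    then have "liminf (\<lambda>n. y n + ereal (- d / 2)) = t + ereal (- d / 2)" by (intro lim_imp_Liminf) auto
    moreover have "liminf (\<lambda>n. y n + ereal (- d / 2)) \<le> liminf x"
    proof (rule Liminf_mono)
      show "\<forall>\<^sub>F n in sequentially. y n + ereal (- d / 2) \<le> x n"
        using y(2)
      proof eventually_elim
        case (elim n)
        then show ?case by (cases "y n"; cases "x n") auto
      qed
    qed
    ultimately have "limsup x \<le> t + ereal (d / 2)" "t + ereal (- d / 2) \<le> liminf x" by simp_all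
    then show ?thesis by (cases "limsup x"; cases "liminf x"; cases t) auto
  qed
  then have "limsup x \<le> liminf x" by (rule ereal_le_epsilon2)
  then have "liminf x = limsup x" by (intro antisym Liminf_le_Limsup) auto
  then have "x \<longlonglongrightarrow> limsup x" by (intro Liminf_eq_Limsup) auto
  then show ?thesis by blast
qed

text \<open>The library states \<open>nn_integral_cmult\<close> for measurable functions only; a positive constant can
  be cancelled, so it may be pulled out of the lower integral of an arbitrary function.\<close>

lemma nn_integral_cmult_lower:
  fixes f :: "'a \<Rightarrow> ennreal"
  assumes "0 < c"
  shows "(\<integral>\<^sup>+x. ennreal c * f x \<partial>M) = ennreal c * (\<integral>\<^sup>+x. f x \<partial>M)"
proof (rule antisym)
  have le: "ennreal d * (\<integral>\<^sup>+x. g x \<partial>M) \<le> (\<integral>\<^sup>+x. ennreal d * g x \<partial>M)" for d and g :: "'a \<Rightarrow> ennreal"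
  proof -
    have ne: "{s. simple_function M s \<and> s \<le> g} \<noteq> {}"
      by (auto intro!: exI[of _ "\<lambda>_. 0"] simp: le_fun_def)
    have "ennreal d * (\<integral>\<^sup>+x. g x \<partial>M) = (SUP s\<in>{s. simple_function M s \<and> s \<le> g}. ennreal d * integral\<^sup>S M s)"
      unfolding nn_integral_def using ne by (simp add: SUP_mult_left_ennreal)
    also have "\<dots> \<le> (\<integral>\<^sup>+x. ennreal d * g x \<partial>M)"
    proof (rule SUP_least)
      fix s assume "s \<in> {s. simple_function M s \<and> s \<le> g}"
      then have s: "simple_function M s" "\<And>x. s x \<le> g x" by (auto simp: le_fun_def)
      have "ennreal d * integral\<^sup>S M s = (\<integral>\<^sup>+x. ennreal d * s x \<partial>M)"
        using s(1) by (simp add: nn_integral_cmult borel_measurable_simple_function nn_integral_eq_simple_integral)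
      also have "\<dots> \<le> (\<integral>\<^sup>+x. ennreal d * g x \<partial>M)" by (intro nn_integral_mono mult_left_mono s(2)) auto
      finally show "ennreal d * integral\<^sup>S M s \<le> (\<integral>\<^sup>+x. ennreal d * g x \<partial>M)" .
    qed
    finally show ?thesis .
  qed
  show "ennreal c * (\<integral>\<^sup>+x. f x \<partial>M) \<le> (\<integral>\<^sup>+x. ennreal c * f x \<partial>M)" by (rule le)
  have 1: "ennreal (1 / c) * (ennreal c * z) = z" "ennreal c * (ennreal (1 / c) * z) = z" for z
    using assms by (simp_all add: mult.assoc[symmetric] ennreal_mult'[symmetric])
  have "ennreal (1 / c) * (\<integral>\<^sup>+x. ennreal c * f x \<partial>M) \<le> (\<integral>\<^sup>+x. f x \<partial>M)"
    using le[of "1 / c" "\<lambda>x. ennreal c * f x"] by (simp only: 1)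
  from mult_left_mono[OF this, of "ennreal c"]
  show "(\<integral>\<^sup>+x. ennreal c * f x \<partial>M) \<le> ennreal c * (\<integral>\<^sup>+x. f x \<partial>M)" by (simp only: 1 zero_le)
qed

lemma ereal_integral_cmult:
  assumes "0 < c"
  shows "ereal_integral M (\<lambda>x. ereal c * f x) = ereal c * ereal_integral M f"
proof -
  have e: "e2ennreal (ereal c * z) = ennreal c * e2ennreal z" for z
    using assms by (cases z) (auto simp: ennreal_mult' ennreal_mult_top e2ennreal_neg)
  have m: "- (ereal c * z) = ereal c * (- z)" for z by simp
  have n: "enn2ereal (ennreal c * u) = ereal c * enn2ereal u" for u
    using assms by (simp add: times_ennreal.rep_eq enn2ereal_ennreal)
  have d: "ereal c * u - ereal c * v = ereal c * (u - v)" for u v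
    using assms by (cases u; cases v) (auto simp: right_diff_distrib)
  show ?thesis
    unfolding ereal_integral_def m e nn_integral_cmult_lower[OF assms] n d ..
qed

lemma eln_epowr: "0 < p \<Longrightarrow> eln (epowr u p) = ereal p * eln u"
proof (cases "u = 0 \<or> u = \<top>")
  case False
  then have "0 < enn2real u" by (simp add: enn2real_positive_iff zero_less_iff_neq_zero less_top[symmetric])
  with False show ?thesis by (simp add: eln_def epowr_def ln_powr)
qed (auto simp: eln_def epowr_def)

context seq_invariant
begin

text \<open>An exchange of the limit in \<open>n\<close> with the infimum over \<open>k\<close>.
  That the limit cannot exceed the infimum follows from truncation raising the integrand. Conversely
  the constant in \<open>trunc_mean_le\<close> is common to all \<open>k\<close>, so at length
  \<open>n\<close> the integral is at least \<open>n\<close> times the infimum minus that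
  constant.\<close>

lemma potential_mean_usc_tendsto:
  assumes X: "compact X" and \<phi>: "usc_subadditive_potential X \<phi>"
  shows "(\<lambda>n. ereal_integral M (\<lambda>x. eln (\<phi> n x)) / ereal (real n)) \<longlonglongrightarrow> (INF k. ereal (trunc_mean \<phi> k M))"
proof -
  define J where "J n = ereal_integral M (\<lambda>x. eln (\<phi> n x))" for n
  obtain C where C: "\<forall>k. \<forall>n\<ge>1. real n * trunc_mean \<phi> k M \<le> (\<integral>x. trunc_log \<phi> k n x \<partial>M) + C"
    using trunc_mean_le[OF X \<phi>] by blast
  have meas: "\<phi> n \<in> borel_measurable M" if "1 \<le> n" for n
    using X \<phi> that by (intro borel_measurable_usc) (auto simp: usc_subadditive_potential_def)
  have upper: "J n \<le> ereal (\<integral>x. trunc_log \<phi> k n x \<partial>M)" if n: "1 \<le> n" for n k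
  proof -
    obtain B where "\<And>x. x \<in> space M \<Longrightarrow> \<phi> n x \<le> ennreal B"
      using usc_potential_bounded[OF X \<phi> n] by (auto simp: space_M)
    from ereal_integral_eln_le[OF meas[OF n] this, of "real k * real n"] n show ?thesis
      by (simp add: J_def trunc_log_def)
  qed
  have lower: "ereal l \<le> J n" if n: "1 \<le> n" and l: "\<And>k. l \<le> (\<integral>x. trunc_log \<phi> k n x \<partial>M)" for n l
  proof -
    obtain B where B: "\<And>x. x \<in> space M \<Longrightarrow> \<phi> n x \<le> ennreal B"
      using usc_potential_bounded[OF X \<phi> n] by (auto simp: space_M)
    \<comment> \<open>\<open>ereal_integral_eln_ge\<close> asks for the levels \<open>k\<close>; the
      hypothesis speaks of the levels \<open>k * n\<close>, which cut off no higher because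
      \<open>n\<close> is at least 1.\<close>
    have "l \<le> (\<integral>x. trunc_ln (real k) (\<phi> n x) \<partial>M)" for k :: nat
    proof -
      have "(\<integral>x. trunc_log \<phi> k n x \<partial>M) \<le> (\<integral>x. trunc_ln (real k) (\<phi> n x) \<partial>M)"
      proof (rule integral_mono[OF integrable_trunc_log[OF X \<phi>] integrable_trunc_ln[OF meas[OF n] B]])
        have "real k * 1 \<le> real k * real n" using n by (intro mult_left_mono) auto
        then show "trunc_log \<phi> k n x \<le> trunc_ln (real k) (\<phi> n x)" for x
          using n by (auto simp: trunc_log_def intro: trunc_ln_antimono)
      qed
      with l[of k] show ?thesis by linarith
    qed
    from ereal_integral_eln_ge[OF meas[OF n] B this] show ?thesis by (simp add: J_def)
  qed
  let ?L = "INF k. ereal (trunc_mean \<phi> k M)"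
  have "(\<lambda>n. J n / ereal (real n)) \<longlonglongrightarrow> ?L"
  proof (rule order_tendstoI)
    fix a assume "?L < a"
    then obtain k where k: "ereal (trunc_mean \<phi> k M) < a" by (auto simp: INF_less_iff)
    have "(\<lambda>n. ereal ((\<integral>x. trunc_log \<phi> k n x \<partial>M) / real n)) \<longlonglongrightarrow> ereal (trunc_mean \<phi> k M)"
      by (intro tendsto_ereal trunc_mean_tendsto[OF X \<phi>])
    then have "\<forall>\<^sub>F n in sequentially. ereal ((\<integral>x. trunc_log \<phi> k n x \<partial>M) / real n) < a"
      using k by (rule order_tendstoD)
    with eventually_ge_at_top[of 1] show "\<forall>\<^sub>F n in sequentially. J n / ereal (real n) < a"
    proof eventually_elim
      case (elim n)
      have "J n / ereal (real n) \<le> ereal (\<integral>x. trunc_log \<phi> k n x \<partial>M) / ereal (real n)"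
        using upper[OF elim(1)] elim(1) by (intro ereal_divide_right_mono) auto
      also have "\<dots> = ereal ((\<integral>x. trunc_log \<phi> k n x \<partial>M) / real n)" using elim(1) by simp
      finally show ?case using elim(2) by (rule le_less_trans)
    qed
  next
    fix a assume a: "a < ?L"
    show "\<forall>\<^sub>F n in sequentially. a < J n / ereal (real n)"
    proof (cases ?L)
      case (real l)
      have "l \<le> trunc_mean \<phi> k M" for k
      proof -
        have "?L \<le> ereal (trunc_mean \<phi> k M)" by (rule INF_lower) simp
        then show ?thesis by (simp add: real)
      qed
      then have l: "real n * l - C \<le> (\<integral>x. trunc_log \<phi> k n x \<partial>M)" if "1 \<le> n" for k n
      proof -
        have "real n * l \<le> real n * trunc_mean \<phi> k M" using \<open>l \<le> trunc_mean \<phi> k M\<close> by (intro mult_left_mono) auto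
        with C that show ?thesis by (smt (verit))
      qed
      have "(\<lambda>n. l - C / real n) \<longlonglongrightarrow> l - 0" by (intro tendsto_intros real_div_const_tendsto_0)
      then have "(\<lambda>n. ereal (l - C / real n)) \<longlonglongrightarrow> ereal l" by simp
      then have "\<forall>\<^sub>F n in sequentially. a < ereal (l - C / real n)"
        using a by (intro order_tendstoD(1)) (simp_all add: real)
      with eventually_ge_at_top[of 1] show ?thesis
      proof eventually_elim
        case (elim n)
        have "ereal (l - C / real n) = ereal (real n * l - C) / ereal (real n)"
          using elim(1) by (simp add: field_simps)
        also have "\<dots> \<le> J n / ereal (real n)"
          using lower[OF elim(1) l[OF elim(1)]] elim(1) by (intro ereal_divide_right_mono) auto
        finally show ?case using elim(2) by (rule less_le_trans[rotated])
      qed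
    next
      case PInf
      have "?L \<le> ereal (trunc_mean \<phi> 0 M)" by (rule INF_lower) simp
      with PInf show ?thesis by simp
    qed (use a in simp)
  qed
  then show ?thesis by (simp add: J_def)
qed

lemma potential_mean_usc:
  assumes "compact X" "usc_subadditive_potential X \<phi>"
  shows "potential_mean \<phi> M = (INF k. ereal (trunc_mean \<phi> k M))"
  unfolding potential_mean_def by (rule limI[OF potential_mean_usc_tendsto[OF assms]])

lemma ereal_integral_near:
  assumes X: "compact X" and \<theta>: "usc_subadditive_potential X \<theta>" and near: "near \<delta> X \<phi> \<theta>" and "0 \<le> \<delta>"
  shows "\<forall>\<^sub>F n in sequentially.
    ereal_integral M (\<lambda>x. eln (\<phi> n x)) / ereal (real n) \<le> ereal_integral M (\<lambda>x. eln (\<theta> n x)) / ereal (real n) + ereal \<delta> \<and>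
    ereal_integral M (\<lambda>x. eln (\<theta> n x)) / ereal (real n) \<le> ereal_integral M (\<lambda>x. eln (\<phi> n x)) / ereal (real n) + ereal \<delta>"
  using near[unfolded near_def] eventually_ge_at_top[of 1]
proof eventually_elim
  case (elim n)
  have meas: "\<theta> n \<in> borel_measurable M"
    using X \<theta> elim(2) by (intro borel_measurable_usc) (auto simp: usc_subadditive_potential_def)
  obtain B where B: "\<And>x. x \<in> space M \<Longrightarrow> \<theta> n x \<le> ennreal B"
    using usc_potential_bounded[OF X \<theta> elim(2)] by (auto simp: space_M)
  have div: "u / ereal (real n) \<le> v / ereal (real n) + ereal \<delta>" if "u \<le> v + ereal (real n * \<delta>)" for u v
    using that elim(2) by (cases u; cases v) (auto simp: field_simps)
  have "0 \<le> real n * \<delta>" using \<open>0 \<le> \<delta>\<close> by simp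
  then show ?case
    using elim(1)
    by (intro conjI div ereal_integral_eln_upper[OF meas B] ereal_integral_eln_lower[OF meas B]) (auto simp: space_M)
qed

lemma potential_mean_tendsto:
  assumes X: "compact X" and \<phi>: "usc_asymptotically_subadditive X \<phi>"
  shows "(\<lambda>n. ereal_integral M (\<lambda>x. eln (\<phi> n x)) / ereal (real n)) \<longlonglongrightarrow> potential_mean \<phi> M"
proof -
  have "\<exists>L. (\<lambda>n. ereal_integral M (\<lambda>x. eln (\<phi> n x)) / ereal (real n)) \<longlonglongrightarrow> L"
  proof (rule eventually_le_tendsto_ereal)
    fix e :: real assume "0 < e"
    with \<phi> obtain \<theta> where \<theta>: "usc_subadditive_potential X \<theta>" "near e X \<phi> \<theta>"
      by (auto simp: usc_asymptotically_subadditive_iff)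
    from potential_mean_usc_tendsto[OF X \<theta>(1)] ereal_integral_near[OF X \<theta>] \<open>0 < e\<close>
    show "\<exists>y t. y \<longlonglongrightarrow> t \<and> (\<forall>\<^sub>F n in sequentially.
        ereal_integral M (\<lambda>x. eln (\<phi> n x)) / ereal (real n) \<le> y n + ereal e \<and>
        y n \<le> ereal_integral M (\<lambda>x. eln (\<phi> n x)) / ereal (real n) + ereal e)"
      by (intro exI conjI) auto
  qed
  then show ?thesis unfolding potential_mean_def by (auto simp: limI)
qed

lemma potential_mean_near:
  assumes X: "compact X" and \<phi>: "usc_asymptotically_subadditive X \<phi>"
    and \<theta>: "usc_subadditive_potential X \<theta>" and near: "near \<delta> X \<phi> \<theta>" and \<delta>: "0 \<le> \<delta>"
  shows "potential_mean \<phi> M \<le> potential_mean \<theta> M + ereal \<delta>" "potential_mean \<theta> M \<le> potential_mean \<phi> M + ereal \<delta>"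
proof -
  note lim = potential_mean_tendsto[OF X \<phi>]
  have lim': "(\<lambda>n. ereal_integral M (\<lambda>x. eln (\<theta> n x)) / ereal (real n)) \<longlonglongrightarrow> potential_mean \<theta> M"
    using potential_mean_usc_tendsto[OF X \<theta>] by (simp add: potential_mean_usc[OF X \<theta>])
  note ev = ereal_integral_near[OF X \<theta> near \<delta>]
  have add: "(\<lambda>n. f n + ereal \<delta>) \<longlonglongrightarrow> t + ereal \<delta>" if "f \<longlonglongrightarrow> t" for f and t :: ereal
    using that by (rule tendsto_add_left_ereal[rotated]) simp
  show "potential_mean \<phi> M \<le> potential_mean \<theta> M + ereal \<delta>"
    by (rule tendsto_le[OF _ add[OF lim'] lim]) (use ev in \<open>auto elim: eventually_mono\<close>)
  show "potential_mean \<theta> M \<le> potential_mean \<phi> M + ereal \<delta>"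
    by (rule tendsto_le[OF _ add[OF lim] lim']) (use ev in \<open>auto elim: eventually_mono\<close>)
qed

lemma potential_mean_less_top:
  assumes X: "compact X" and \<phi>: "usc_asymptotically_subadditive X \<phi>"
  shows "potential_mean \<phi> M < \<infinity>"
proof -
  obtain \<theta> where \<theta>: "usc_subadditive_potential X \<theta>" "near 1 X \<phi> \<theta>"
    using \<phi> zero_less_one unfolding usc_asymptotically_subadditive_iff by blast
  have "potential_mean \<theta> M \<le> ereal (trunc_mean \<theta> 0 M)"
    unfolding potential_mean_usc[OF X \<theta>(1)] by (rule INF_lower) simp
  then have "potential_mean \<theta> M + ereal 1 < \<infinity>" by (cases "potential_mean \<theta> M") auto
  with potential_mean_near(1)[OF X \<phi> \<theta>] show ?thesis by (auto intro: le_less_trans)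
qed

lemma potential_mean_scale:
  assumes X: "compact X" and \<phi>: "usc_asymptotically_subadditive X \<phi>" and p: "0 < p"
  shows "potential_mean (scale_potential p \<phi>) M = ereal p * potential_mean \<phi> M"
proof -
  have "ereal_integral M (\<lambda>x. eln (scale_potential p \<phi> n x)) / ereal (real n) =
      ereal p * (ereal_integral M (\<lambda>x. eln (\<phi> n x)) / ereal (real n))" for n
    using ereal_integral_cmult[OF p, of M "\<lambda>x. eln (\<phi> n x)"]
    by (simp add: scale_potential_def eln_epowr[OF p] ereal_times_divide_eq)
  moreover have "(\<lambda>n. ereal p * (ereal_integral M (\<lambda>x. eln (\<phi> n x)) / ereal (real n)))
      \<longlonglongrightarrow> ereal p * potential_mean \<phi> M"
    by (intro tendsto_cmult_ereal potential_mean_tendsto[OF X \<phi>]) simp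
  ultimately show ?thesis
    unfolding potential_mean_def[of "scale_potential p \<phi>"] by (simp add: limI)
qed

end

section \<open>Sums over words and the fibrewise potential\<close>

definition seq_map :: "('a \<Rightarrow> 'd) \<Rightarrow> (nat \<Rightarrow> 'a) \<Rightarrow> (nat \<Rightarrow> 'd)" where
  "seq_map p x = (\<lambda>i. p (x i))"

lemma pre_seq_map: "pre n (seq_map p x) = map p (pre n x)"
  by (simp add: pre_def seq_map_def)

lemma seq_map_shift: "seq_map p (left_shift x) = left_shift (seq_map p x)"
  by (simp add: seq_map_def left_shift_def)

lemma seq_map_shift_pow: "seq_map p ((left_shift ^^ n) x) = (left_shift ^^ n) (seq_map p x)"
  by (rule ext) (simp add: seq_map_def shift_pow_apply)

text \<open>The set \<open>D\<close> is a parameter because three choices are needed: a fibre gives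
  the fibre potential, a neighbourhood of it gives a majorant depending on finitely many
  coordinates, and \<open>UNIV\<close> gives the partition function. Words that do not occur in
  \<open>D\<close> contribute 0, the supremum of the empty set.\<close>

definition word_sum :: "(nat \<Rightarrow> 'a::finite) set \<Rightarrow> 'a potential \<Rightarrow> nat \<Rightarrow> (nat \<Rightarrow> 'a) set \<Rightarrow> ennreal" where
  "word_sum X \<phi> n D = (\<Sum>I\<in>{I. length I = n}. SUP x\<in>X \<inter> ({x. pre n x = I} \<inter> D). \<phi> n x)"

definition fiber_sum :: "(nat \<Rightarrow> 'a::finite) set \<Rightarrow> ('a \<Rightarrow> 'd) \<Rightarrow> 'a potential \<Rightarrow> 'd potential" where
  "fiber_sum X p \<phi> n y = word_sum X \<phi> n {x. seq_map p x = y}"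

lemma word_sum_mono: "D \<subseteq> E \<Longrightarrow> word_sum X \<phi> n D \<le> word_sum X \<phi> n E"
  unfolding word_sum_def by (intro sum_mono SUP_subset_mono) auto

lemma word_sum_less_top:
  fixes X :: "(nat \<Rightarrow> 'a::finite) set"
  assumes "\<And>x. x \<in> X \<Longrightarrow> \<phi> n x \<le> ennreal B"
  shows "word_sum X \<phi> n D < \<top>"
proof -
  have "(SUP x\<in>X \<inter> ({x. pre n x = I} \<inter> D). \<phi> n x) < \<top>" for I
    by (rule le_less_trans[of _ "ennreal B"]) (use assms in \<open>auto intro!: SUP_least\<close>)
  then show ?thesis unfolding word_sum_def by (simp add: finite_words)
qed

lemma le_word_sum:
  fixes X :: "(nat \<Rightarrow> 'a::finite) set"
  assumes "x \<in> X" "x \<in> D" shows "\<phi> n x \<le> word_sum X \<phi> n D"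
proof -
  have "\<phi> n x \<le> (SUP x\<in>X \<inter> ({z. pre n z = pre n x} \<inter> D). \<phi> n x)"
    using assms by (intro SUP_upper) auto
  also have "\<dots> \<le> word_sum X \<phi> n D"
    unfolding word_sum_def using finite_words
    by (intro member_le_sum[where f="\<lambda>I. SUP x\<in>X \<inter> ({x. pre n x = I} \<inter> D). \<phi> n x"]) auto
  finally show ?thesis .
qed

lemma word_sum_tendsto:
  fixes X :: "(nat \<Rightarrow> 'a::{finite, discrete_topology}) set"
  assumes "compact X" "upper_semicontinuous_on X (\<phi> n)" "\<And>N. closed (D N)" "decseq D"
  shows "(\<lambda>N. word_sum X \<phi> n (D N)) \<longlonglongrightarrow> word_sum X \<phi> n (\<Inter>N. D N)"
  unfolding word_sum_def
proof (intro tendsto_sum)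
  fix I :: "'a list"
  let ?D = "\<lambda>N. {x. pre n x = I} \<inter> D N"
  have dec: "decseq ?D" using assms(4) unfolding decseq_def by blast
  have "(SUP x\<in>X \<inter> ({x. pre n x = I} \<inter> (\<Inter>N. D N)). \<phi> n x) = (SUP x\<in>X \<inter> (\<Inter>N. ?D N). \<phi> n x)"
    by (intro arg_cong[where f="\<lambda>A. Sup (\<phi> n ` A)"]) auto
  also have "\<dots> = (INF N. SUP x\<in>X \<inter> ?D N. \<phi> n x)"
    by (rule usc_INF_SUP[symmetric, OF assms(1,2) _ dec]) (intro closed_Int closed_pre assms)
  finally show "(\<lambda>N. SUP x\<in>X \<inter> ?D N. \<phi> n x) \<longlonglongrightarrow> (SUP x\<in>X \<inter> ({x. pre n x = I} \<inter> (\<Inter>N. D N)). \<phi> n x)"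
    using LIMSEQ_INF[OF decseq_SUP[OF dec, where X=X and f="\<phi> n"]] by simp
qed

text \<open>Closed sets that decrease to the fibre and depend on \<open>y\<close> only through a
  prefix, so that the word sums over them are locally constant in \<open>y\<close>.\<close>

definition fiber_nbhd :: "('a \<Rightarrow> 'd) \<Rightarrow> (nat \<Rightarrow> 'd) \<Rightarrow> nat \<Rightarrow> (nat \<Rightarrow> 'a) set" where
  "fiber_nbhd p y N = {x. map p (pre N x) = pre N y}"

lemma fiber_nbhd:
  fixes p :: "'a::{finite, discrete_topology} \<Rightarrow> 'd"
  shows closed_fiber_nbhd: "closed (fiber_nbhd p y N)" and decseq_fiber_nbhd: "decseq (fiber_nbhd p y)"
    and INT_fiber_nbhd: "(\<Inter>N. fiber_nbhd p y N) = {x. seq_map p x = y}"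
proof -
  show "closed (fiber_nbhd p y N)" unfolding fiber_nbhd_def by (rule closed_pre)
  show "decseq (fiber_nbhd p y)"
    unfolding decseq_def fiber_nbhd_def pre_seq_map[symmetric] using pre_eq_mono by blast
  show "(\<Inter>N. fiber_nbhd p y N) = {x. seq_map p x = y}"
  proof (intro equalityI subsetI)
    fix x assume "x \<in> (\<Inter>N. fiber_nbhd p y N)"
    then have "pre (Suc i) (seq_map p x) = pre (Suc i) y" for i
      by (simp add: fiber_nbhd_def pre_seq_map)
    then have "seq_map p x i = y i" for i unfolding pre_eq_iff by (metis lessI)
    then show "x \<in> {x. seq_map p x = y}" by auto
  qed (auto simp: fiber_nbhd_def pre_seq_map[symmetric])
qed

lemma fiber_nbhd_cong: "pre N y = pre N z \<Longrightarrow> fiber_nbhd p y N = fiber_nbhd p z N"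
  by (simp add: fiber_nbhd_def)

lemma fiber_sum_tendsto:
  fixes X :: "(nat \<Rightarrow> 'a::{finite, discrete_topology}) set"
  assumes "compact X" "upper_semicontinuous_on X (\<phi> n)"
  shows "(\<lambda>N. word_sum X \<phi> n (fiber_nbhd p y N)) \<longlonglongrightarrow> fiber_sum X p \<phi> n y"
  using word_sum_tendsto[where D="fiber_nbhd p y" and \<phi>=\<phi> and n=n and X=X, OF assms closed_fiber_nbhd decseq_fiber_nbhd]
  by (simp add: fiber_sum_def INT_fiber_nbhd)

lemma fiber_sum_le: "fiber_sum X p \<phi> n y \<le> word_sum X \<phi> n (fiber_nbhd p y N)"
  for p :: "'a::{finite, discrete_topology} \<Rightarrow> 'd"
  unfolding fiber_sum_def INT_fiber_nbhd[symmetric] by (intro word_sum_mono) auto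

text \<open>The fibre sum is the decreasing limit of the word sums over \<open>fiber_nbhd\<close>,
  each depending on finitely many coordinates. Its superlevel sets are therefore intersections of
  clopen sets.\<close>

lemma fiber_sum_usc:
  fixes X :: "(nat \<Rightarrow> 'a::{finite, discrete_topology}) set" and p :: "'a \<Rightarrow> 'd::{finite, discrete_topology}"
  assumes "compact X" "upper_semicontinuous_on X (\<phi> n)"
  shows "upper_semicontinuous_on Y (fiber_sum X p \<phi> n)"
  unfolding upper_semicontinuous_on_def
proof
  fix t
  define W where "W N = {y. t \<le> word_sum X \<phi> n (fiber_nbhd p y N)}" for N
  have "cyl_set N (W N)" for N
  proof (rule cyl_setI)
    fix x y assume xy: "pre N x = pre N y" "x \<in> W N"
    have "fiber_nbhd p x N = fiber_nbhd p y N" by (rule fiber_nbhd_cong[OF xy(1)])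
    with xy(2) show "y \<in> W N" by (simp add: W_def)
  qed
  then have "closed (\<Inter>N. W N)" by (intro closed_INT ballI closed_cyl_set)
  moreover have "{y \<in> Y. t \<le> fiber_sum X p \<phi> n y} = Y \<inter> (\<Inter>N. W N)"
  proof (intro equalityI subsetI)
    fix y assume "y \<in> Y \<inter> (\<Inter>N. W N)"
    moreover from this have "t \<le> fiber_sum X p \<phi> n y"
      by (intro LIMSEQ_le_const[OF fiber_sum_tendsto[where \<phi>=\<phi> and n=n, OF assms]]) (auto simp: W_def)
    ultimately show "y \<in> {y \<in> Y. t \<le> fiber_sum X p \<phi> n y}" by simp
  next
    fix y assume "y \<in> {y \<in> Y. t \<le> fiber_sum X p \<phi> n y}"
    then show "y \<in> Y \<inter> (\<Inter>N. W N)" by (auto simp: W_def intro: order_trans[OF _ fiber_sum_le[of X p \<phi> n y]])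
  qed
  ultimately show "closedin (top_of_set Y) {y \<in> Y. t \<le> fiber_sum X p \<phi> n y}"
    by (simp add: closedin_closed_Int)
qed

text \<open>A word of length \<open>n + m\<close> splits uniquely into two pieces. Forgetting that
  the pieces must fit together in one point of \<open>X\<close> leaves a product of two word
  sums.\<close>

lemma fiber_sum_submultiplicative:
  fixes X :: "(nat \<Rightarrow> 'a::finite) set"
  assumes shift: "left_shift ` X \<subseteq> X"
    and sub: "\<And>x. x \<in> X \<Longrightarrow> \<phi> (n + m) x \<le> ennreal c * \<phi> n x * \<phi> m ((left_shift ^^ n) x)"
  shows "fiber_sum X p \<phi> (n + m) y \<le> ennreal c * fiber_sum X p \<phi> n y * fiber_sum X p \<phi> m ((left_shift ^^ n) y)"
proof -
  let ?D = "\<lambda>y. {x. seq_map p x = y}"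
  let ?y = "(left_shift ^^ n) y"
  define f where "f I = (SUP x\<in>X \<inter> ({x. pre n x = I} \<inter> ?D y). \<phi> n x)" for I
  define g where "g I = (SUP x\<in>X \<inter> ({x. pre m x = I} \<inter> ?D ?y). \<phi> m x)" for I
  have SX: "(left_shift ^^ n) x \<in> X" if "x \<in> X" for x using that shift by (induction n) auto
  have pre_add: "pre (n + m) x = pre n x @ pre m ((left_shift ^^ n) x)" for x :: "nat \<Rightarrow> 'a"
    by (intro nth_equalityI) (auto simp: nth_append shift_pow_apply)
  have "fiber_sum X p \<phi> (n + m) y \<le> (\<Sum>I\<in>{I :: 'a list. length I = n + m}. ennreal c * f (take n I) * g (drop n I))"
    unfolding fiber_sum_def word_sum_def
  proof (intro sum_mono SUP_least)
    fix I :: "'a list" and x assume I: "I \<in> {I. length I = n + m}"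
      and x: "x \<in> X \<inter> ({x. pre (n + m) x = I} \<inter> ?D y)"
    have "\<phi> (n + m) x \<le> ennreal c * \<phi> n x * \<phi> m ((left_shift ^^ n) x)" using sub x by auto
    also have "\<dots> \<le> ennreal c * f (take n I) * g (drop n I)"
    proof (intro mult_mono)
      have "pre n x = take n I" "pre m ((left_shift ^^ n) x) = drop n I" using x by (auto simp: pre_add)
      then show "\<phi> n x \<le> f (take n I)" "\<phi> m ((left_shift ^^ n) x) \<le> g (drop n I)"
        unfolding f_def g_def using x SX by (auto simp: seq_map_shift_pow intro!: SUP_upper)
    qed auto
    finally show "\<phi> (n + m) x \<le> ennreal c * f (take n I) * g (drop n I)" .
  qed
  also have "\<dots> = (\<Sum>(K, L)\<in>{K. length K = n} \<times> {L. length L = m}. ennreal c * f K * g L)"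
    by (rule sum.reindex_bij_witness[of _ "\<lambda>(K, L). K @ L" "\<lambda>I. (take n I, drop n I)"]) auto
  also have "\<dots> = ennreal c * (\<Sum>(K, L)\<in>{K. length K = n} \<times> {L. length L = m}. f K * g L)"
    by (simp add: sum_distrib_left split_beta mult.assoc)
  also have "(\<Sum>(K, L)\<in>{K. length K = n} \<times> {L. length L = m}. f K * g L) =
      (\<Sum>K\<in>{K. length K = n}. f K) * (\<Sum>L\<in>{L. length L = m}. g L)"
    by (simp only: sum_product sum.cartesian_product)
  finally show ?thesis by (simp only: fiber_sum_def word_sum_def f_def g_def mult.assoc)
qed

lemma fiber_sum_usc_subadditive:
  fixes X :: "(nat \<Rightarrow> 'a::{finite, discrete_topology}) set" and p :: "'a \<Rightarrow> 'd::{finite, discrete_topology}"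
  assumes X: "subshift X" and \<phi>: "usc_subadditive_potential X \<phi>"
  shows "usc_subadditive_potential Y (fiber_sum X p \<phi>)"
  unfolding usc_subadditive_potential_def submultiplicative_up_to_const_def
proof (intro conjI allI impI ballI)
  have comp: "compact X" and shift: "left_shift ` X \<subseteq> X" using X by (auto simp: subshift_def)
  fix n :: nat assume n: "1 \<le> n"
  show "upper_semicontinuous_on Y (fiber_sum X p \<phi> n)"
    using \<phi> n by (intro fiber_sum_usc[OF comp]) (auto simp: usc_subadditive_potential_def)
  show "fiber_sum X p \<phi> n y < \<top>" for y
    using usc_potential_bounded[OF comp \<phi> n] unfolding fiber_sum_def by (auto intro: word_sum_less_top)
next
  have shift: "left_shift ` X \<subseteq> X" using X by (auto simp: subshift_def)
  obtain c where c: "0 < c" "\<forall>n\<ge>1. \<forall>m\<ge>1. \<forall>x\<in>X. \<phi> (n + m) x \<le> ennreal c * \<phi> n x * \<phi> m ((left_shift ^^ n) x)"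
    using \<phi> unfolding usc_subadditive_potential_def submultiplicative_up_to_const_def by blast
  show "\<exists>c>0. \<forall>n\<ge>1. \<forall>m\<ge>1. \<forall>y\<in>Y. fiber_sum X p \<phi> (n + m) y \<le>
      ennreal c * fiber_sum X p \<phi> n y * fiber_sum X p \<phi> m ((left_shift ^^ n) y)"
  proof (intro exI[of _ c] conjI allI impI ballI c(1))
    fix n m :: nat and y assume "1 \<le> n" "1 \<le> m"
    with c(2) show "fiber_sum X p \<phi> (n + m) y \<le>
        ennreal c * fiber_sum X p \<phi> n y * fiber_sum X p \<phi> m ((left_shift ^^ n) y)"
      by (intro fiber_sum_submultiplicative[OF shift]) simp
  qed
qed

lemma fiber_sum_le_mult:
  fixes X :: "(nat \<Rightarrow> 'a::finite) set"
  assumes "\<And>x. x \<in> X \<Longrightarrow> \<phi> n x \<le> ennreal c * \<theta> n x"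
  shows "fiber_sum X p \<phi> n y \<le> ennreal c * fiber_sum X p \<theta> n y"
  unfolding fiber_sum_def word_sum_def sum_distrib_left
proof (intro sum_mono SUP_least)
  fix I x assume x: "x \<in> X \<inter> ({x. pre n x = I} \<inter> {x. seq_map p x = y})"
  then have "\<phi> n x \<le> ennreal c * \<theta> n x" using assms by auto
  also have "\<dots> \<le> ennreal c * (SUP x\<in>X \<inter> ({x. pre n x = I} \<inter> {x. seq_map p x = y}). \<theta> n x)"
    using x by (intro mult_left_mono SUP_upper) auto
  finally show "\<phi> n x \<le> ennreal c * (SUP x\<in>X \<inter> ({x. pre n x = I} \<inter> {x. seq_map p x = y}). \<theta> n x)" .
qed

lemma near_fiber_sum:
  fixes X :: "(nat \<Rightarrow> 'a::finite) set"
  assumes "near \<delta> X \<phi> \<theta>" shows "near \<delta> Y (fiber_sum X p \<phi>) (fiber_sum X p \<theta>)"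
  using assms unfolding near_def by (auto elim!: eventually_mono intro!: fiber_sum_le_mult)

lemma fiber_sum_usc_asymptotically_subadditive:
  fixes X :: "(nat \<Rightarrow> 'a::{finite, discrete_topology}) set" and p :: "'a \<Rightarrow> 'd::{finite, discrete_topology}"
  assumes X: "subshift X" and \<phi>: "usc_asymptotically_subadditive X \<phi>"
  shows "usc_asymptotically_subadditive Y (fiber_sum X p \<phi>)"
  unfolding usc_asymptotically_subadditive_iff
proof (intro allI impI)
  fix \<epsilon> :: real assume "0 < \<epsilon>"
  with \<phi> obtain \<theta> where "usc_subadditive_potential X \<theta>" "near \<epsilon> X \<phi> \<theta>"
    by (auto simp: usc_asymptotically_subadditive_iff)
  then show "\<exists>\<theta>. usc_subadditive_potential Y \<theta> \<and> near \<epsilon> Y (fiber_sum X p \<phi>) \<theta>"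
    using fiber_sum_usc_subadditive[OF X] near_fiber_sum by blast
qed

section \<open>Powers of potentials\<close>

lemma epowr_mono: "0 < p \<Longrightarrow> u \<le> v \<Longrightarrow> epowr u p \<le> epowr v p"
  by (auto simp: epowr_def top_unique less_top intro!: ennreal_leI powr_mono2 enn2real_mono)

lemma epowr_less_top: "epowr u p < \<top> \<longleftrightarrow> u < \<top>"
  by (simp add: epowr_def less_top)

lemma epowr_mult:
  assumes "0 < p" "0 < c" "u < \<top>" "v < \<top>"
  shows "epowr (ennreal c * u * v) p = ennreal (c powr p) * epowr u p * epowr v p"
proof -
  have "ennreal c * u * v \<noteq> \<top>" using assms by (simp add: ennreal_mult_eq_top_iff less_top)
  moreover have "enn2real (ennreal c * u * v) powr p = c powr p * enn2real u powr p * enn2real v powr p"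
    using assms by (simp add: enn2real_mult powr_mult)
  moreover have "u \<noteq> \<top>" "v \<noteq> \<top>" using assms by auto
  ultimately show ?thesis by (simp add: epowr_def ennreal_mult')
qed

lemma epowr_one: "epowr 1 p = 1" by (simp add: epowr_def)

lemma epowr_epowr: "0 < p \<Longrightarrow> epowr (epowr u p) q = epowr u (p * q)"
  by (auto simp: epowr_def powr_powr)

lemma epowr_id: "epowr u 1 = u"
  by (auto simp: epowr_def less_top)

text \<open>Superlevel sets of a power are superlevel sets of the function itself, which transfers
  upper semicontinuity.\<close>

lemma le_epowr_iff:
  assumes "0 < p" shows "t \<le> epowr u p \<longleftrightarrow> epowr t (1 / p) \<le> u"
proof
  assume "t \<le> epowr u p"
  then have "epowr t (1 / p) \<le> epowr (epowr u p) (1 / p)" using assms by (intro epowr_mono) auto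
  then show "epowr t (1 / p) \<le> u" using assms by (simp add: epowr_epowr epowr_id)
next
  assume "epowr t (1 / p) \<le> u"
  then have "epowr (epowr t (1 / p)) p \<le> epowr u p" using assms by (intro epowr_mono) auto
  then show "t \<le> epowr u p" using assms by (simp add: epowr_epowr epowr_id)
qed

lemma scale_usc_subadditive:
  assumes p: "0 < p" and \<phi>: "usc_subadditive_potential X \<phi>" and shift: "left_shift ` X \<subseteq> X"
  shows "usc_subadditive_potential X (scale_potential p \<phi>)"
  unfolding usc_subadditive_potential_def submultiplicative_up_to_const_def
proof (intro conjI allI impI ballI)
  fix n :: nat assume n: "1 \<le> n"
  show "upper_semicontinuous_on X (scale_potential p \<phi> n)"
    using \<phi> n unfolding usc_subadditive_potential_def upper_semicontinuous_on_def scale_potential_def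
    by (simp add: le_epowr_iff[OF p])
  show "scale_potential p \<phi> n x < \<top>" if "x \<in> X" for x
    using \<phi> n that by (simp add: usc_subadditive_potential_def scale_potential_def epowr_less_top)
next
  obtain c where c: "0 < c" "\<forall>n\<ge>1. \<forall>m\<ge>1. \<forall>x\<in>X. \<phi> (n + m) x \<le> ennreal c * \<phi> n x * \<phi> m ((left_shift ^^ n) x)"
    using \<phi> unfolding usc_subadditive_potential_def submultiplicative_up_to_const_def by blast
  show "\<exists>c>0. \<forall>n\<ge>1. \<forall>m\<ge>1. \<forall>x\<in>X. scale_potential p \<phi> (n + m) x \<le>
      ennreal c * scale_potential p \<phi> n x * scale_potential p \<phi> m ((left_shift ^^ n) x)"
  proof (intro exI[of _ "c powr p"] conjI allI impI ballI)
    show "0 < c powr p" using c by simp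
    fix n m :: nat and x assume nm: "1 \<le> n" "1 \<le> m" and x: "x \<in> X"
    have "(left_shift ^^ n) x \<in> X" using x shift by (induction n) auto
    then have fin: "\<phi> n x < \<top>" "\<phi> m ((left_shift ^^ n) x) < \<top>"
      using \<phi> nm x by (auto simp: usc_subadditive_potential_def)
    have "epowr (\<phi> (n + m) x) p \<le> epowr (ennreal c * \<phi> n x * \<phi> m ((left_shift ^^ n) x)) p"
      using c nm x p by (intro epowr_mono) auto
    then show "scale_potential p \<phi> (n + m) x \<le>
        ennreal (c powr p) * scale_potential p \<phi> n x * scale_potential p \<phi> m ((left_shift ^^ n) x)"
      by (simp add: scale_potential_def epowr_mult[OF p c(1) fin])
  qed
qed

lemma near_scale:
  assumes p: "0 < p" and near: "near \<delta> X \<phi> \<theta>" and \<theta>: "\<And>n x. 1 \<le> n \<Longrightarrow> x \<in> X \<Longrightarrow> \<theta> n x < \<top>"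
  shows "near (p * \<delta>) X (scale_potential p \<phi>) (scale_potential p \<theta>)"
  using near[unfolded near_def] eventually_ge_at_top[of 1] unfolding near_def
proof eventually_elim
  case (elim n)
  show ?case
  proof
    fix x assume x: "x \<in> X"
    have e: "exp (real n * \<delta>) powr p = exp (real n * (p * \<delta>))" by (simp add: powr_def)
    have le: "epowr u p \<le> ennreal (exp (real n * (p * \<delta>))) * epowr v p"
      if "u \<le> ennreal (exp (real n * \<delta>)) * v" "v < \<top>" for u v
      using epowr_mono[OF p that(1)] epowr_mult[OF p exp_gt_zero, of v 1 "real n * \<delta>"] that(2)
      by (simp add: e epowr_one)
    have u: "\<phi> n x \<le> ennreal (exp (real n * \<delta>)) * \<theta> n x" "\<theta> n x \<le> ennreal (exp (real n * \<delta>)) * \<phi> n x"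
      using elim(1) x by auto
    have "\<theta> n x < \<top>" using \<theta> elim(2) x by auto
    moreover from this have "\<phi> n x < \<top>"
      by (intro le_less_trans[OF u(1)]) (simp add: ennreal_mult_less_top)
    ultimately show "scale_potential p \<phi> n x \<le> ennreal (exp (real n * (p * \<delta>))) * scale_potential p \<theta> n x \<and>
        scale_potential p \<theta> n x \<le> ennreal (exp (real n * (p * \<delta>))) * scale_potential p \<phi> n x"
      unfolding scale_potential_def using u by (intro conjI le) auto
  qed
qed

lemma scale_usc_asymptotically_subadditive:
  assumes p: "0 < p" and \<phi>: "usc_asymptotically_subadditive X \<phi>" and shift: "left_shift ` X \<subseteq> X"
  shows "usc_asymptotically_subadditive X (scale_potential p \<phi>)"
  unfolding usc_asymptotically_subadditive_iff
proof (intro allI impI)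
  fix \<epsilon> :: real assume "0 < \<epsilon>"
  then have "0 < \<epsilon> / p" using p by simp
  with \<phi> obtain \<theta> where \<theta>: "usc_subadditive_potential X \<theta>" "near (\<epsilon> / p) X \<phi> \<theta>"
    by (auto simp: usc_asymptotically_subadditive_iff)
  have "near (p * (\<epsilon> / p)) X (scale_potential p \<phi>) (scale_potential p \<theta>)"
    using \<theta> by (intro near_scale[OF p]) (auto simp: usc_subadditive_potential_def)
  then show "\<exists>\<theta>. usc_subadditive_potential X \<theta> \<and> near \<epsilon> X (scale_potential p \<phi>) \<theta>"
    using scale_usc_subadditive[OF p \<theta>(1) shift] p by auto
qed

lemma fiber_potential_eq:
  assumes "\<And>x. x \<in> X \<Longrightarrow> \<pi> x = seq_map p x"
  shows "fiber_potential X \<pi> a \<phi> = fiber_sum X p (scale_potential (1 / a) \<phi>)"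
proof (intro ext)
  fix n :: nat and y
  have "cylinder I \<inter> fiber X \<pi> y = X \<inter> ({x. pre n x = I} \<inter> {x. seq_map p x = y})" if "length I = n" for I
    using assms that by (auto simp: in_cylinder_iff fiber_def)
  then have "fiber_potential X \<pi> a \<phi> n y =
      (\<Sum>I\<in>{I. length I = n \<and> X \<inter> ({x. pre n x = I} \<inter> {x. seq_map p x = y}) \<noteq> {}}.
        SUP x\<in>X \<inter> ({x. pre n x = I} \<inter> {x. seq_map p x = y}). epowr (\<phi> n x) (1 / a))"
    unfolding fiber_potential_def by (intro sum.cong) auto
  also have "\<dots> = fiber_sum X p (scale_potential (1 / a) \<phi>) n y"
    unfolding fiber_sum_def word_sum_def scale_potential_def
    using finite_words by (intro sum.mono_neutral_left) (auto simp: bot_ennreal)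
  finally show "fiber_potential X \<pi> a \<phi> n y = fiber_sum X p (scale_potential (1 / a) \<phi>) n y" .
qed

section \<open>The upper bound of the relative variational principle\<close>

lemma (in prob_space) integral_simple_comp:
  fixes v :: "'b \<Rightarrow> real"
  assumes f: "simple_function M f" and B: "finite B" "f ` space M \<subseteq> B"
  shows "(\<integral>x. v (f x) \<partial>M) = (\<Sum>b\<in>B. v b * prob {x\<in>space M. f x = b})"
    and "integrable M (\<lambda>x. v (f x))"
proof -
  note lev = simple_function_level_set[OF f]
  have eq: "v (f x) = (\<Sum>b\<in>B. v b * indicator {x\<in>space M. f x = b} x)" if "x \<in> space M" for x
  proof -
    have "(\<Sum>b\<in>B. v b * indicator {x\<in>space M. f x = b} x) = (\<Sum>b\<in>B. if b = f x then v b else 0)"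
      using that by (intro sum.cong) (auto simp: indicator_def)
    also have "\<dots> = v (f x)" using B that by (simp add: sum.delta image_subset_iff)
    finally show ?thesis by simp
  qed
  have int: "integrable M (\<lambda>x. v b * indicator {x\<in>space M. f x = b} x)" for b
    using lev by (intro integrable_mult_right integrable_real_indicator) (auto simp: emeasure_eq_measure)
  have "(\<integral>x. v (f x) \<partial>M) = (\<integral>x. (\<Sum>b\<in>B. v b * indicator {x\<in>space M. f x = b} x) \<partial>M)"
    by (intro Bochner_Integration.integral_cong refl eq)
  also have "\<dots> = (\<Sum>b\<in>B. v b * prob {x\<in>space M. f x = b})"
    using int lev by (subst Bochner_Integration.integral_sum) auto
  finally show "(\<integral>x. v (f x) \<partial>M) = (\<Sum>b\<in>B. v b * prob {x\<in>space M. f x = b})" .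
  have "integrable M (\<lambda>x. \<Sum>b\<in>B. v b * indicator {x\<in>space M. f x = b} x)"
    by (intro Bochner_Integration.integrable_sum int)
  then show "integrable M (\<lambda>x. v (f x))"
    by (rule Bochner_Integration.integrable_cong[THEN iffD1, rotated -1]) (simp_all add: eq)
qed

text \<open>\<open>gibbs\<close> on each level set of \<open>g\<close>, applied to the joint law.
  The leftover \<open>eta\<close> of the marginals adds up to the entropy of \<open>g\<close>, which
  \<open>cond_ent\<close> subtracts.\<close>

lemma (in prob_space) cond_ent_gibbs:
  assumes f: "simple_function M f" and g: "simple_function M g"
    and A: "finite A" "f ` space M \<subseteq> A" and B: "finite B" "g ` space M \<subseteq> B"
    and W: "\<And>a b. 0 < W a b"
  shows "(\<integral>x. ln (W (f x) (g x)) \<partial>M) + cond_ent M f g \<le>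
    (\<Sum>b\<in>B. prob {x\<in>space M. g x = b} * ln (\<Sum>a\<in>A. W a b))"
proof -
  define r where "r a b = prob {x\<in>space M. f x = a \<and> g x = b}" for a b
  have fg: "simple_function M (\<lambda>x. (f x, g x))" using f g by simp
  have AB: "finite (A \<times> B)" "(\<lambda>x. (f x, g x)) ` space M \<subseteq> A \<times> B" using A B by auto
  have marg: "(\<Sum>a\<in>A. r a b) = prob {x\<in>space M. g x = b}" for b
    unfolding r_def by (rule sum_marginal[OF f g A])
  have "(\<integral>x. ln (W (f x) (g x)) \<partial>M) = (\<Sum>(a, b)\<in>A \<times> B. ln (W a b) * r a b)"
    using integral_simple_comp(1)[OF fg AB, of "\<lambda>(a, b). ln (W a b)"]
    by (simp add: r_def split_beta prod_eq_iff)
  then have 1: "(\<integral>x. ln (W (f x) (g x)) \<partial>M) = (\<Sum>b\<in>B. \<Sum>a\<in>A. r a b * ln (W a b))"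
    by (subst sum.swap) (simp add: sum.cartesian_product mult.commute)
  have "ent M (\<lambda>x. (f x, g x)) = (\<Sum>(a, b)\<in>A \<times> B. eta (r a b))"
    unfolding ent_superset[OF AB] by (simp add: r_def split_beta prod_eq_iff)
  then have 2: "ent M (\<lambda>x. (f x, g x)) = (\<Sum>b\<in>B. \<Sum>a\<in>A. eta (r a b))"
    by (subst sum.swap) (simp add: sum.cartesian_product)
  have 3: "ent M g = (\<Sum>b\<in>B. eta (\<Sum>a\<in>A. r a b))"
    unfolding ent_superset[OF B] by (simp add: marg)
  have "(\<Sum>b\<in>B. \<Sum>a\<in>A. r a b * ln (W a b) + eta (r a b)) \<le>
      (\<Sum>b\<in>B. (\<Sum>a\<in>A. r a b) * ln (\<Sum>a\<in>A. W a b) + eta (\<Sum>a\<in>A. r a b))"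
    using A W by (intro sum_mono gibbs) (auto simp: r_def)
  then show ?thesis unfolding cond_ent_def 1 2 3 by (simp add: sum.distrib marg)
qed

lemma continuous_on_seq_map:
  fixes p :: "'a::{finite, discrete_topology} \<Rightarrow> 'd::{finite, discrete_topology}"
  shows "continuous_on S (seq_map p)"
proof (rule continuous_on_coordinatewise_then_product)
  fix i
  have "continuous_on UNIV p" using continuous_on_open_vimage[OF open_UNIV, of p]
    by (simp add: discrete_topology_class.open_discrete)
  then show "continuous_on S (\<lambda>x. seq_map p x i)" unfolding seq_map_def
    by (rule continuous_on_compose2) (auto intro: continuous_on_subset[OF continuous_on_product_coordinates])
qed

lemma trunc_ln_tendsto:
  assumes "(u \<longlongrightarrow> l) F" "l < \<top>"
  shows "((\<lambda>x. trunc_ln s (u x)) \<longlongrightarrow> trunc_ln s l) F"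
proof -
  have "((\<lambda>x. enn2real (u x)) \<longlongrightarrow> enn2real l) F"
    using assms by (intro tendsto_enn2real) auto
  then show ?thesis unfolding trunc_ln_def
    using max_exp_pos[of "enn2real l" "- s"] by (intro tendsto_ln tendsto_max tendsto_const) auto
qed

context seq_invariant
begin

definition push :: "('a \<Rightarrow> 'd::{finite, discrete_topology}) \<Rightarrow> (nat \<Rightarrow> 'd) measure" where
  "push p = distr M (restrict_space borel (seq_map p ` X)) (seq_map p)"

lemma measurable_seq_map:
  fixes p :: "'a \<Rightarrow> 'd::{finite, discrete_topology}"
  shows "seq_map p \<in> M \<rightarrow>\<^sub>M restrict_space borel (seq_map p ` X)"
  using measurable_continuous_on[OF continuous_on_seq_map]
  by (intro measurable_restrict_space2) (auto simp: space_M)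

lemma space_push: "space (push p) = seq_map p ` X"
  for p :: "'a \<Rightarrow> 'd::{finite, discrete_topology}"
  by (simp add: push_def space_restrict_space)

lemma measurable_seq_map_push: "seq_map p \<in> M \<rightarrow>\<^sub>M push p"
  for p :: "'a \<Rightarrow> 'd::{finite, discrete_topology}"
  using measurable_seq_map by (simp add: push_def)

lemma seq_invariant_push:
  fixes p :: "'a \<Rightarrow> 'd::{finite, discrete_topology}"
  shows "seq_invariant (seq_map p ` X) (push p)"
proof -
  interpret N: prob_space "push p"
    unfolding push_def by (rule prob_space_distr[OF measurable_seq_map])
  interpret N: seq_prob "seq_map p ` X" "push p"
    by unfold_locales (simp add: push_def)
  have shift: "left_shift ` seq_map p ` X \<subseteq> seq_map p ` X"
    using shift_X by (auto simp: seq_map_shift[symmetric])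
  have T1: "left_shift \<in> M \<rightarrow>\<^sub>M M" using measurable_shift_pow[of 1] by simp
  have T2: "left_shift \<in> push p \<rightarrow>\<^sub>M push p"
  proof -
    have "left_shift \<in> restrict_space borel (seq_map p ` X) \<rightarrow>\<^sub>M restrict_space borel (seq_map p ` X)"
      using shift by (intro measurable_restrict_space2 borel_measurable_continuous_on_restrict continuous_on_left_shift)
        (auto simp: space_restrict_space)
    then show ?thesis using measurable_cong_sets[OF N.sets_M N.sets_M] by simp
  qed
  have "distr (push p) (push p) left_shift = distr M (push p) (left_shift \<circ> seq_map p)"
    unfolding push_def[of p, THEN arg_cong[where f="\<lambda>N. distr N (push p) left_shift"]]
    using T2 measurable_seq_map by (intro distr_distr) (simp_all add: push_def)
  also have "left_shift \<circ> seq_map p = seq_map p \<circ> left_shift" by (simp add: fun_eq_iff seq_map_shift)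
  also have "distr M (push p) (seq_map p \<circ> left_shift) = distr (distr M M left_shift) (push p) (seq_map p)"
    using measurable_seq_map_push T1 by (subst distr_distr) auto
  also have "\<dots> = push p" unfolding distr_shift by (simp add: push_def cong: distr_cong)
  finally have "distr (push p) (push p) left_shift = push p" .
  with shift show ?thesis by unfold_locales
qed

lemma ent_push: "simple_function (push p) g \<Longrightarrow> ent (push p) g = ent M (\<lambda>x. g (seq_map p x))"
  for p :: "'a \<Rightarrow> 'd::{finite, discrete_topology}"
  using ent_distr[OF measurable_seq_map_push, of p g] by (simp add: push_def cong: distr_cong)

lemma measure_push_pre: "measure (push p) {y\<in>space (push p). pre L y = J} = prob {x\<in>space M. map p (pre L x) = J}"
  for p :: "'a \<Rightarrow> 'd::{finite, discrete_topology}"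
proof -
  interpret N: seq_invariant "seq_map p ` X" "push p" by (rule seq_invariant_push)
  have "{y\<in>space (push p). pre L y = J} \<in> sets (push p)"
    by (rule simple_function_level_set[OF N.simple_function_pre'])
  then have "measure (push p) {y\<in>space (push p). pre L y = J} =
      prob (seq_map p -` {y\<in>space (push p). pre L y = J} \<inter> space M)"
    unfolding push_def by (intro measure_distr measurable_seq_map) simp
  also have "seq_map p -` {y\<in>space (push p). pre L y = J} \<inter> space M = {x\<in>space M. map p (pre L x) = J}"
    by (auto simp: space_push space_M pre_seq_map)
  finally show ?thesis .
qed

text \<open>Cut a prefix of length \<open>k * n\<close> into \<open>k\<close> blocks. Given a long
  enough prefix of the image, each block costs at most its conditional entropy given the image
  window that starts with it. Division by \<open>k\<close> turns the entropy of the image prefix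
  into the entropy rate of the image.\<close>

lemma entropy_rate_le_push:
  fixes p :: "'a \<Rightarrow> 'd::{finite, discrete_topology}"
  assumes n: "1 \<le> n"
  shows "real n * entropy_rate \<le>
    real n * seq_invariant.entropy_rate (push p) + cond_ent M (pre n) (\<lambda>x. map p (pre L x))"
proof -
  interpret N: seq_invariant "seq_map p ` X" "push p" by (rule seq_invariant_push)
  let ?c = "cond_ent M (pre n) (\<lambda>x. map p (pre L x))"
  have sg: "simple_function M (\<lambda>x. map p (pre m x))" for m by (rule simple_function_pre)
  have bound: "real n * entropy_rate \<le>
      real n * (ent (push p) (pre (k * n)) / real (k * n)) + ent (push p) (pre L) / real k + ?c" if k: "1 \<le> k" for k
  proof -
    let ?F = "\<lambda>x. map (\<lambda>j. pre n ((left_shift ^^ (j * n)) x)) [0..<k]"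
    \<comment> \<open>The extra \<open>L\<close> coordinates cover windows that overrun the last
      block.\<close>
    let ?G = "\<lambda>x. map p (pre (k * n + L) x)"
    have blocks: "simple_function M ?F \<and> ent M (\<lambda>x. (?F x, ?G x)) \<le>
        ent M ?G + (\<Sum>j<k. cond_ent M (\<lambda>x. pre n ((left_shift ^^ (j * n)) x))
          (\<lambda>x. map p (pre L ((left_shift ^^ (j * n)) x))))"
    proof (rule ent_blocks_le)
      fix j assume j: "j < k"
      show "simple_function M (\<lambda>x. pre n ((left_shift ^^ (j * n)) x))"
        by (rule simple_function_shift_pow[OF simple_function_pre'])
      show "simple_function M (\<lambda>x. map p (pre L ((left_shift ^^ (j * n)) x)))"
        by (rule simple_function_shift_pow[OF sg])
      fix x y :: "nat \<Rightarrow> 'a" assume "?G x = ?G y"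
      moreover have "j * n + L \<le> k * n + L" using j by simp
      ultimately show "map p (pre L ((left_shift ^^ (j * n)) x)) = map p (pre L ((left_shift ^^ (j * n)) y))"
        unfolding pre_seq_map[symmetric] seq_map_shift_pow by (rule pre_shift_eq)
    qed (rule sg)
    have "ent M (pre (k * n)) \<le> ent M (\<lambda>x. (?F x, ?G x))"
    proof (rule ent_mono)
      show "simple_function M (\<lambda>x. (?F x, ?G x))" using blocks sg by (intro simple_function_Pair) auto
      fix x y :: "nat \<Rightarrow> 'a" assume "(?F x, ?G x) = (?F y, ?G y)"
      then have eq: "pre n ((left_shift ^^ (j * n)) x) = pre n ((left_shift ^^ (j * n)) y)" if "j < k" for j
        using that by auto
      show "pre (k * n) x = pre (k * n) y"
        unfolding pre_eq_iff
      proof (intro allI impI)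
        fix i assume "i < k * n"
        then have "i div n < k" using n by (simp add: less_mult_imp_div_less)
        from eq[OF this] have "\<forall>m<n. x (i div n * n + m) = y (i div n * n + m)"
          by (simp add: pre_eq_iff shift_pow_apply)
        from this[rule_format, of "i mod n"] show "x i = y i" using n by simp
      qed
    qed (rule simple_function_pre')
    also have "\<dots> \<le> ent M ?G + real k * ?c"
      using blocks by (simp add: cond_ent_shift_pow[OF simple_function_pre' sg])
    also have "ent M ?G = ent (push p) (pre (k * n + L))"
      by (simp add: ent_push[OF N.simple_function_pre'] pre_seq_map)
    also have "\<dots> \<le> ent (push p) (pre (k * n)) + ent (push p) (pre L)" by (rule N.ent_pre_add)
    finally have "entropy_rate * real (k * n) \<le> ent (push p) (pre (k * n)) + ent (push p) (pre L) + real k * ?c"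
      using entropy_rate_le[of "k * n"] n k by simp
    then show ?thesis using n k by (simp add: field_simps)
  qed
  have "(\<lambda>k. ent (push p) (pre (k * n)) / real (k * n)) \<longlonglongrightarrow> N.entropy_rate"
    using N.entropy_rate_tendsto n
    by (intro filterlim_compose[OF N.entropy_rate_tendsto] filterlim_subseq) (auto simp: strict_mono_def)
  then have "(\<lambda>k. real n * (ent (push p) (pre (k * n)) / real (k * n)) + ent (push p) (pre L) / real k + ?c)
      \<longlonglongrightarrow> real n * N.entropy_rate + 0 + ?c"
    by (intro tendsto_intros real_div_const_tendsto_0)
  from LIMSEQ_le_const[OF this] bound show ?thesis by auto
qed

text \<open>Replacing \<open>\<phi> n\<close> by its supremum over the points with the same word and
  the same image prefix makes the energy a function of these two finite data, to which
  \<open>cond_ent_gibbs\<close> applies. The truncation at every single word is what forces the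
  deeper level \<open>k + K\<close> on the left.\<close>

lemma cond_ent_word_sum:
  fixes p :: "'a \<Rightarrow> 'd::{finite, discrete_topology}"
  assumes X: "compact X" and \<phi>: "usc_subadditive_potential X \<phi>" and n: "1 \<le> n"
    and K: "real CARD('a) \<le> exp (real K)"
  shows "(\<integral>x. trunc_log \<phi> (k + K) n x \<partial>M) + cond_ent M (pre n) (\<lambda>x. map p (pre L x)) \<le>
    ln 2 + (\<integral>y. trunc_ln (real k * real n) (word_sum X \<phi> n (fiber_nbhd p y L)) \<partial>push p)"
proof -
  interpret N: seq_invariant "seq_map p ` X" "push p" by (rule seq_invariant_push)
  obtain B where B: "0 \<le> B" "\<forall>x\<in>X. \<phi> n x \<le> ennreal B" using usc_potential_bounded[OF X \<phi> n] by blast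
  define t where "t = real (k + K) * real n"
  define s where "s = real k * real n"
  define S where "S I J = (SUP x\<in>X \<inter> ({x. pre n x = I} \<inter> {x. map p (pre L x) = J}). \<phi> n x)" for I J
  define W where "W I J = max (enn2real (S I J)) (exp (- t))" for I J
  have W_pos: "0 < W I J" for I J unfolding W_def by (rule max_exp_pos)
  have S_le: "S I J \<le> ennreal B" for I J unfolding S_def using B by (intro SUP_least) auto
  have S_fin: "S I J < \<top>" for I J using S_le by (rule le_less_trans) simp
  let ?A = "{I :: 'a list. length I = n}" and ?B = "{J :: 'd list. length J = L}"
  let ?ws = "\<lambda>J. word_sum X \<phi> n {x. map p (pre L x) = J}"
  have ws: "?ws J = (\<Sum>I\<in>?A. S I J)" for J by (simp add: word_sum_def S_def)
  have sg: "simple_function M (\<lambda>x. map p (pre L x))" by (rule simple_function_pre)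
  have ln_W: "ln (W I J) = trunc_ln t (S I J)" for I J by (simp add: W_def trunc_ln_def)
  have "(\<integral>x. trunc_log \<phi> (k + K) n x \<partial>M) \<le> (\<integral>x. ln (W (pre n x) (map p (pre L x))) \<partial>M)"
  proof (rule integral_mono[OF integrable_trunc_log[OF X \<phi>]])
    show "integrable M (\<lambda>x. ln (W (pre n x) (map p (pre L x))))"
    proof -
      have "integrable M (\<lambda>x. case (pre n x, map p (pre L x)) of (I, J) \<Rightarrow> ln (W I J))"
        by (rule integral_simple_comp(2)[OF simple_function_Pair[OF simple_function_pre' sg], where B="?A \<times> ?B"])
           (auto simp: finite_words)
      then show ?thesis by simp
    qed
    fix x assume "x \<in> space M"
    then have "\<phi> n x \<le> S (pre n x) (map p (pre L x))" unfolding S_def by (intro SUP_upper) (auto simp: space_M)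
    then show "trunc_log \<phi> (k + K) n x \<le> ln (W (pre n x) (map p (pre L x)))"
      unfolding ln_W using n S_fin by (auto simp: trunc_log_def t_def intro: trunc_ln_mono)
  qed
  moreover have "(\<integral>x. ln (W (pre n x) (map p (pre L x))) \<partial>M) + cond_ent M (pre n) (\<lambda>x. map p (pre L x)) \<le>
      (\<Sum>J\<in>?B. prob {x\<in>space M. map p (pre L x) = J} * ln (\<Sum>I\<in>?A. W I J))"
    by (rule cond_ent_gibbs[OF simple_function_pre' sg finite_words _ finite_words _ W_pos]) auto
  moreover have "ln (\<Sum>I\<in>?A. W I J) \<le> ln 2 + trunc_ln s (?ws J)" for J
  proof -
    have "W I J \<le> enn2real (S I J) + exp (- t)" for I
      unfolding W_def by simp
    then have "(\<Sum>I\<in>?A. W I J) \<le> (\<Sum>I\<in>?A. enn2real (S I J) + exp (- t))" by (rule sum_mono)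
    also have "\<dots> = enn2real (?ws J) + real CARD('a) ^ n * exp (- t)"
      using S_fin by (simp add: ws sum.distrib card_words enn2real_sum)
    \<comment> \<open>Truncation adds at most \<open>exp (- t)\<close> for each of
      \<open>CARD('a) ^ n\<close> words; the surplus \<open>K * n\<close> in \<open>t\<close>
      outweighs their number and leaves \<open>exp (- s)\<close>.\<close>
    also have "real CARD('a) ^ n * exp (- t) \<le> exp (real K) ^ n * exp (- t)"
      using K by (intro mult_right_mono power_mono) auto
    also have "exp (real K) ^ n * exp (- t) = exp (- s)"
      by (simp add: exp_of_nat_mult[symmetric] exp_add[symmetric] t_def s_def algebra_simps)
    also have "enn2real (?ws J) + exp (- s) \<le> 2 * max (enn2real (?ws J)) (exp (- s))" by simp
    finally have "(\<Sum>I\<in>?A. W I J) \<le> 2 * max (enn2real (?ws J)) (exp (- s))" by simp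
    moreover have "replicate n (undefined :: 'a) \<in> ?A" by simp
    then have "0 < (\<Sum>I\<in>?A. W I J)" using W_pos finite_words by (intro sum_pos) blast+
    ultimately have "ln (\<Sum>I\<in>?A. W I J) \<le> ln (2 * max (enn2real (?ws J)) (exp (- s)))"
      by (intro ln_mono) auto
    also have "\<dots> = ln 2 + trunc_ln s (?ws J)"
      unfolding trunc_ln_def using max_exp_pos[of "enn2real (?ws J)" "- s"] by (intro ln_mult_pos) auto
    finally show ?thesis .
  qed
  then have "(\<Sum>J\<in>?B. prob {x\<in>space M. map p (pre L x) = J} * ln (\<Sum>I\<in>?A. W I J)) \<le>
      (\<Sum>J\<in>?B. prob {x\<in>space M. map p (pre L x) = J} * (ln 2 + trunc_ln s (?ws J)))"
    by (intro sum_mono mult_left_mono) auto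
  moreover have "\<dots> = (\<integral>y. ln 2 + trunc_ln s (?ws (pre L y)) \<partial>push p)"
    by (subst N.integral_simple_comp(1)[OF N.simple_function_pre' finite_words, of L L "\<lambda>J. ln 2 + trunc_ln s (?ws J)"])
       (auto simp: measure_push_pre mult.commute)
  moreover have "\<dots> = ln 2 + (\<integral>y. trunc_ln s (?ws (pre L y)) \<partial>push p)"
    using N.integral_simple_comp(2)[OF N.simple_function_pre' finite_words, of L L "\<lambda>J. trunc_ln s (?ws J)"]
    by (simp add: N.prob_space image_subset_iff)
  ultimately show ?thesis by (simp add: fiber_nbhd_def s_def)
qed

text \<open>Dominated convergence: every word sum lies below the one over \<open>UNIV\<close>, which
  is finite.\<close>

lemma integral_word_sum_tendsto:
  fixes p :: "'a \<Rightarrow> 'd::{finite, discrete_topology}"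
  assumes X: "compact X" and \<phi>: "usc_subadditive_potential X \<phi>" and n: "1 \<le> n"
  shows "(\<lambda>L. \<integral>y. trunc_ln s (word_sum X \<phi> n (fiber_nbhd p y L)) \<partial>push p)
    \<longlonglongrightarrow> (\<integral>y. trunc_ln s (fiber_sum X p \<phi> n y) \<partial>push p)"
proof -
  interpret N: seq_invariant "seq_map p ` X" "push p" by (rule seq_invariant_push)
  obtain B where B: "0 \<le> B" "\<forall>x\<in>X. \<phi> n x \<le> ennreal B" using usc_potential_bounded[OF X \<phi> n] by blast
  have usc: "upper_semicontinuous_on X (\<phi> n)" using \<phi> n by (simp add: usc_subadditive_potential_def)
  define b where "b = enn2real (word_sum X \<phi> n UNIV)"
  have top: "word_sum X \<phi> n D < \<top>" for D using B by (intro word_sum_less_top) auto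
  have le_b: "word_sum X \<phi> n D \<le> ennreal b" for D
    using word_sum_mono[of D UNIV X \<phi> n] top[of UNIV] by (simp add: b_def)
  have meas: "(\<lambda>y. word_sum X \<phi> n (fiber_nbhd p y L)) \<in> borel_measurable (push p)" for L
    unfolding fiber_nbhd_def by (rule borel_measurable_simple_function[OF N.simple_function_pre])
  have "compact (seq_map p ` X)" by (rule compact_continuous_image[OF continuous_on_seq_map X])
  then have meas': "fiber_sum X p \<phi> n \<in> borel_measurable (push p)"
    by (rule N.borel_measurable_usc) (rule fiber_sum_usc[where \<phi>=\<phi> and n=n, OF X usc])
  show ?thesis
  proof (rule integral_dominated_convergence[where w="\<lambda>_. \<bar>s\<bar> + \<bar>ln (max b (exp (- s)))\<bar>"])
    show "(\<lambda>y. trunc_ln s (fiber_sum X p \<phi> n y)) \<in> borel_measurable (push p)"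
      using meas' by (rule borel_measurable_trunc_ln)
    show "(\<lambda>y. trunc_ln s (word_sum X \<phi> n (fiber_nbhd p y L))) \<in> borel_measurable (push p)" for L
      using meas by (rule borel_measurable_trunc_ln)
    show "AE y in push p. (\<lambda>L. trunc_ln s (word_sum X \<phi> n (fiber_nbhd p y L))) \<longlonglongrightarrow> trunc_ln s (fiber_sum X p \<phi> n y)"
      by (intro AE_I2 trunc_ln_tendsto fiber_sum_tendsto[where \<phi>=\<phi> and n=n, OF X usc])
         (simp add: fiber_sum_def top)
    show "AE y in push p. norm (trunc_ln s (word_sum X \<phi> n (fiber_nbhd p y L))) \<le> \<bar>s\<bar> + \<bar>ln (max b (exp (- s)))\<bar>" for L
      using trunc_ln_bounded[OF le_b] by simp
  qed simp
qed

text \<open>The depth \<open>L\<close> tends to infinity first, with \<open>n\<close> and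
  \<open>k\<close> fixed; then division by \<open>n\<close> removes \<open>ln 2\<close>; the infimum
  over \<open>k\<close> comes last. The shift by \<open>K\<close> does no harm there, since every
  truncated mean bounds the mean from above.\<close>

theorem relative_upper_bound:
  fixes p :: "'a \<Rightarrow> 'd::{finite, discrete_topology}"
  assumes X: "subshift X" and \<phi>: "usc_subadditive_potential X \<phi>"
  shows "potential_mean \<phi> M + ereal entropy_rate \<le>
    potential_mean (fiber_sum X p \<phi>) (push p) + ereal (seq_invariant.entropy_rate (push p))"
proof -
  interpret N: seq_invariant "seq_map p ` X" "push p" by (rule seq_invariant_push)
  have comp: "compact X" using X by (simp add: subshift_def)
  have compY: "compact (seq_map p ` X)" by (rule compact_continuous_image[OF continuous_on_seq_map comp])
  let ?\<psi> = "fiber_sum X p \<phi>"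
  have \<psi>: "usc_subadditive_potential (seq_map p ` X) ?\<psi>" by (rule fiber_sum_usc_subadditive[OF X \<phi>])
  obtain K :: nat where "ln (real CARD('a)) \<le> real K" using real_arch_simple by blast
  moreover have "exp (ln (real CARD('a))) = real CARD('a)" by (rule exp_ln) simp
  ultimately have K: "real CARD('a) \<le> exp (real K)" by (metis exp_le_cancel_iff)
  have step: "(\<integral>x. trunc_log \<phi> (k + K) n x \<partial>M) + real n * entropy_rate \<le>
      ln 2 + (\<integral>y. trunc_log ?\<psi> k n y \<partial>push p) + real n * N.entropy_rate" if n: "1 \<le> n" for k n
  proof -
    have "(\<integral>x. trunc_log \<phi> (k + K) n x \<partial>M) + real n * entropy_rate - real n * N.entropy_rate - ln 2 \<le>
        (\<integral>y. trunc_ln (real k * real n) (word_sum X \<phi> n (fiber_nbhd p y L)) \<partial>push p)" for L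
      using cond_ent_word_sum[OF comp \<phi> n K, where k=k and L=L and p=p] entropy_rate_le_push[OF n, where L=L and p=p] by linarith
    with LIMSEQ_le_const[OF integral_word_sum_tendsto[OF comp \<phi> n]]
    have "(\<integral>x. trunc_log \<phi> (k + K) n x \<partial>M) + real n * entropy_rate - real n * N.entropy_rate - ln 2 \<le>
        (\<integral>y. trunc_ln (real k * real n) (?\<psi> n y) \<partial>push p)" by blast
    moreover have "(\<integral>y. trunc_ln (real k * real n) (?\<psi> n y) \<partial>push p) = (\<integral>y. trunc_log ?\<psi> k n y \<partial>push p)"
      using n by (simp add: trunc_log_def)
    ultimately show ?thesis by linarith
  qed
  have mean: "trunc_mean \<phi> (k + K) M + entropy_rate \<le> trunc_mean ?\<psi> k (push p) + N.entropy_rate" for k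
  proof -
    have 1: "(\<lambda>n. (\<integral>x. trunc_log \<phi> (k + K) n x \<partial>M) / real n + entropy_rate) \<longlonglongrightarrow> trunc_mean \<phi> (k + K) M + entropy_rate"
      by (intro tendsto_intros trunc_mean_tendsto[OF comp \<phi>])
    have 2: "(\<lambda>n. ln 2 / real n + (\<integral>y. trunc_log ?\<psi> k n y \<partial>push p) / real n + N.entropy_rate)
        \<longlonglongrightarrow> 0 + trunc_mean ?\<psi> k (push p) + N.entropy_rate"
      by (intro tendsto_intros N.trunc_mean_tendsto[OF compY \<psi>] real_div_const_tendsto_0)
    have "\<exists>N0. \<forall>n\<ge>N0. (\<integral>x. trunc_log \<phi> (k + K) n x \<partial>M) / real n + entropy_rate \<le>
        ln 2 / real n + (\<integral>y. trunc_log ?\<psi> k n y \<partial>push p) / real n + N.entropy_rate"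
    proof (intro exI[of _ 1] allI impI)
      fix n :: nat assume "1 \<le> n"
      then show "(\<integral>x. trunc_log \<phi> (k + K) n x \<partial>M) / real n + entropy_rate \<le>
        ln 2 / real n + (\<integral>y. trunc_log ?\<psi> k n y \<partial>push p) / real n + N.entropy_rate"
        using divide_right_mono[OF step[of n k], of "real n"] by (simp add: add_divide_distrib)
    qed
    from LIMSEQ_le[OF 1 2 this] show ?thesis by simp
  qed
  \<comment> \<open>Both entropies are real numbers and move to one side, so that the infimum acts
    on the truncated means alone.\<close>
  have "potential_mean \<phi> M + ereal (entropy_rate - N.entropy_rate) \<le> (INF k. ereal (trunc_mean ?\<psi> k (push p)))"
  proof (rule INF_greatest)
    fix k
    have "potential_mean \<phi> M \<le> ereal (trunc_mean \<phi> (k + K) M)"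
      unfolding potential_mean_usc[OF comp \<phi>] by (rule INF_lower) simp
    then have "potential_mean \<phi> M + ereal (entropy_rate - N.entropy_rate) \<le>
        ereal (trunc_mean \<phi> (k + K) M) + ereal (entropy_rate - N.entropy_rate)" by (rule add_right_mono)
    also have "\<dots> \<le> ereal (trunc_mean ?\<psi> k (push p))" using mean[of k] by simp
    finally show "potential_mean \<phi> M + ereal (entropy_rate - N.entropy_rate) \<le> ereal (trunc_mean ?\<psi> k (push p))" .
  qed
  then show ?thesis
    unfolding N.potential_mean_usc[OF compY \<psi>]
    by (cases "potential_mean \<phi> M"; cases "INF k. ereal (trunc_mean ?\<psi> k (push p))") auto
qed

end

section \<open>Finitely supported approximations\<close>

lemma pmf_of_weights:
  assumes "finite S" "\<And>x. x \<in> S \<Longrightarrow> 0 \<le> q x" "(\<Sum>x\<in>S. q x) = (1::real)"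
  shows "\<exists>\<eta>. set_pmf \<eta> \<subseteq> S \<and> (\<forall>x\<in>S. pmf \<eta> x = q x)"
proof -
  define f where "f x = (if x \<in> S then q x else 0)" for x
  have nn: "0 \<le> f x" for x using assms(2) by (simp add: f_def)
  have "(\<integral>\<^sup>+x. ennreal (f x) \<partial>count_space UNIV) = (\<Sum>x\<in>S. ennreal (f x))"
    using assms(1) by (intro nn_integral_count_space'[where A=S]) (auto simp: f_def)
  also have "\<dots> = 1" using assms by (simp add: f_def sum_ennreal)
  finally have 1: "(\<integral>\<^sup>+x. ennreal (f x) \<partial>count_space UNIV) = 1" .
  have pmf: "pmf (embed_pmf f) x = f x" for x by (rule pmf_embed_pmf[OF nn 1])
  have "set_pmf (embed_pmf f) \<subseteq> S" using pmf by (auto simp: set_pmf_iff f_def split: if_splits)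
  with pmf show ?thesis by (intro exI[of _ "embed_pmf f"]) (simp add: f_def)
qed

lemma expectation_finite_pmf:
  fixes f :: "'a \<Rightarrow> real"
  assumes "finite S" "set_pmf \<eta> \<subseteq> S"
  shows "measure_pmf.expectation \<eta> f = (\<Sum>x\<in>S. pmf \<eta> x * f x)"
  using assms by (subst integral_measure_pmf[of S]) auto

lemma prob_finite_pmf:
  assumes "finite S" "set_pmf \<eta> \<subseteq> S"
  shows "measure_pmf.prob \<eta> A = (\<Sum>x\<in>S \<inter> A. pmf \<eta> x)"
proof -
  have "measure_pmf.prob \<eta> A = measure_pmf.expectation \<eta> (indicator A)" by simp
  also have "\<dots> = (\<Sum>x\<in>S. pmf \<eta> x * indicator A x)" by (rule expectation_finite_pmf[OF assms])
  also have "\<dots> = (\<Sum>x\<in>S. if x \<in> A then pmf \<eta> x else 0)"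
    by (intro sum.cong) (auto simp: indicator_def)
  also have "\<dots> = (\<Sum>x\<in>S \<inter> A. pmf \<eta> x)" by (rule sum.inter_restrict[symmetric, OF assms(1)])
  finally show ?thesis .
qed

lemma simple_function_pmf: "finite (range f) \<Longrightarrow> simple_function (measure_pmf \<eta>) f"
  by (simp add: simple_function_def)

lemma finite_range_pre: "finite (range (\<lambda>x :: nat \<Rightarrow> 'a::finite. f (pre n x)))"
proof -
  have "finite (f ` {I :: 'a list. length I = n})" using finite_words by blast
  then show ?thesis by (rule finite_subset[rotated]) auto
qed

lemma ent_pmf_inj:
  assumes S: "finite S" "set_pmf \<eta> \<subseteq> S" and f: "finite (range f)" "inj_on f S"
  shows "ent (measure_pmf \<eta>) f = (\<Sum>x\<in>S. eta (pmf \<eta> x))"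
proof -
  have p: "measure_pmf.prob \<eta> {x. f x = f z} = pmf \<eta> z" if "z \<in> S" for z
  proof -
    have "S \<inter> {x. f x = f z} = {z}" using f(2) that by (auto dest: inj_onD)
    then show ?thesis by (simp add: prob_finite_pmf[OF S])
  qed
  have z: "measure_pmf.prob \<eta> {x. f x = b} = 0" if "b \<notin> f ` S" for b
  proof -
    have "S \<inter> {x. f x = b} = {}" using that by auto
    then show ?thesis by (simp add: prob_finite_pmf[OF S])
  qed
  have "ent (measure_pmf \<eta>) f = (\<Sum>b\<in>f ` S. eta (measure_pmf.prob \<eta> {x. f x = b}))"
    unfolding ent_def using f(1) by (intro sum.mono_neutral_cong_right) (auto simp: z)
  also have "\<dots> = (\<Sum>x\<in>S. eta (pmf \<eta> x))"
    using f(2) p by (subst sum.reindex) auto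
  finally show ?thesis .
qed

lemma (in prob_space) prob_comp_eq:
  assumes f: "simple_function M f" and B: "finite B" "f ` space M \<subseteq> B"
  shows "prob {x\<in>space M. h (f x) = c} = (\<Sum>b\<in>{b\<in>B. h b = c}. prob {x\<in>space M. f x = b})"
proof -
  have "simple_function M (\<lambda>x. h (f x))" using simple_function_compose1[OF f, of h] .
  then have m: "{x\<in>space M. h (f x) = c} \<in> events" by (rule simple_function_level_set)
  have "prob {x\<in>space M. h (f x) = c} = (\<integral>x. indicator {x\<in>space M. h (f x) = c} x \<partial>M)"
    using m by simp
  also have "\<dots> = (\<integral>x. (if h (f x) = c then 1 else 0) \<partial>M)"
    by (intro Bochner_Integration.integral_cong) (auto simp: indicator_def)
  also have "\<dots> = (\<Sum>b\<in>B. (if h b = c then 1 else 0) * prob {x\<in>space M. f x = b})"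
    by (rule integral_simple_comp(1)[OF f B])
  also have "\<dots> = (\<Sum>b\<in>{b\<in>B. h b = c}. prob {x\<in>space M. f x = b})"
    using B(1) by (simp add: sum.If_cases if_distrib[where f="\<lambda>u. u * _"] Int_def conj_commute cong: if_cong)
  finally show ?thesis .
qed

text \<open>Equal laws of long words give equal laws of everything computed from them, in particular
  of subwords.\<close>

lemma prob_comp_cong:
  assumes "prob_space M" "prob_space N" "simple_function M f" "simple_function N g"
    and "finite B" "f ` space M \<subseteq> B" "g ` space N \<subseteq> B"
    and eq: "\<And>b. b \<in> B \<Longrightarrow> measure M {x\<in>space M. f x = b} = measure N {x\<in>space N. g x = b}"
  shows "measure M {x\<in>space M. h (f x) = c} = measure N {x\<in>space N. h (g x) = c}"
  using assms by (simp add: prob_space.prob_comp_eq)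

lemma exists_almost_max:
  fixes f :: "'a \<Rightarrow> real"
  assumes "A \<noteq> {}" "\<And>x. x \<in> A \<Longrightarrow> f x \<le> K"
  shows "\<exists>x\<in>A. \<forall>z\<in>A. f z \<le> f x + 1"
proof -
  have bdd: "bdd_above (f ` A)" using assms by (intro bdd_aboveI[of _ K]) auto
  have "Sup (f ` A) - 1 < Sup (f ` A)" by simp
  then obtain x where x: "x \<in> A" "Sup (f ` A) - 1 < f x"
    using less_cSup_iff[of "f ` A" "Sup (f ` A) - 1"] assms(1) bdd by auto
  have "f z \<le> f x + 1" if "z \<in> A" for z
    using cSup_upper[of "f z" "f ` A"] that bdd x(2) by force
  with x(1) show ?thesis by blast
qed

text \<open>For each word occurring in the fibre, keep one point that maximizes the truncated
  logarithm up to 1. On the exponential scale this loses a factor e, which is harmless after taking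
  logarithms and dividing by \<open>n\<close>.\<close>

lemma fiber_selection:
  fixes X :: "(nat \<Rightarrow> 'a::{finite, discrete_topology}) set" and p :: "'a \<Rightarrow> 'd::{finite, discrete_topology}"
  assumes y: "y \<in> seq_map p ` X" and B: "\<And>x. x \<in> X \<Longrightarrow> \<phi> n x \<le> ennreal B"
  shows "\<exists>S\<subseteq>X. finite S \<and> inj_on (pre n) S \<and> (\<forall>x\<in>S. seq_map p x = y) \<and>
    exp (trunc_ln t (fiber_sum X p \<phi> n y) - 1) \<le> (\<Sum>x\<in>S. exp (trunc_ln t (\<phi> n x)))"
proof -
  define D where "D I = X \<inter> ({x. pre n x = I} \<inter> {x. seq_map p x = y})" for I
  define Is where "Is = {I. length I = n \<and> D I \<noteq> {}}"
  have fin: "finite Is" unfolding Is_def by (rule finite_subset[OF _ finite_words[of n]]) auto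
  have "\<exists>x\<in>D I. \<forall>z\<in>D I. trunc_ln t (\<phi> n z) \<le> trunc_ln t (\<phi> n x) + 1" if "I \<in> Is" for I
  proof (rule exists_almost_max)
    show "D I \<noteq> {}" using that by (simp add: Is_def)
    fix x assume "x \<in> D I"
    then have "\<phi> n x \<le> ennreal B" using B by (simp add: D_def)
    from trunc_ln_bounded[OF this, of t]
    show "trunc_ln t (\<phi> n x) \<le> \<bar>t\<bar> + \<bar>ln (max B (exp (- t)))\<bar>" by linarith
  qed
  then have "\<forall>I\<in>Is. \<exists>x. x \<in> D I \<and> (\<forall>z\<in>D I. trunc_ln t (\<phi> n z) \<le> trunc_ln t (\<phi> n x) + 1)" by blast
  from bchoice[OF this] obtain s where
    s_all: "\<forall>I\<in>Is. s I \<in> D I \<and> (\<forall>z\<in>D I. trunc_ln t (\<phi> n z) \<le> trunc_ln t (\<phi> n (s I)) + 1)" ..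
  then have s: "s I \<in> D I" "z \<in> D I \<Longrightarrow> trunc_ln t (\<phi> n z) \<le> trunc_ln t (\<phi> n (s I)) + 1" if "I \<in> Is" for I z
    using that by blast+
  have pre_s: "pre n (s I) = I" if "I \<in> Is" for I using s(1)[OF that] by (simp add: D_def)
  have inj: "inj_on s Is" using pre_s by (metis inj_onI)
  define w where "w I = exp (trunc_ln t (\<phi> n (s I)))" for I
  define Z where "Z = (\<Sum>I\<in>Is. w I)"
  have w_pos: "0 < w I" for I by (simp add: w_def)
  have Z_eq: "(\<Sum>x\<in>s ` Is. exp (trunc_ln t (\<phi> n x))) = Z"
    unfolding Z_def w_def by (simp add: sum.reindex[OF inj])
  obtain x0 where x0: "x0 \<in> X" "y = seq_map p x0" using y by auto
  have I0: "pre n x0 \<in> Is" using x0 by (auto simp: Is_def D_def)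
  \<comment> \<open>The truncated fibre sum may equal its threshold, so \<open>Z\<close> has to
    reach it too; one word in the fibre is enough, and \<open>y\<close> has a preimage.\<close>
  have e_le: "exp (- t) \<le> Z"
  proof -
    have "exp (- t) \<le> w (pre n x0)" unfolding w_def by (simp add: trunc_ln_ge)
    also have "\<dots> \<le> Z" unfolding Z_def using fin I0 w_pos by (intro member_le_sum less_imp_le) auto
    finally show ?thesis .
  qed
  have "(SUP x\<in>D I. \<phi> n x) \<le> ennreal (exp 1 * w I)" if I: "I \<in> Is" for I
  proof (rule SUP_least)
    fix z assume z: "z \<in> D I"
    have "enn2real (\<phi> n z) \<le> exp (trunc_ln t (\<phi> n z))" by (simp add: exp_trunc_ln)
    also have "\<dots> \<le> exp (1 + trunc_ln t (\<phi> n (s I)))" using s(2)[OF I z] by simp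
    also have "\<dots> = exp 1 * w I" by (simp add: w_def exp_add)
    finally have "ennreal (enn2real (\<phi> n z)) \<le> ennreal (exp 1 * w I)" by (rule ennreal_leI)
    moreover have "\<phi> n z \<le> ennreal B" using B z by (simp add: D_def)
    then have "\<phi> n z < \<top>" by (rule le_less_trans) simp
    ultimately show "\<phi> n z \<le> ennreal (exp 1 * w I)" by simp
  qed
  then have "(\<Sum>I\<in>Is. SUP x\<in>D I. \<phi> n x) \<le> (\<Sum>I\<in>Is. ennreal (exp 1 * w I))" by (rule sum_mono)
  also have "\<dots> = ennreal (exp 1 * Z)"
    using w_pos by (simp add: sum_ennreal Z_def sum_distrib_left less_imp_le)
  finally have "(\<Sum>I\<in>Is. SUP x\<in>D I. \<phi> n x) \<le> ennreal (exp 1 * Z)" .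
  moreover have "fiber_sum X p \<phi> n y = (\<Sum>I\<in>Is. SUP x\<in>D I. \<phi> n x)"
    unfolding fiber_sum_def word_sum_def D_def[symmetric]
    using finite_words by (intro sum.mono_neutral_right) (auto simp: Is_def bot_ennreal)
  ultimately have "fiber_sum X p \<phi> n y \<le> ennreal (exp 1 * Z)" by simp
  moreover have "0 \<le> Z" using e_le exp_gt_zero[of "- t"] by linarith
  then have "0 \<le> exp 1 * Z" by simp
  ultimately have "enn2real (fiber_sum X p \<phi> n y) \<le> exp 1 * Z"
    using enn2real_mono[of "fiber_sum X p \<phi> n y" "ennreal (exp 1 * Z)"] by simp
  moreover have "exp (- t) \<le> exp 1 * Z"
  proof -
    have "0 \<le> Z" using e_le exp_gt_zero[of "- t"] by linarith
    then have "1 * Z \<le> exp 1 * Z" by (intro mult_right_mono) auto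
    with e_le show ?thesis by simp
  qed
  ultimately have "exp (trunc_ln t (fiber_sum X p \<phi> n y)) \<le> exp 1 * Z" by (simp add: exp_trunc_ln)
  then have "exp (trunc_ln t (fiber_sum X p \<phi> n y) - 1) \<le> Z"
    by (simp add: exp_diff field_simps)
  then show ?thesis
    using s(1) inj pre_s fin
    by (intro exI[of _ "s ` Is"]) (auto simp: Z_eq D_def inj_on_def)
qed

text \<open>One almost optimal base point per word of length \<open>m\<close> costs the second
  factor e and makes the bound valid for every \<open>y\<close> with that prefix. Points selected
  over the same word share their base point, so their prefixes of length \<open>n\<close> already
  separate them.\<close>

lemma word_selection:
  fixes X :: "(nat \<Rightarrow> 'a::{finite, discrete_topology}) set" and p :: "'a \<Rightarrow> 'd::{finite, discrete_topology}"
  assumes B: "\<And>x. x \<in> X \<Longrightarrow> \<phi> n x \<le> ennreal B"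
  shows "\<exists>S\<subseteq>X. finite S \<and> inj_on (\<lambda>x. (pre n x, map p (pre m x))) S \<and>
    (\<forall>y\<in>seq_map p ` X. exp (trunc_ln t (fiber_sum X p \<phi> n y) - 2) \<le>
      (\<Sum>x\<in>{x\<in>S. map p (pre m x) = pre m y}. exp (trunc_ln t (\<phi> n x))))"
proof -
  let ?Y = "seq_map p ` X" and ?f = "\<lambda>y. trunc_ln t (fiber_sum X p \<phi> n y)"
  define Js where "Js = pre m ` ?Y"
  have finJ: "finite Js" unfolding Js_def by (rule finite_subset[OF _ finite_words[of m]]) auto
  have "\<exists>S\<subseteq>X. finite S \<and> inj_on (pre n) S \<and> (\<forall>x\<in>S. map p (pre m x) = J) \<and>
      (\<forall>y\<in>?Y. pre m y = J \<longrightarrow> exp (?f y - 2) \<le> (\<Sum>x\<in>S. exp (trunc_ln t (\<phi> n x))))" if J: "J \<in> Js" for J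
  proof -
    have "\<exists>y\<in>{y\<in>?Y. pre m y = J}. \<forall>z\<in>{y\<in>?Y. pre m y = J}. ?f z \<le> ?f y + 1"
    proof (rule exists_almost_max)
      show "{y\<in>?Y. pre m y = J} \<noteq> {}" using J by (auto simp: Js_def)
      define b where "b = enn2real (word_sum X \<phi> n UNIV)"
      fix y
      have "fiber_sum X p \<phi> n y \<le> ennreal b"
        using word_sum_less_top[of X \<phi> n B UNIV] B word_sum_mono[of _ UNIV X \<phi> n]
        by (simp add: b_def fiber_sum_def)
      from trunc_ln_bounded[OF this, of t] show "?f y \<le> \<bar>t\<bar> + \<bar>ln (max b (exp (- t)))\<bar>" by linarith
    qed
    then obtain y where y: "y \<in> ?Y" "pre m y = J" "\<And>z. z \<in> ?Y \<Longrightarrow> pre m z = J \<Longrightarrow> ?f z \<le> ?f y + 1" by blast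
    from fiber_selection[where \<phi>=\<phi> and n=n and t=t, OF y(1) B] obtain S where S: "S \<subseteq> X" "finite S" "inj_on (pre n) S"
      "\<forall>x\<in>S. seq_map p x = y" "exp (?f y - 1) \<le> (\<Sum>x\<in>S. exp (trunc_ln t (\<phi> n x)))" by blast
    have "exp (?f z - 2) \<le> (\<Sum>x\<in>S. exp (trunc_ln t (\<phi> n x)))" if "z \<in> ?Y" "pre m z = J" for z
    proof -
      have "exp (?f z - 2) \<le> exp (?f y - 1)" using y(3)[OF that] by simp
      with S(5) show ?thesis by linarith
    qed
    moreover have "map p (pre m x) = J" if "x \<in> S" for x
      using S(4) that y(2) by (simp add: pre_seq_map[symmetric])
    ultimately show ?thesis using S(1-3) by (intro exI[of _ S]) auto
  qed
  then have "\<forall>J\<in>Js. \<exists>S. S \<subseteq> X \<and> finite S \<and> inj_on (pre n) S \<and> (\<forall>x\<in>S. map p (pre m x) = J) \<and>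
      (\<forall>y\<in>?Y. pre m y = J \<longrightarrow> exp (?f y - 2) \<le> (\<Sum>x\<in>S. exp (trunc_ln t (\<phi> n x))))" by blast
  from bchoice[OF this] obtain S where S_all: "\<forall>J\<in>Js. S J \<subseteq> X \<and> finite (S J) \<and> inj_on (pre n) (S J) \<and>
      (\<forall>x\<in>S J. map p (pre m x) = J) \<and>
      (\<forall>y\<in>?Y. pre m y = J \<longrightarrow> exp (?f y - 2) \<le> (\<Sum>x\<in>S J. exp (trunc_ln t (\<phi> n x))))" ..
  have S: "S J \<subseteq> X" "finite (S J)" "inj_on (pre n) (S J)" "\<And>x. x \<in> S J \<Longrightarrow> map p (pre m x) = J"
    "\<And>y. y \<in> ?Y \<Longrightarrow> pre m y = J \<Longrightarrow> exp (?f y - 2) \<le> (\<Sum>x\<in>S J. exp (trunc_ln t (\<phi> n x)))" if "J \<in> Js" for J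
    using S_all that by blast+
  have level: "{x \<in> (\<Union>J\<in>Js. S J). map p (pre m x) = J} = S J" if "J \<in> Js" for J
    using that S(4) by auto
  show ?thesis
  proof (intro exI[of _ "\<Union>J\<in>Js. S J"] conjI ballI)
    show "(\<Union>J\<in>Js. S J) \<subseteq> X" using S(1) by blast
    show "finite (\<Union>J\<in>Js. S J)" using finJ S(2) by blast
    show "inj_on (\<lambda>x. (pre n x, map p (pre m x))) (\<Union>J\<in>Js. S J)"
    proof (rule inj_onI)
      fix x z assume x: "x \<in> (\<Union>J\<in>Js. S J)" and z: "z \<in> (\<Union>J\<in>Js. S J)"
        and eq: "(pre n x, map p (pre m x)) = (pre n z, map p (pre m z))"
      from x obtain J where J: "J \<in> Js" "x \<in> S J" by blast
      from z obtain J' where J': "J' \<in> Js" "z \<in> S J'" by blast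
      have "J = J'" using S(4)[OF J] S(4)[OF J'] eq by simp
      then show "x = z" using inj_onD[OF S(3)[OF J(1)] _ J(2)] J'(2) eq by simp
    qed
    fix y assume y: "y \<in> ?Y"
    then have J: "pre m y \<in> Js" by (simp add: Js_def)
    show "exp (?f y - 2) \<le> (\<Sum>x\<in>{x\<in>\<Union>J\<in>Js. S J. map p (pre m x) = pre m y}. exp (trunc_ln t (\<phi> n x)))"
      unfolding level[OF J] by (rule S(5)[OF J y refl])
  qed
qed

text \<open>The approximating measure gives the points selected over a word the weights of a Gibbs measure,
  for which entropy plus energy is exactly the logarithm of the partition function.\<close>

lemma gibbs_approximation:
  fixes X :: "(nat \<Rightarrow> 'a::{finite, discrete_topology}) set" and p :: "'a \<Rightarrow> 'd::{finite, discrete_topology}"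
  assumes N: "seq_invariant (seq_map p ` X) N" and X: "compact X" and \<phi>: "usc_subadditive_potential X \<phi>"
    and n: "1 \<le> n" "n \<le> m"
  shows "\<exists>\<eta>. finite (set_pmf \<eta>) \<and> set_pmf \<eta> \<subseteq> X \<and>
    (\<forall>J. length J = m \<longrightarrow> measure_pmf.prob \<eta> {x. map p (pre m x) = J} = measure N {y\<in>space N. pre m y = J}) \<and>
    (\<integral>y. trunc_log (fiber_sum X p \<phi>) k n y \<partial>N) + ent N (pre n) - 2 \<le>
      measure_pmf.expectation \<eta> (trunc_log \<phi> k n) + ent (measure_pmf \<eta>) (pre n)"
proof -
  interpret N: seq_invariant "seq_map p ` X" N by (rule N)
  define t where "t = real k * real n"
  let ?\<psi> = "fiber_sum X p \<phi>"
  obtain B where "\<forall>x\<in>X. \<phi> n x \<le> ennreal B" using usc_potential_bounded[OF X \<phi> n(1)] by blast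
  then obtain S where S: "S \<subseteq> X" "finite S" "inj_on (\<lambda>x. (pre n x, map p (pre m x))) S"
    and Z_ge: "\<forall>y\<in>seq_map p ` X. exp (trunc_ln t (?\<psi> n y) - 2) \<le>
      (\<Sum>x\<in>{x\<in>S. map p (pre m x) = pre m y}. exp (trunc_ln t (\<phi> n x)))"
    using word_selection[where X=X and \<phi>=\<phi> and n=n and B=B and m=m and p=p and t=t] by blast
  define J where "J x = map p (pre m x)" for x
  define W where "W x = exp (trunc_ln t (\<phi> n x))" for x
  define Z where "Z K = (\<Sum>x\<in>{x\<in>S. J x = K}. W x)" for K
  define \<nu> where "\<nu> K = measure N {y\<in>space N. pre m y = K}" for K
  let ?B = "{K :: 'd list. length K = m}"
  have W_pos: "0 < W x" for x by (simp add: W_def)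
  have Z_ge': "exp (trunc_ln t (?\<psi> n y) - 2) \<le> Z (pre m y)" if "y \<in> space N" for y
  proof -
    have "y \<in> seq_map p ` X" using that by (simp only: N.space_M)
    from Z_ge[rule_format, OF this] show ?thesis by (simp only: Z_def J_def W_def)
  qed
  have \<nu>_nn: "0 \<le> \<nu> K" for K by (simp add: \<nu>_def)
  \<comment> \<open>A word charged by \<open>N\<close> is the prefix of some point of the image,
    where the selection bounds \<open>Z\<close> from below.\<close>
  have Z_pos: "0 < Z K" if "\<nu> K \<noteq> 0" for K
  proof -
    have "{y\<in>space N. pre m y = K} \<noteq> {}" using that unfolding \<nu>_def by (metis measure_empty)
    then obtain y where "y \<in> space N" "pre m y = K" by blast
    with Z_ge'[of y] show ?thesis by (auto intro: less_le_trans[OF exp_gt_zero])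
  qed
  \<comment> \<open>Each word keeps its \<open>N\<close>-mass, shared among the selected points
    above it in proportion to \<open>W\<close>. Where \<open>\<nu>\<close> vanishes so does
    \<open>q\<close>, even if \<open>Z\<close> is 0.\<close>
  define q where "q x = \<nu> (J x) * W x / Z (J x)" for x
  have Z_nn: "0 \<le> Z K" for K unfolding Z_def using W_pos by (intro sum_nonneg less_imp_le) auto
  have q_nn: "0 \<le> q x" for x unfolding q_def using \<nu>_nn Z_nn W_pos by (simp add: less_imp_le)
  have q_level: "(\<Sum>x\<in>{x\<in>S. J x = K}. q x) = \<nu> K" for K
  proof (cases "\<nu> K = 0")
    case False
    have "(\<Sum>x\<in>{x\<in>S. J x = K}. q x) = (\<Sum>x\<in>{x\<in>S. J x = K}. \<nu> K / Z K * W x)"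
      by (intro sum.cong) (auto simp: q_def)
    also have "\<dots> = \<nu> K / Z K * Z K" by (simp only: sum_distrib_left[symmetric] Z_def[symmetric])
    also have "\<dots> = \<nu> K" using Z_pos[OF False] by simp
    finally show ?thesis .
  qed (auto simp: q_def intro!: sum.neutral)
  have group: "(\<Sum>x\<in>S. g x) = (\<Sum>K\<in>?B. \<Sum>x\<in>{x\<in>S. J x = K}. g x)" for g :: "(nat \<Rightarrow> 'a) \<Rightarrow> real"
    by (rule sum.group[symmetric, OF S(2) finite_words]) (auto simp: J_def)
  have \<nu>_sum: "(\<Sum>K\<in>?B. \<nu> K) = 1"
    unfolding \<nu>_def by (rule N.sum_prob_level[OF N.simple_function_pre' finite_words]) auto
  have "(\<Sum>x\<in>S. q x) = 1" unfolding group q_level \<nu>_sum ..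
  from pmf_of_weights[OF S(2) q_nn this] obtain \<eta> where \<eta>: "set_pmf \<eta> \<subseteq> S" "\<forall>x\<in>S. pmf \<eta> x = q x" by blast
  have prob_J: "measure_pmf.prob \<eta> {x. J x = K} = \<nu> K" for K
    using \<eta>(2) by (simp add: prob_finite_pmf[OF S(2) \<eta>(1)] q_level[symmetric] Int_def)
  have fin_range: "finite (range (\<lambda>x :: nat \<Rightarrow> 'a. f (pre l x)))" for f :: "'a list \<Rightarrow> 'c" and l
    by (rule finite_range_pre)
  have sJ: "simple_function (measure_pmf \<eta>) (\<lambda>x. map p (pre l x))" for l
    by (rule simple_function_pmf[OF finite_range_pre])
  have sn: "simple_function (measure_pmf \<eta>) (pre l)" for l
    by (rule simple_function_pmf) (use finite_range_pre[of "\<lambda>I :: 'a list. I" l] in simp)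
  have ent_J: "ent (measure_pmf \<eta>) J = (\<Sum>K\<in>?B. eta (\<nu> K))"
    by (subst ent_superset[of ?B]) (auto simp: finite_words prob_J J_def[symmetric], auto simp: J_def)
  have ent_Jn: "ent (measure_pmf \<eta>) (\<lambda>x. map p (pre n x)) = ent N (pre n)"
  proof -
    let ?C = "{K :: 'd list. length K = n}"
    have "measure_pmf.prob \<eta> {x. map p (pre n x) = K} = measure N {y\<in>space N. pre n y = K}" for K
    proof -
      have t1: "map p (pre n x) = take n (J x)" for x using n by (simp add: J_def pre_def take_map)
      have t2: "pre n y = take n (pre m y)" for y :: "nat \<Rightarrow> 'd" using n by (simp add: pre_def take_map)
      have "measure (measure_pmf \<eta>) {x\<in>space (measure_pmf \<eta>). take n (J x) = K} =
          measure N {y\<in>space N. take n (pre m y) = K}"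
        by (rule prob_comp_cong[OF measure_pmf.prob_space_axioms N.prob_space_axioms _ N.simple_function_pre' finite_words[of m]])
           (use sJ[of m] in \<open>auto simp: J_def[abs_def] prob_J[unfolded J_def] \<nu>_def\<close>)
      then show ?thesis by (simp add: t1 t2[symmetric])
    qed
    then show ?thesis
      by (subst (1 2) ent_superset[of ?C]) (auto simp: finite_words)
  qed
  have inj: "inj_on (\<lambda>x. (pre n x, J x)) S" using S(3) by (simp add: J_def)
  have fin_pair: "finite (range (\<lambda>x. (pre n x, J x)))"
    by (rule finite_subset[of _ "{I. length I = n} \<times> ?B"]) (auto simp: finite_words J_def)
  have ent_pair: "ent (measure_pmf \<eta>) (\<lambda>x. (pre n x, J x)) = (\<Sum>x\<in>S. eta (q x))"
    using \<eta>(2) by (simp add: ent_pmf_inj[OF S(2) \<eta>(1) fin_pair inj])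
  have energy: "measure_pmf.expectation \<eta> (trunc_log \<phi> k n) = (\<Sum>x\<in>S. q x * ln (W x))"
    using \<eta>(2) n by (simp add: expectation_finite_pmf[OF S(2) \<eta>(1)] W_def trunc_log_def t_def)
  have free: "cond_ent (measure_pmf \<eta>) (pre n) J + measure_pmf.expectation \<eta> (trunc_log \<phi> k n) = (\<Sum>K\<in>?B. \<nu> K * ln (Z K))"
  proof -
    have "eta (q x) + q x * ln (W x) = q x * (ln (Z (J x)) - ln (\<nu> (J x)))" for x
    proof (cases "\<nu> (J x) = 0")
      case False
      then have "0 < \<nu> (J x)" using \<nu>_nn[of "J x"] by simp
      then have "ln (q x) = ln (\<nu> (J x)) + ln (W x) - ln (Z (J x))"
        using W_pos[of x] Z_pos[OF False] by (simp add: q_def ln_div ln_mult)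
      then have "q x * ln (q x) = q x * ln (\<nu> (J x)) + q x * ln (W x) - q x * ln (Z (J x))"
        by (simp only: distrib_left right_diff_distrib)
      then show ?thesis by (simp add: eta_def right_diff_distrib)
    qed (simp add: q_def)
    then have "(\<Sum>x\<in>S. eta (q x)) + (\<Sum>x\<in>S. q x * ln (W x)) = (\<Sum>x\<in>S. q x * (ln (Z (J x)) - ln (\<nu> (J x))))"
      by (simp add: sum.distrib[symmetric])
    also have "\<dots> = (\<Sum>K\<in>?B. \<Sum>x\<in>{x\<in>S. J x = K}. q x * (ln (Z K) - ln (\<nu> K)))"
      unfolding group by (intro sum.cong) auto
    also have "\<dots> = (\<Sum>K\<in>?B. \<nu> K * (ln (Z K) - ln (\<nu> K)))"
      by (simp add: sum_distrib_right[symmetric] q_level)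
    also have "\<dots> = (\<Sum>K\<in>?B. \<nu> K * ln (Z K)) + (\<Sum>K\<in>?B. eta (\<nu> K))"
      by (simp add: eta_def sum.distrib[symmetric] right_diff_distrib)
    finally show ?thesis by (simp add: cond_ent_def ent_pair ent_J energy)
  qed
  \<comment> \<open>\<open>J\<close> sees the image up to \<open>m\<close>, but the entropy of
    \<open>N\<close> is wanted at length \<open>n\<close>. Conditioning on the shorter image prefix
    only increases the conditional entropy; that prefix is a function of \<open>pre n\<close>, so
    its entropy is simply subtracted.\<close>
  have "cond_ent (measure_pmf \<eta>) (pre n) J \<le> cond_ent (measure_pmf \<eta>) (pre n) (\<lambda>x. map p (pre n x))"
  proof (rule measure_pmf.cond_ent_mono)
    show "simple_function (measure_pmf \<eta>) J" using sJ[of m] by (simp add: J_def[abs_def])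
    fix x y :: "nat \<Rightarrow> 'a" assume "J x = J y"
    then show "map p (pre n x) = map p (pre n y)"
      unfolding J_def pre_seq_map[symmetric] using n(2) by (rule pre_eq_mono)
  qed (rule sn sJ)+
  also have "\<dots> = ent (measure_pmf \<eta>) (pre n) - ent N (pre n)"
  proof -
    have "ent (measure_pmf \<eta>) (\<lambda>x. (pre n x, map p (pre n x))) = ent (measure_pmf \<eta>) (pre n)"
      by (rule measure_pmf.ent_eq) (use sn sJ in auto)
    then show ?thesis by (simp add: cond_ent_def ent_Jn)
  qed
  finally have ent_ge: "cond_ent (measure_pmf \<eta>) (pre n) J \<le> ent (measure_pmf \<eta>) (pre n) - ent N (pre n)" .
  have "(\<integral>y. trunc_log ?\<psi> k n y \<partial>N) - 2 \<le> (\<Sum>K\<in>?B. \<nu> K * ln (Z K))"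
  proof -
    have Y: "compact (seq_map p ` X)"
      by (rule compact_continuous_image[OF continuous_on_seq_map X])
    have usc: "upper_semicontinuous_on X (\<phi> n)" using \<phi> n by (simp add: usc_subadditive_potential_def)
    have b: "?\<psi> n y \<le> ennreal (enn2real (word_sum X \<phi> n UNIV))" for y
      using word_sum_less_top[of X \<phi> n B UNIV] \<open>\<forall>x\<in>X. \<phi> n x \<le> ennreal B\<close> word_sum_mono[of _ UNIV X \<phi> n]
      by (simp add: fiber_sum_def)
    have int: "integrable N (\<lambda>y. trunc_ln t (?\<psi> n y))"
      by (rule N.integrable_trunc_ln[OF _ b])
         (rule N.borel_measurable_usc[OF Y fiber_sum_usc[where \<phi>=\<phi> and n=n, OF X usc]])
    have "(\<integral>y. trunc_log ?\<psi> k n y \<partial>N) - 2 = (\<integral>y. trunc_ln t (?\<psi> n y) - 2 \<partial>N)"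
      using int n by (simp add: trunc_log_def t_def N.prob_space)
    also have "\<dots> \<le> (\<integral>y. ln (Z (pre m y)) \<partial>N)"
    proof (rule integral_mono)
      show "integrable N (\<lambda>y. ln (Z (pre m y)))"
        by (rule N.integral_simple_comp(2)[OF N.simple_function_pre' finite_words]) auto
      fix y assume "y \<in> space N"
      from Z_ge'[OF this] have "ln (exp (trunc_ln t (?\<psi> n y) - 2)) \<le> ln (Z (pre m y))"
        by (intro ln_mono) auto
      then show "trunc_ln t (?\<psi> n y) - 2 \<le> ln (Z (pre m y))" by simp
    qed (use int in simp)
    also have "\<dots> = (\<Sum>K\<in>?B. ln (Z K) * \<nu> K)"
      unfolding \<nu>_def by (rule N.integral_simple_comp(1)[OF N.simple_function_pre' finite_words]) auto
    finally show ?thesis by (simp add: mult.commute)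
  qed
  then have "(\<integral>y. trunc_log ?\<psi> k n y \<partial>N) + ent N (pre n) - 2 \<le>
      measure_pmf.expectation \<eta> (trunc_log \<phi> k n) + ent (measure_pmf \<eta>) (pre n)"
    using free ent_ge by linarith
  moreover have "finite (set_pmf \<eta>)" using \<eta>(1) S(2) by (rule finite_subset)
  moreover have "set_pmf \<eta> \<subseteq> X" using \<eta>(1) S(1) by blast
  ultimately show ?thesis using prob_J by (intro exI[of _ \<eta>]) (simp add: J_def \<nu>_def)
qed

section \<open>Limits of averaged measures\<close>

definition shift_average :: "nat \<Rightarrow> (nat \<Rightarrow> 'a) pmf \<Rightarrow> (nat \<Rightarrow> 'a) pmf" where
  "shift_average n \<eta> = bind_pmf (pmf_of_set {..<n}) (\<lambda>i. map_pmf (left_shift ^^ i) \<eta>)"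

lemma expectation_shift_average:
  fixes f :: "(nat \<Rightarrow> 'a) \<Rightarrow> real"
  assumes "finite (set_pmf \<eta>)" "1 \<le> n"
  shows "measure_pmf.expectation (shift_average n \<eta>) f =
    (\<Sum>i<n. measure_pmf.expectation \<eta> (\<lambda>x. f ((left_shift ^^ i) x))) / real n"
proof -
  have ne: "{..<n} \<noteq> {}" using assms(2) by (auto simp: lessThan_empty_iff)
  have "measure_pmf.expectation (shift_average n \<eta>) f =
      (\<Sum>i<n. measure_pmf.expectation (map_pmf (left_shift ^^ i) \<eta>) f /\<^sub>R real (card {..<n}))"
    unfolding shift_average_def
    by (rule pmf_expectation_bind_pmf_of_set) (use ne assms in auto)
  then show ?thesis by (simp add: divide_inverse mult.commute sum_distrib_left)
qed

lemma prob_shift_average: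
  assumes "finite (set_pmf \<eta>)" "1 \<le> n"
  shows "measure_pmf.prob (shift_average n \<eta>) A =
    (\<Sum>i<n. measure_pmf.prob \<eta> {x. (left_shift ^^ i) x \<in> A}) / real n"
proof -
  have "measure_pmf.prob (shift_average n \<eta>) A = measure_pmf.expectation (shift_average n \<eta>) (indicator A)"
    by simp
  also have "\<dots> = (\<Sum>i<n. measure_pmf.expectation \<eta> (\<lambda>x. indicator A ((left_shift ^^ i) x))) / real n"
    by (rule expectation_shift_average[OF assms])
  also have "(\<lambda>i. measure_pmf.expectation \<eta> (\<lambda>x. indicator A ((left_shift ^^ i) x))) =
      (\<lambda>i. measure_pmf.prob \<eta> {x. (left_shift ^^ i) x \<in> A})"
  proof
    fix i
    have "(\<lambda>x. indicator A ((left_shift ^^ i) x) :: real) = indicator {x. (left_shift ^^ i) x \<in> A}"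
      by (simp add: fun_eq_iff indicator_def)
    then show "measure_pmf.expectation \<eta> (\<lambda>x. indicator A ((left_shift ^^ i) x)) =
        measure_pmf.prob \<eta> {x. (left_shift ^^ i) x \<in> A}" by simp
  qed
  finally show ?thesis .
qed

lemma set_shift_average:
  assumes "set_pmf \<eta> \<subseteq> X" "left_shift ` X \<subseteq> X" "1 \<le> n"
  shows "set_pmf (shift_average n \<eta>) \<subseteq> X"
proof -
  have "(left_shift ^^ i) x \<in> X" if "x \<in> X" for i x using assms(2) that by (induction i) auto
  moreover have "{..<n} \<noteq> {}" using assms(3) by (auto simp: lessThan_empty_iff)
  ultimately show ?thesis using assms(1) by (auto simp: shift_average_def)
qed

lemma shift_average_almost_invariant:
  assumes "finite (set_pmf \<eta>)" "1 \<le> n"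
  shows "\<bar>measure_pmf.prob (shift_average n \<eta>) {x. left_shift x \<in> A} - measure_pmf.prob (shift_average n \<eta>) A\<bar> \<le> 1 / real n"
proof -
  define g where "g i = measure_pmf.prob \<eta> {x. (left_shift ^^ i) x \<in> A}" for i
  have "measure_pmf.prob \<eta> {x. (left_shift ^^ i) x \<in> {x. left_shift x \<in> A}} = g (Suc i)" for i
    by (simp add: g_def)
  then have "measure_pmf.prob (shift_average n \<eta>) {x. left_shift x \<in> A} - measure_pmf.prob (shift_average n \<eta>) A
      = (\<Sum>i<n. g (Suc i) - g i) / real n"
    unfolding prob_shift_average[OF assms] by (simp add: g_def[symmetric] sum_subtractf diff_divide_distrib)
  also have "\<dots> = (g n - g 0) / real n" by (simp add: sum_lessThan_telescope)
  finally have "measure_pmf.prob (shift_average n \<eta>) {x. left_shift x \<in> A} - measure_pmf.prob (shift_average n \<eta>) A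
      = (g n - g 0) / real n" .
  moreover have "\<bar>g n - g 0\<bar> \<le> 1"
    using measure_pmf.prob_le_1[of \<eta>] measure_nonneg[of \<eta>] unfolding g_def by (smt (verit))
  ultimately show ?thesis by (simp add: divide_right_mono)
qed

text \<open>Misiurewicz's estimate without residue classes. Entropies of segments form a
  sub-additive array whose short entries are at most \<open>l * ln CARD('a)\<close>, so
  \<open>subadditive_block_bound\<close> compares the whole word with all its blocks of length
  \<open>l\<close>. Concavity of \<open>eta\<close> then replaces the average of the block entropies
  by the entropy of the averaged law.\<close>

lemma ent_shift_average:
  fixes \<eta> :: "(nat \<Rightarrow> 'a::finite) pmf"
  assumes fin: "finite (set_pmf \<eta>)" and n: "1 \<le> n" and l: "1 \<le> l" "l \<le> n"
  shows "real l * ent (measure_pmf \<eta>) (pre n) \<le>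
    real n * ent (measure_pmf (shift_average n \<eta>)) (pre l) + 3 * real l * (real l * ln CARD('a))"
proof -
  define seg where "seg s t = (\<lambda>x :: nat \<Rightarrow> 'a. pre (t - s) ((left_shift ^^ s) x))" for s t :: nat
  define a where "a s t = ent (measure_pmf \<eta>) (seg s t)" for s t
  have fr: "finite (range (seg s t))" for s t
    unfolding seg_def by (rule finite_subset[OF _ finite_words[of "t - s"]]) auto
  have sf: "simple_function (measure_pmf \<eta>) (seg s t)" for s t by (rule simple_function_pmf[OF fr])
  have seg_iff: "seg s t x = seg s t y \<longleftrightarrow> (\<forall>i\<in>{s..<t}. x i = y i)" for s t x y
  proof -
    have "seg s t x = seg s t y \<longleftrightarrow> (\<forall>i<t - s. x (s + i) = y (s + i))"
      by (simp add: seg_def pre_eq_iff shift_pow_apply)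
    also have "\<dots> \<longleftrightarrow> (\<forall>i\<in>{s..<t}. x i = y i)"
    proof (intro iffI ballI allI impI)
      fix i assume h: "\<forall>i<t - s. x (s + i) = y (s + i)" "i \<in> {s..<t}"
      show "x i = y i" using h(1)[rule_format, of "i - s"] h(2) by auto
    qed auto
    finally show ?thesis .
  qed
  have "real l * a 0 n \<le> (\<Sum>i<n. a i (i + l)) + 3 * real l * (real l * ln CARD('a))"
  proof (rule subadditive_block_bound)
    fix s t u :: nat assume "s \<le> t" "t \<le> u"
    have "a s u \<le> ent (measure_pmf \<eta>) (\<lambda>x. (seg s t x, seg t u x))"
      unfolding a_def
    proof (rule measure_pmf.ent_mono)
      fix x y :: "nat \<Rightarrow> 'a" assume "(seg s t x, seg t u x) = (seg s t y, seg t u y)"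
      then have "\<forall>i\<in>{s..<t}. x i = y i" "\<forall>i\<in>{t..<u}. x i = y i" by (simp_all add: seg_iff)
      then show "seg s u x = seg s u y" unfolding seg_iff by (metis atLeastLessThan_iff not_le)
    qed (use sf in auto)
    also have "\<dots> \<le> a s t + a t u" unfolding a_def by (rule measure_pmf.ent_Pair_le) (rule sf)+
    finally show "a s u \<le> a s t + a t u" .
  next
    fix s t :: nat assume st: "s \<le> t" "t \<le> s + l"
    have "a s t \<le> ln (real (card {I :: 'a list. length I = t - s}))"
      unfolding a_def by (rule measure_pmf.ent_le_ln_card[OF sf finite_words]) (auto simp: seg_def)
    also have "\<dots> = real (t - s) * ln CARD('a)" by (simp add: card_words ln_realpow)
    also have "\<dots> \<le> real l * ln CARD('a)" using st by (intro mult_right_mono) auto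
    finally show "\<bar>a s t\<bar> \<le> real l * ln CARD('a)" using measure_pmf.ent_nonneg[of \<eta> "seg s t"] by (simp add: a_def)
  qed (rule l)
  also have "a 0 n = ent (measure_pmf \<eta>) (pre n)"
    by (simp add: a_def seg_def[abs_def])
  also have "(\<Sum>i<n. a i (i + l)) \<le> real n * ent (measure_pmf (shift_average n \<eta>)) (pre l)"
  proof -
    let ?A = "{I :: 'a list. length I = l}"
    define P where "P i I = measure_pmf.prob \<eta> {x. pre l ((left_shift ^^ i) x) = I}" for i I
    have avg: "measure_pmf.prob (shift_average n \<eta>) {x. pre l x = I} = (\<Sum>i<n. 1 / real n * P i I)" for I
      using prob_shift_average[OF fin n, of "{x. pre l x = I}"] by (simp add: P_def sum_divide_distrib)
    have a_eq: "a i (i + l) = (\<Sum>I\<in>?A. eta (P i I))" for i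
      unfolding a_def by (subst ent_superset[OF finite_words[of l]]) (auto simp: seg_def P_def)
    have "(\<Sum>i<n. 1 / real n * a i (i + l)) = (\<Sum>I\<in>?A. \<Sum>i<n. 1 / real n * eta (P i I))"
      unfolding a_eq sum_distrib_left by (rule sum.swap)
    also have "\<dots> \<le> (\<Sum>I\<in>?A. eta (\<Sum>i<n. 1 / real n * P i I))"
      using n by (intro sum_mono eta_concave) (auto simp: P_def)
    also have "\<dots> = ent (measure_pmf (shift_average n \<eta>)) (pre l)"
      by (subst ent_superset[OF finite_words[of l]]) (auto simp: avg)
    finally have "(\<Sum>i<n. a i (i + l)) / real n \<le> ent (measure_pmf (shift_average n \<eta>)) (pre l)"
      by (simp add: sum_divide_distrib)
    then show ?thesis using n by (simp add: field_simps)
  qed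
  finally show ?thesis by simp
qed

text \<open>\<open>subadditive_block_bound\<close> along each orbit, then integrated. The order of
  the quantifiers matters: \<open>K\<close> may depend on \<open>k\<close> and \<open>l\<close>, as
  it is later divided by \<open>n\<close>, while \<open>C\<close> must be common to all
  \<open>l\<close> because only division by \<open>l\<close> removes it.\<close>

lemma trunc_log_shift_average:
  fixes X :: "(nat \<Rightarrow> 'a::{finite, discrete_topology}) set"
  assumes X: "subshift X" and \<phi>: "usc_subadditive_potential X \<phi>"
  shows "\<exists>C. \<forall>k l. 1 \<le> l \<longrightarrow> (\<exists>K. \<forall>n \<eta>. l \<le> n \<longrightarrow> finite (set_pmf \<eta>) \<longrightarrow> set_pmf \<eta> \<subseteq> X \<longrightarrow>
    real l * measure_pmf.expectation \<eta> (trunc_log \<phi> k n) \<le>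
      real n * (measure_pmf.expectation (shift_average n \<eta>) (trunc_log \<phi> k l) + C) + K)"
proof -
  have comp: "compact X" and shift: "left_shift ` X \<subseteq> X" using X by (auto simp: subshift_def)
  obtain C where C: "0 \<le> C" and sub: "\<forall>k m n. \<forall>x\<in>X.
      trunc_log \<phi> k (m + n) x \<le> C + trunc_log \<phi> k m x + trunc_log \<phi> k n ((left_shift ^^ m) x)"
    using trunc_log_subadditive[OF \<phi> shift] by (elim exE conjE)
  have SX: "(left_shift ^^ i) x \<in> X" if "x \<in> X" for i x using shift that by (induction i) auto
  show ?thesis
  proof (rule exI[of _ C], intro allI impI)
    fix k l :: nat assume l: "1 \<le> l"
    have "\<forall>j. \<exists>b\<ge>0. \<forall>x\<in>X. \<bar>trunc_log \<phi> k j x\<bar> \<le> b" using trunc_log_bounded[OF comp \<phi>] by blast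
    from choice[OF this] obtain b where b: "\<And>j. 0 \<le> b j" "\<And>j x. x \<in> X \<Longrightarrow> \<bar>trunc_log \<phi> k j x\<bar> \<le> b j" by blast
    define K where "K = C + (\<Sum>j\<le>l. b j)"
    have "0 \<le> K" using C b by (simp add: K_def sum_nonneg)
    have pt: "real l * (trunc_log \<phi> k n x + C) \<le> (\<Sum>i<n. trunc_log \<phi> k l ((left_shift ^^ i) x) + C) + 3 * real l * K"
      if x: "x \<in> X" and n: "l \<le> n" for x n
    proof -
      define a where "a s t = trunc_log \<phi> k (t - s) ((left_shift ^^ s) x) + C" for s t :: nat
      have "real l * a 0 n \<le> (\<Sum>i<n. a i (i + l)) + 3 * real l * K"
      proof (rule subadditive_block_bound[OF _ _ n])
        fix s t u :: nat assume st: "s \<le> t" "t \<le> u"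
        have "(left_shift ^^ (t - s)) ((left_shift ^^ s) x) = (left_shift ^^ t) x"
          using st by (intro ext) (simp add: shift_pow_apply)
        then show "a s u \<le> a s t + a t u"
          using sub[rule_format, OF SX[OF x], of k "t - s" "u - t" s] st by (simp add: a_def)
      next
        fix s t :: nat assume st: "s \<le> t" "t \<le> s + l"
        have "b (t - s) \<le> (\<Sum>j\<le>l. b j)" using st b by (intro member_le_sum) auto
        then show "\<bar>a s t\<bar> \<le> K" using b(2)[OF SX[OF x], of "t - s" s] C by (simp add: a_def K_def)
      qed
      then show ?thesis by (simp add: a_def)
    qed
    show "\<exists>K. \<forall>n \<eta>. l \<le> n \<longrightarrow> finite (set_pmf \<eta>) \<longrightarrow> set_pmf \<eta> \<subseteq> X \<longrightarrow>
        real l * measure_pmf.expectation \<eta> (trunc_log \<phi> k n) \<le>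
        real n * (measure_pmf.expectation (shift_average n \<eta>) (trunc_log \<phi> k l) + C) + K"
    proof (intro exI[of _ "3 * real l * K"] allI impI)
      fix n and \<eta> :: "(nat \<Rightarrow> 'a) pmf"
      assume n: "l \<le> n" and fin: "finite (set_pmf \<eta>)" and sub: "set_pmf \<eta> \<subseteq> X"
      have int: "integrable (measure_pmf \<eta>) f" for f :: "(nat \<Rightarrow> 'a) \<Rightarrow> real"
        using fin by (rule integrable_measure_pmf_finite)
      have n1: "1 \<le> n" using n l by simp
      have "real l * (measure_pmf.expectation \<eta> (trunc_log \<phi> k n) + C) =
          measure_pmf.expectation \<eta> (\<lambda>x. real l * (trunc_log \<phi> k n x + C))"
        using int by simp
      also have "\<dots> \<le> measure_pmf.expectation \<eta>
          (\<lambda>x. (\<Sum>i<n. trunc_log \<phi> k l ((left_shift ^^ i) x) + C) + 3 * real l * K)"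
      proof (rule integral_mono_AE[OF int int])
        show "AE x in measure_pmf \<eta>. real l * (trunc_log \<phi> k n x + C) \<le>
            (\<Sum>i<n. trunc_log \<phi> k l ((left_shift ^^ i) x) + C) + 3 * real l * K"
          using pt[OF _ n] sub by (auto simp: AE_measure_pmf_iff)
      qed
      also have "\<dots> = (\<Sum>i<n. measure_pmf.expectation \<eta> (\<lambda>x. trunc_log \<phi> k l ((left_shift ^^ i) x)) + C) + 3 * real l * K"
        using int by simp
      also have "(\<Sum>i<n. measure_pmf.expectation \<eta> (\<lambda>x. trunc_log \<phi> k l ((left_shift ^^ i) x)) + C) =
          real n * (measure_pmf.expectation (shift_average n \<eta>) (trunc_log \<phi> k l) + C)"
        using n1 by (simp add: expectation_shift_average[OF fin n1] sum.distrib field_simps)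
      finally have "real l * (measure_pmf.expectation \<eta> (trunc_log \<phi> k n) + C) \<le>
          real n * (measure_pmf.expectation (shift_average n \<eta>) (trunc_log \<phi> k l) + C) + 3 * real l * K" .
      moreover have "0 \<le> real l * C" using C by simp
      ultimately show "real l * measure_pmf.expectation \<eta> (trunc_log \<phi> k n) \<le>
          real n * (measure_pmf.expectation (shift_average n \<eta>) (trunc_log \<phi> k l) + C) + 3 * real l * K"
        by (simp add: distrib_left)
    qed
  qed
qed

section \<open>Equality and compactness of measures through cylinder masses\<close>

lemma sets_restrict_borel_seq:
  fixes X :: "(nat \<Rightarrow> 'a::{finite, discrete_topology}) set"
  shows "sets (restrict_space borel X) = sigma_sets X {X \<inter> C |C. \<exists>n. cyl_set n C}" (is "_ = sigma_sets X ?E")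
proof
  have "?E \<subseteq> sets (restrict_space borel X)"
    using open_cyl_set by (fastforce simp: sets_restrict_space)
  then show "sigma_sets X ?E \<subseteq> sets (restrict_space borel X)"
    using sets.sigma_sets_subset[of ?E "restrict_space borel X"] by (simp add: space_restrict_space)
  show "sets (restrict_space borel X) \<subseteq> sigma_sets X ?E"
  proof
    fix A assume "A \<in> sets (restrict_space borel X)"
    then obtain B where B: "B \<in> sigma_sets UNIV (range cylinder)" "A = X \<inter> B"
      by (auto simp: sets_restrict_space borel_seq_eq)
    have "X \<inter> B \<in> sigma_sets X ?E" using B(1)
    proof induction
      case (Basic a)
      then obtain I where "a = cylinder I" by auto
      then have "cyl_set (length I) a" by (auto simp: cyl_set_def in_cylinder_iff)
      then show ?case by (intro sigma_sets.Basic) auto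
    next
      case (Compl a)
      have "X \<inter> (UNIV - a) = X - X \<inter> a" by auto
      with Compl.IH show ?case by (simp add: sigma_sets.Compl)
    next
      case (Union a)
      have "X \<inter> (\<Union>i. a i) = (\<Union>i. X \<inter> a i)" by auto
      with Union.IH show ?case by (simp only: sigma_sets.Union)
    qed (simp add: sigma_sets.Empty)
    then show "A \<in> sigma_sets X ?E" by (simp only: B(2))
  qed
qed

lemma seq_prob_eqI:
  fixes X :: "(nat \<Rightarrow> 'a::{finite, discrete_topology}) set"
  assumes "seq_prob X M" "seq_prob X N"
    and eq: "\<And>n C. cyl_set n C \<Longrightarrow> measure M (X \<inter> C) = measure N (X \<inter> C)"
  shows "M = N"
proof -
  interpret M: seq_prob X M by fact
  interpret N: seq_prob X N by fact
  define E where "E = {X \<inter> C |C. \<exists>n. cyl_set n C}"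
  have XE: "X \<in> E" unfolding E_def
    by (rule CollectI, rule exI[of _ UNIV]) (auto simp: cyl_set_def)
  have sets_eq: "sets M = sigma_sets X E" "sets N = sigma_sets X E"
    by (simp_all add: M.sets_M N.sets_M sets_restrict_borel_seq E_def)
  show ?thesis
  proof (rule measure_eqI_generator_eq[where E=E and \<Omega>=X and A="\<lambda>_. X"])
    show "Int_stable E"
    proof (rule Int_stableI)
      fix a b assume "a \<in> E" "b \<in> E"
      then obtain C D m n where "a = X \<inter> C" "b = X \<inter> D" "cyl_set m C" "cyl_set n D" by (auto simp: E_def)
      moreover from this have "cyl_set (max m n) (C \<inter> D)" by (intro cyl_set_Int) (auto elim: cyl_set_mono)
      ultimately show "a \<inter> b \<in> E" unfolding E_def by (intro CollectI exI[of _ "C \<inter> D"]) blast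
    qed
    show "E \<subseteq> Pow X" by (auto simp: E_def)
    show "emeasure M A = emeasure N A" if "A \<in> E" for A
      using that eq by (auto simp: E_def M.emeasure_eq_measure N.emeasure_eq_measure)
  qed (use XE sets_eq M.emeasure_eq_measure in auto)
qed

lemma prob_cyl_set:
  fixes \<mu> :: "(nat \<Rightarrow> 'a::finite) pmf"
  assumes "cyl_set n C"
  shows "measure_pmf.prob \<mu> C = (\<Sum>I\<in>pre n ` C. measure_pmf.prob \<mu> {x. pre n x = I})"
proof -
  have fin: "finite (pre n ` C)" by (rule finite_subset[OF _ finite_words[of n]]) auto
  have "C = (\<Union>I\<in>pre n ` C. {x. pre n x = I})"
  proof (intro equalityI subsetI)
    fix x assume "x \<in> (\<Union>I\<in>pre n ` C. {x. pre n x = I})"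
    then obtain z where "z \<in> C" "pre n x = pre n z" by auto
    with cyl_setD[OF assms this(2)] show "x \<in> C" by simp
  qed auto
  then have "measure_pmf.prob \<mu> C = measure_pmf.prob \<mu> (\<Union>I\<in>pre n ` C. {x. pre n x = I})" by (rule arg_cong)
  also have "\<dots> = (\<Sum>I\<in>pre n ` C. measure_pmf.prob \<mu> {x. pre n x = I})"
    using fin by (intro measure_pmf.finite_measure_finite_Union) (auto simp: disjoint_family_on_def)
  finally show ?thesis .
qed

text \<open>Weak compactness by hand: along a subsequence the masses of all cylinders converge, the
  limits are finitely additive on the algebra of traces of cylinder sets on \<open>X\<close>, and
  Caratheodory's theorem extends them to a Borel measure.\<close>

lemma pmf_convergent_subsequence:
  fixes X :: "(nat \<Rightarrow> 'a::{finite, discrete_topology}) set"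
  assumes X: "compact X" and m: "\<And>k. set_pmf (m k) \<subseteq> X"
  shows "\<exists>r M. strict_mono (r :: nat \<Rightarrow> nat) \<and> seq_prob X M \<and>
    (\<forall>n C. cyl_set n C \<longrightarrow> (\<lambda>k. measure_pmf.prob (m (r k)) C) \<longlonglongrightarrow> measure M (X \<inter> C))"
proof -
  define f where "f k I = measure_pmf.prob (m k) (cylinder I)" for k and I :: "'a list"
  let ?K = "PiE UNIV (\<lambda>_ :: 'a list. {0..1 :: real})"
  \<comment> \<open>The words form a countable index set, so this compact cube is first countable
    and hence sequentially compact.\<close>
  have "compactin (product_topology (\<lambda>_. euclidean) UNIV) ?K" by (simp add: compactin_PiE)
  then have "compact ?K" by (simp add: euclidean_product_topology)
  then have "seq_compact ?K" by (rule compact_imp_seq_compact)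
  moreover have "f k \<in> ?K" for k by (simp add: f_def PiE_iff)
  ultimately obtain l r where r: "strict_mono r" and lim: "(f \<circ> r) \<longlonglongrightarrow> l"
    unfolding seq_compact_def by blast
  have lim_I: "(\<lambda>k. f (r k) I) \<longlonglongrightarrow> l I" for I
    using continuous_on_tendsto_compose[OF continuous_on_product_coordinates[of I] lim] by (simp add: comp_def)
  let ?p = "\<lambda>k A. measure_pmf.prob (m (r k)) A"
  have conv: "convergent (\<lambda>k. ?p k C)" if "cyl_set n C" for n C
  proof -
    have "(\<lambda>k. \<Sum>I\<in>pre n ` C. f (r k) I) \<longlonglongrightarrow> (\<Sum>I\<in>pre n ` C. l I)" by (intro tendsto_sum lim_I)
    moreover have "?p k C = (\<Sum>I\<in>pre n ` C. f (r k) I)" for k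
      unfolding prob_cyl_set[OF that] f_def by (intro sum.cong arg_cong2[where f=measure]) (auto simp: in_cylinder_iff)
    ultimately show ?thesis by (auto simp: convergent_def)
  qed
  have p_Int: "?p k (X \<inter> C) = ?p k C" for k C
    using m[of "r k"] by (intro measure_pmf.finite_measure_eq_AE) (auto simp: AE_measure_pmf_iff)
  define E where "E = {X \<inter> C |C. \<exists>n. cyl_set n C}"
  have E: "\<exists>n C. cyl_set n C \<and> A = X \<inter> C" if "A \<in> E" for A using that by (auto simp: E_def)
  define F where "F A = lim (\<lambda>k. ?p k A)" for A
  have F: "(\<lambda>k. ?p k A) \<longlonglongrightarrow> F A" if A: "A \<in> E" for A
  proof -
    obtain n C where "cyl_set n C" "A = X \<inter> C" using E[OF A] by blast
    then have "convergent (\<lambda>k. ?p k A)" using conv p_Int by simp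
    then show ?thesis by (simp add: F_def convergent_LIMSEQ_iff)
  qed
  have F_nn: "0 \<le> F A" if "A \<in> E" for A by (rule LIMSEQ_le_const[OF F[OF that]]) auto
  have F_empty: "F {} = 0" by (simp add: F_def)
  have XE: "X \<in> E" unfolding E_def by (rule CollectI, rule exI[of _ UNIV]) (auto simp: cyl_set_def)
  have alg: "algebra X E"
    unfolding algebra_iff_Un
  proof (intro conjI ballI)
    show "E \<subseteq> Pow X" by (auto simp: E_def)
    show "{} \<in> E" unfolding E_def by (rule CollectI, rule exI[of _ "{}"]) (auto simp: cyl_set_def)
    fix a assume "a \<in> E"
    then obtain m C where a: "cyl_set m C" "a = X \<inter> C" using E by blast
    have "X - a = X \<inter> - C" using a by auto
    with cyl_set_Compl[OF a(1)] show "X - a \<in> E" by (auto simp: E_def)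
    fix b assume "b \<in> E"
    then obtain n D where b: "cyl_set n D" "b = X \<inter> D" using E by blast
    have "cyl_set (max m n) (- (- C \<inter> - D))"
      using a(1) b(1) by (intro cyl_set_Compl cyl_set_Int) (auto intro: cyl_set_Compl elim: cyl_set_mono)
    moreover have "a \<union> b = X \<inter> - (- C \<inter> - D)" using a b by auto
    ultimately show "a \<union> b \<in> E" by (auto simp: E_def)
  qed
  interpret E: algebra X E by (rule alg)
  have F_add: "F (a \<union> b) = F a + F b" if "a \<in> E" "b \<in> E" "a \<inter> b = {}" for a b
  proof (rule LIMSEQ_unique[OF F])
    show "a \<union> b \<in> E" by (rule E.Un[OF that(1,2)])
    have "?p k (a \<union> b) = ?p k a + ?p k b" for k
      using that(3) by (intro measure_pmf.finite_measure_Union) auto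
    then show "(\<lambda>k. ?p k (a \<union> b)) \<longlonglongrightarrow> F a + F b" using tendsto_add[OF F[OF that(1)] F[OF that(2)]] by simp
  qed
  have "\<exists>\<mu>. (\<forall>s\<in>E. \<mu> s = ennreal (F s)) \<and> measure_space X (sigma_sets X E) \<mu>"
  proof (rule E.caratheodory_empty_continuous)
    show "positive E (\<lambda>s. ennreal (F s))" by (simp add: positive_def F_empty)
    show "Measure_Space.additive E (\<lambda>s. ennreal (F s))"
      unfolding Measure_Space.additive_def
    proof (intro ballI impI)
      fix a b assume ab: "a \<in> E" "b \<in> E" "a \<inter> b = {}"
      show "ennreal (F (a \<union> b)) = ennreal (F a) + ennreal (F b)"
        unfolding F_add[OF ab] by (rule ennreal_plus[OF F_nn[OF ab(1)] F_nn[OF ab(2)]])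
    qed
    fix A :: "nat \<Rightarrow> (nat \<Rightarrow> 'a) set"
    assume A: "range A \<subseteq> E" "decseq A" "(\<Inter>i. A i) = {}"
    \<comment> \<open>Members of the algebra are closed subsets of a compact set. A decreasing
      sequence of them with empty intersection is eventually empty, and continuity at the empty set
      becomes trivial.\<close>
    have "\<exists>i. A i = {}"
    proof (rule ccontr)
      assume "\<not> (\<exists>i. A i = {})"
      then have "A i \<noteq> {}" for i by blast
      moreover have "A i \<subseteq> X" for i using A(1) E.space_closed by blast
      ultimately have "X \<inter> A i \<noteq> {}" for i by (simp add: Int_absorb1)
      moreover have "closed (A i)" for i
      proof -
        have "A i \<in> E" using A(1) by blast
        from E[OF this] obtain n C where C: "cyl_set n C" "A i = X \<inter> C" by blast
        show ?thesis unfolding C(2) by (rule closed_Int[OF compact_imp_closed_seq[OF X] closed_cyl_set[OF C(1)]])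
      qed
      ultimately have "X \<inter> (\<Inter>i. A i) \<noteq> {}" by (intro compact_decseq_Int_nonempty[OF X _ A(2)])
      with A(3) show False by simp
    qed
    then obtain i where "A i = {}" by blast
    then have "A j = {}" if "i \<le> j" for j using decseqD[OF A(2) that] by simp
    then have "\<forall>\<^sub>F j in sequentially. ennreal (F (A j)) = 0"
      by (intro eventually_sequentiallyI[of i]) (simp add: F_empty)
    then show "(\<lambda>j. ennreal (F (A j))) \<longlonglongrightarrow> 0" by (rule tendsto_eventually)
  qed simp
  then obtain \<mu> where \<mu>: "\<And>s. s \<in> E \<Longrightarrow> \<mu> s = ennreal (F s)" "measure_space X (sigma_sets X E) \<mu>" by blast
  define M where "M = measure_of X (sigma_sets X E) \<mu>"
  have ss: "sigma_sets X (sigma_sets X E) = sigma_sets X E"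
    by (rule sigma_sets_sigma_sets_eq[OF E.space_closed])
  have sub: "sigma_sets X E \<subseteq> Pow X" by (intro subsetI PowI sigma_sets_into_sp[OF E.space_closed])
  have sets_M: "sets M = sigma_sets X E" unfolding M_def sets_measure_of[OF sub] by (rule ss)
  have em: "emeasure M A = \<mu> A" if "A \<in> sigma_sets X E" for A
    using \<mu>(2) unfolding M_def measure_space_def by (intro emeasure_measure_of_sigma that) blast+
  have em_E: "emeasure M A = ennreal (F A)" if "A \<in> E" for A
    using em[OF sigma_sets.Basic[OF that]] \<mu>(1)[OF that] by simp
  have "F X = 1"
  proof (rule LIMSEQ_unique[OF F[OF XE]])
    have "?p k X = 1" for k using p_Int[of k UNIV] by simp
    then show "(\<lambda>k. ?p k X) \<longlonglongrightarrow> 1" by simp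
  qed
  have space_M: "space M = X" unfolding M_def by (rule space_measure_of[OF sub])
  interpret prob_space M by standard (simp add: space_M em_E[OF XE] \<open>F X = 1\<close>)
  have "seq_prob X M"
    by unfold_locales (simp only: sets_M sets_restrict_borel_seq E_def)
  moreover have "(\<lambda>k. ?p k C) \<longlonglongrightarrow> measure M (X \<inter> C)" if "cyl_set n C" for n C
  proof -
    have XC: "X \<inter> C \<in> E" unfolding E_def using that by blast
    then have "measure M (X \<inter> C) = F (X \<inter> C)" using em_E[OF XC] F_nn[OF XC] by (simp add: measure_def)
    with F[OF XC] show ?thesis by (simp add: p_Int)
  qed
  ultimately show ?thesis using r by (intro exI[of _ r] exI[of _ M]) simp
qed

text \<open>Only the limit 0, where the logarithm is not continuous, requires an argument.\<close>

lemma eta_tendsto: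
  assumes "t \<longlonglongrightarrow> s" "\<And>k. 0 \<le> t k" "\<And>k. t k \<le> 1"
  shows "(\<lambda>k. eta (t k)) \<longlonglongrightarrow> eta s"
proof (cases "s = 0")
  case False
  then show ?thesis unfolding eta_def using assms(1) by (intro tendsto_intros)
next
  case True
  have "(\<lambda>k. eta (t k)) \<longlonglongrightarrow> 0"
  proof (rule order_tendstoI)
    fix a :: real assume "a < 0"
    moreover have "0 \<le> eta (t k)" for k by (rule eta_nonneg[OF assms(2,3)])
    ultimately show "\<forall>\<^sub>F k in sequentially. a < eta (t k)"
      by (intro always_eventually allI) (rule less_le_trans)
  next
    fix a :: real assume "0 < a"
    then have "0 < a / 2" by simp
    \<comment> \<open>The tangent of \<open>eta\<close> at \<open>a / 2\<close> has height
      \<open>a / 2\<close> over the origin, which is below \<open>a\<close>.\<close>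
    have "(\<lambda>k. a / 2 - t k - t k * ln (a / 2)) \<longlonglongrightarrow> a / 2 - 0 - 0 * ln (a / 2)"
      using assms(1) True by (intro tendsto_intros) simp_all
    then have "\<forall>\<^sub>F k in sequentially. a / 2 - t k - t k * ln (a / 2) < a"
      by (rule order_tendstoD(2)) (use \<open>0 < a\<close> in simp)
    then show "\<forall>\<^sub>F k in sequentially. eta (t k) < a"
      by eventually_elim (rule le_less_trans[OF eta_tangent[OF assms(2) \<open>0 < a / 2\<close>]])
  qed
  with True show ?thesis by simp
qed

lemma (in seq_prob) measure_pre_eq: "prob {x\<in>space M. P (pre l x)} = prob (X \<inter> {x. P (pre l x)})"
  by (intro arg_cong[where f=prob]) (auto simp: space_M)

lemma (in seq_prob) limits_of_pmf:
  assumes lim: "\<And>n C. cyl_set n C \<Longrightarrow> (\<lambda>k. measure_pmf.prob (\<mu> k) C) \<longlonglongrightarrow> measure M (X \<inter> C)"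
  shows ent_pmf_tendsto: "(\<lambda>k. ent (measure_pmf (\<mu> k)) (pre l)) \<longlonglongrightarrow> ent M (pre l)"
    and expectation_pmf_tendsto:
      "(\<lambda>k. measure_pmf.expectation (\<mu> k) (\<lambda>x. v (pre l x))) \<longlonglongrightarrow> (\<integral>x. v (pre l x) \<partial>M :: real)"
proof -
  let ?A = "{I :: 'a list. length I = l}"
  have lim_I: "(\<lambda>k. measure_pmf.prob (\<mu> k) {x. pre l x = I}) \<longlonglongrightarrow> prob {x\<in>space M. pre l x = I}" for I
    unfolding measure_pre_eq[of "\<lambda>K. K = I" l] by (rule lim[OF cyl_set_Collect])
  have sf: "simple_function (measure_pmf (\<mu> k)) (pre l)" for k
    by (rule simple_function_pmf) (use finite_range_pre[of "\<lambda>I :: 'a list. I" l] in simp)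
  have "(\<lambda>k. \<Sum>I\<in>?A. eta (measure_pmf.prob (\<mu> k) {x. pre l x = I})) \<longlonglongrightarrow> (\<Sum>I\<in>?A. eta (prob {x\<in>space M. pre l x = I}))"
    by (intro tendsto_sum eta_tendsto lim_I) auto
  moreover have "ent (measure_pmf (\<mu> k)) (pre l) = (\<Sum>I\<in>?A. eta (measure_pmf.prob (\<mu> k) {x. pre l x = I}))" for k
    by (subst ent_superset[OF finite_words[of l]]) auto
  moreover have "ent M (pre l) = (\<Sum>I\<in>?A. eta (prob {x\<in>space M. pre l x = I}))"
    by (subst ent_superset[OF finite_words[of l]]) auto
  ultimately show "(\<lambda>k. ent (measure_pmf (\<mu> k)) (pre l)) \<longlonglongrightarrow> ent M (pre l)" by simp
  have "(\<lambda>k. \<Sum>I\<in>?A. v I * measure_pmf.prob (\<mu> k) {x. pre l x = I}) \<longlonglongrightarrow> (\<Sum>I\<in>?A. v I * prob {x\<in>space M. pre l x = I})"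
    by (intro tendsto_sum tendsto_mult_left lim_I)
  moreover have "measure_pmf.expectation (\<mu> k) (\<lambda>x. v (pre l x)) =
      (\<Sum>I\<in>?A. v I * measure_pmf.prob (\<mu> k) {x. pre l x = I})" for k
    by (subst measure_pmf.integral_simple_comp(1)[OF sf finite_words[of l]]) auto
  moreover have "(\<integral>x. v (pre l x) \<partial>M) = (\<Sum>I\<in>?A. v I * prob {x\<in>space M. pre l x = I})"
    using seq_prob.simple_function_pre[OF seq_prob_axioms, of "\<lambda>I. I" l]
    by (subst integral_simple_comp(1)[OF _ finite_words[of l]]) auto
  ultimately show "(\<lambda>k. measure_pmf.expectation (\<mu> k) (\<lambda>x. v (pre l x))) \<longlonglongrightarrow> (\<integral>x. v (pre l x) \<partial>M)"
    by simp
qed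

lemma (in seq_prob) seq_invariantI:
  assumes shift: "left_shift ` X \<subseteq> X"
    and inv: "\<And>n C. cyl_set n C \<Longrightarrow> prob (X \<inter> {x. left_shift x \<in> C}) = prob (X \<inter> C)"
  shows "seq_invariant X M"
proof -
  have "left_shift \<in> restrict_space borel X \<rightarrow>\<^sub>M restrict_space borel X"
    using shift by (intro measurable_restrict_space2 borel_measurable_continuous_on_restrict continuous_on_left_shift)
      (auto simp: space_restrict_space)
  then have T: "left_shift \<in> M \<rightarrow>\<^sub>M M" using measurable_cong_sets[OF sets_M sets_M] by simp
  interpret D: prob_space "distr M M left_shift" by (rule prob_space_distr[OF T])
  have "seq_prob X (distr M M left_shift)" by unfold_locales (simp add: sets_M)
  then have "distr M M left_shift = M"
  proof (rule seq_prob_eqI[OF _ seq_prob_axioms])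
    fix n and C :: "(nat \<Rightarrow> 'a) set" assume C: "cyl_set n C"
    have "X \<inter> C \<in> sets M" using open_cyl_set[OF C] by (auto intro: borel_Int_in_sets)
    then have "measure (distr M M left_shift) (X \<inter> C) = prob (left_shift -` (X \<inter> C) \<inter> space M)"
      by (rule measure_distr[OF T])
    also have "left_shift -` (X \<inter> C) \<inter> space M = X \<inter> {x. left_shift x \<in> C}" using shift by (auto simp: space_M)
    finally show "measure (distr M M left_shift) (X \<inter> C) = prob (X \<inter> C)" by (simp add: inv[OF C])
  qed
  with shift show ?thesis by unfold_locales
qed

context seq_invariant
begin

lemma prob_pre_shift_pow: "prob {x\<in>space M. pre l ((left_shift ^^ i) x) = I} = prob {x\<in>space M. pre l x = I}"
proof -
  have "{x\<in>space M. pre l x = I} \<in> sets M" by (rule simple_function_level_set[OF simple_function_pre'])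
  then have "measure (distr M M (left_shift ^^ i)) {x\<in>space M. pre l x = I} =
      prob ((left_shift ^^ i) -` {x\<in>space M. pre l x = I} \<inter> space M)"
    by (rule measure_distr[OF measurable_shift_pow])
  also have "(left_shift ^^ i) -` {x\<in>space M. pre l x = I} \<inter> space M = {x\<in>space M. pre l ((left_shift ^^ i) x) = I}"
    using shift_pow_X by (auto simp: space_M)
  finally show ?thesis by (simp add: distr_shift_pow)
qed

lemma push_id: "push (\<lambda>a. a) = M"
proof -
  have "seq_map (\<lambda>a :: 'a. a) = (\<lambda>x. x)" by (simp add: seq_map_def fun_eq_iff)
  then show ?thesis unfolding push_def using sets_M by (simp add: distr_id2)
qed

text \<open>For \<open>i < n\<close> the window of length \<open>l\<close> starting at
  \<open>i\<close> ends within the first \<open>2 * n\<close> coordinates, where the image of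
  \<open>\<eta>\<close> has the law of \<open>M\<close>; invariance of \<open>M\<close> then removes
  the shift. The average thus projects exactly onto \<open>M\<close> for words of length up to
  \<open>n\<close>, with no error term.\<close>

lemma prob_shift_average_factor:
  fixes \<eta> :: "(nat \<Rightarrow> 'b::finite) pmf"
  assumes fin: "finite (set_pmf \<eta>)" and n: "1 \<le> n" "l \<le> n"
    and \<eta>: "\<And>J. length J = 2 * n \<Longrightarrow> measure_pmf.prob \<eta> {x. map p (pre (2 * n) x) = J} = prob {y\<in>space M. pre (2 * n) y = J}"
  shows "measure_pmf.prob (shift_average n \<eta>) {x. map p (pre l x) = J} = prob {y\<in>space M. pre l y = J}"
proof -
  have "measure_pmf.prob \<eta> {x. map p (pre l ((left_shift ^^ i) x)) = J} = prob {y\<in>space M. pre l y = J}" if i: "i < n" for i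
  proof -
    have dt: "pre l ((left_shift ^^ i) y) = take l (drop i (pre (2 * n) y))" for y :: "nat \<Rightarrow> 'c"
      using i n by (intro nth_equalityI) (auto simp: shift_pow_apply)
    have sf: "simple_function (measure_pmf \<eta>) (\<lambda>x. map p (pre (2 * n) x))"
      by (rule simple_function_pmf[OF finite_range_pre])
    have "measure (measure_pmf \<eta>) {x\<in>space (measure_pmf \<eta>). take l (drop i (map p (pre (2 * n) x))) = J} =
        prob {y\<in>space M. take l (drop i (pre (2 * n) y)) = J}"
      by (rule prob_comp_cong[OF measure_pmf.prob_space_axioms prob_space_axioms sf simple_function_pre' finite_words[of "2 * n"]])
         (auto simp: \<eta>)
    also have "\<dots> = prob {y\<in>space M. pre l y = J}"
      using prob_pre_shift_pow[of l i J] by (simp add: dt)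
    finally show ?thesis by (simp add: dt take_map drop_map)
  qed
  then show ?thesis using n by (simp add: prob_shift_average[OF fin n(1)])
qed

end

section \<open>The lower bound of the relative variational principle\<close>

text \<open>Krylov-Bogolyubov averaging of the measures from \<open>gibbs_approximation\<close>.
  Averaging brings invariance in the limit and keeps the projection; the inequality is proved for a
  fixed block length \<open>l\<close> and level \<open>j\<close> and divided by \<open>l\<close> at
  the very end.\<close>

theorem relative_lower_bound:
  fixes X :: "(nat \<Rightarrow> 'a::{finite, discrete_topology}) set" and p :: "'a \<Rightarrow> 'd::{finite, discrete_topology}"
  assumes X: "subshift X" and N: "seq_invariant (seq_map p ` X) N" and \<phi>: "usc_subadditive_potential X \<phi>"
    and fin: "potential_mean (fiber_sum X p \<phi>) N \<noteq> - \<infinity>"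
  shows "\<exists>M. seq_invariant X M \<and> seq_invariant.push X M p = N \<and>
    potential_mean (fiber_sum X p \<phi>) N + ereal (seq_invariant.entropy_rate N) \<le>
    potential_mean \<phi> M + ereal (seq_invariant.entropy_rate M)"
proof -
  interpret N: seq_invariant "seq_map p ` X" N by (rule N)
  let ?Y = "seq_map p ` X"
  let ?\<psi> = "fiber_sum X p \<phi>"
  have comp: "compact X" and shift: "left_shift ` X \<subseteq> X" using X by (auto simp: subshift_def)
  have compY: "compact ?Y" by (rule compact_continuous_image[OF continuous_on_seq_map comp])
  have \<psi>: "usc_subadditive_potential ?Y ?\<psi>" by (rule fiber_sum_usc_subadditive[OF X \<phi>])
  note mean_\<psi> = N.potential_mean_usc[OF compY \<psi>]
  obtain v where v: "potential_mean ?\<psi> N = ereal v"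
  proof -
    have "potential_mean ?\<psi> N \<le> ereal (trunc_mean ?\<psi> 0 N)" unfolding mean_\<psi> by (rule INF_lower) simp
    with fin that show thesis by (cases "potential_mean ?\<psi> N") auto
  qed
  have v_le: "v \<le> trunc_mean ?\<psi> k N" for k
  proof -
    have "potential_mean ?\<psi> N \<le> ereal (trunc_mean ?\<psi> k N)" unfolding mean_\<psi> by (rule INF_lower) simp
    then show ?thesis by (simp add: v)
  qed
  obtain D where D: "\<forall>k. \<forall>n\<ge>1. real n * trunc_mean ?\<psi> k N \<le> (\<integral>y. trunc_log ?\<psi> k n y \<partial>N) + D"
    using N.trunc_mean_le[OF compY \<psi>] by blast
  \<comment> \<open>Level and length are both \<open>n\<close>, so that the limit measure is chosen
    before any particular level is considered.\<close>
  let ?Q = "\<lambda>n \<eta>. finite (set_pmf \<eta>) \<and> set_pmf \<eta> \<subseteq> X \<and>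
    (\<forall>J. length J = 2 * n \<longrightarrow> measure_pmf.prob \<eta> {x. map p (pre (2 * n) x) = J} = measure N {y\<in>space N. pre (2 * n) y = J}) \<and>
    (\<integral>y. trunc_log ?\<psi> n n y \<partial>N) + ent N (pre n) - 2 \<le>
      measure_pmf.expectation \<eta> (trunc_log \<phi> n n) + ent (measure_pmf \<eta>) (pre n)"
  have "\<forall>k. \<exists>\<eta>. ?Q (Suc k) \<eta>"
    by (intro allI gibbs_approximation[OF N comp \<phi>]) auto
  from choice[OF this] obtain \<eta> where \<eta>: "\<forall>k. ?Q (Suc k) (\<eta> k)" ..
  define \<mu> where "\<mu> k = shift_average (Suc k) (\<eta> k)" for k
  have \<eta>_fin: "finite (set_pmf (\<eta> k))" and \<eta>_X: "set_pmf (\<eta> k) \<subseteq> X" for k using \<eta> by blast+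
  have \<mu>_X: "set_pmf (\<mu> k) \<subseteq> X" for k
    unfolding \<mu>_def by (rule set_shift_average[OF \<eta>_X shift]) simp
  from pmf_convergent_subsequence[where m=\<mu>, OF comp \<mu>_X] obtain r M where r: "strict_mono (r :: nat \<Rightarrow> nat)"
    and M: "seq_prob X M"
    and lim_all: "\<forall>n C. cyl_set n C \<longrightarrow> (\<lambda>k. measure_pmf.prob (\<mu> (r k)) C) \<longlonglongrightarrow> measure M (X \<inter> C)" by blast
  have lim: "(\<lambda>k. measure_pmf.prob (\<mu> (r k)) C) \<longlonglongrightarrow> measure M (X \<inter> C)" if "cyl_set n C" for n C
    using lim_all that by blast
  have r_lim: "filterlim r sequentially sequentially" by (rule filterlim_subseq[OF r])
  have div_lim: "(\<lambda>k. c / real (Suc (r k))) \<longlonglongrightarrow> 0" for c :: real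
    using filterlim_compose[OF filterlim_compose[OF real_div_const_tendsto_0[of c] filterlim_Suc] r_lim] .
  have r_ge: "\<forall>\<^sub>F k in sequentially. b \<le> Suc (r k)" for b
    using seq_suble[OF r] by (intro eventually_sequentiallyI[of b]) (metis le_SucI le_trans)

  interpret M: seq_prob X M by (rule M)
  have "seq_invariant X M"
  proof (rule M.seq_invariantI[OF shift])
    fix n and C :: "(nat \<Rightarrow> 'a) set" assume C: "cyl_set n C"
    have C': "cyl_set (Suc n) {x. left_shift x \<in> C}"
    proof (rule cyl_setI)
      fix x y :: "nat \<Rightarrow> 'a" assume xy: "pre (Suc n) x = pre (Suc n) y" "x \<in> {x. left_shift x \<in> C}"
      have "pre n (left_shift x) = pre n (left_shift y)" using xy(1) by (simp add: pre_eq_iff left_shift_def)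
      with cyl_setD[OF C this] xy(2) show "y \<in> {x. left_shift x \<in> C}" by simp
    qed
    have "(\<lambda>k. measure_pmf.prob (\<mu> (r k)) {x. left_shift x \<in> C} - measure_pmf.prob (\<mu> (r k)) C) \<longlonglongrightarrow>
        measure M (X \<inter> {x. left_shift x \<in> C}) - measure M (X \<inter> C)"
      by (intro tendsto_diff lim[OF C] lim[OF C'])
    moreover have "(\<lambda>k. measure_pmf.prob (\<mu> (r k)) {x. left_shift x \<in> C} - measure_pmf.prob (\<mu> (r k)) C) \<longlonglongrightarrow> 0"
    proof (rule Lim_null_comparison[OF _ div_lim[of 1]])
      show "\<forall>\<^sub>F k in sequentially. norm (measure_pmf.prob (\<mu> (r k)) {x. left_shift x \<in> C} -
          measure_pmf.prob (\<mu> (r k)) C) \<le> 1 / real (Suc (r k))"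
        unfolding \<mu>_def real_norm_def
        by (intro always_eventually allI shift_average_almost_invariant \<eta>_fin) simp
    qed
    ultimately have "measure M (X \<inter> {x. left_shift x \<in> C}) - measure M (X \<inter> C) = 0" by (rule LIMSEQ_unique)
    then show "measure M (X \<inter> {x. left_shift x \<in> C}) = measure M (X \<inter> C)" by simp
  qed
  then interpret M: seq_invariant X M .
  interpret P: seq_invariant ?Y "M.push p" by (rule M.seq_invariant_push)

  have push: "M.push p = N"
  proof (rule seq_prob_eqI[OF P.seq_prob_axioms N.seq_prob_axioms])
    fix l and C :: "(nat \<Rightarrow> 'd) set" assume C: "cyl_set l C"
    let ?C = "{x. map p (pre l x) \<in> pre l ` C}"
    have mem: "y \<in> C \<longleftrightarrow> pre l y \<in> pre l ` C" for y by (rule cyl_set_pre[OF C])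
    have "?Y \<inter> C \<in> sets (M.push p)" using open_cyl_set[OF C] by (auto intro: P.borel_Int_in_sets)
    then have "measure (M.push p) (?Y \<inter> C) = measure M (seq_map p -` (?Y \<inter> C) \<inter> space M)"
      unfolding M.push_def by (intro measure_distr M.measurable_seq_map) simp
    also have "seq_map p -` (?Y \<inter> C) \<inter> space M = X \<inter> ?C"
      unfolding pre_seq_map[symmetric] mem[symmetric] by (auto simp: M.space_M)
    finally have lhs: "measure (M.push p) (?Y \<inter> C) = measure M (X \<inter> ?C)" .
    \<comment> \<open>The image masses of words of length \<open>l\<close> are eventually constant
      along the sequence, not merely convergent.\<close>
    have "measure_pmf.prob (\<mu> (r k)) ?C = measure N (?Y \<inter> C)" if k: "l \<le> Suc (r k)" for k
    proof -
      have sf: "simple_function (measure_pmf (\<mu> (r k))) (\<lambda>x. map p (pre l x))"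
        by (rule simple_function_pmf[OF finite_range_pre])
      have eqJ: "measure_pmf.prob (\<mu> (r k)) {x. map p (pre l x) = J} = measure N {y\<in>space N. pre l y = J}" for J
        unfolding \<mu>_def
        by (rule N.prob_shift_average_factor[OF \<eta>_fin _ k]) (use \<eta> in auto)
      have "measure (measure_pmf (\<mu> (r k))) {x\<in>space (measure_pmf (\<mu> (r k))). (map p (pre l x) \<in> pre l ` C) = True} =
          measure N {y\<in>space N. (pre l y \<in> pre l ` C) = True}"
        by (rule prob_comp_cong[OF measure_pmf.prob_space_axioms N.prob_space_axioms sf N.simple_function_pre' finite_words[of l]])
           (auto simp: eqJ)
      also have "{y\<in>space N. (pre l y \<in> pre l ` C) = True} = ?Y \<inter> C"
        unfolding mem[symmetric] by (auto simp: N.space_M)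
      finally show ?thesis by simp
    qed
    then have "\<forall>\<^sub>F k in sequentially. measure_pmf.prob (\<mu> (r k)) ?C = measure N (?Y \<inter> C)"
      using r_ge[of l] by (auto elim: eventually_mono)
    then have "(\<lambda>k. measure_pmf.prob (\<mu> (r k)) ?C) \<longlonglongrightarrow> measure N (?Y \<inter> C)" by (rule tendsto_eventually)
    moreover have "(\<lambda>k. measure_pmf.prob (\<mu> (r k)) ?C) \<longlonglongrightarrow> measure M (X \<inter> ?C)"
      by (rule lim[OF cyl_set_Collect])
    ultimately show "measure (M.push p) (?Y \<inter> C) = measure N (?Y \<inter> C)"
      unfolding lhs by (rule LIMSEQ_unique[rotated])
  qed

  obtain C where C_all: "\<forall>k l. 1 \<le> l \<longrightarrow> (\<exists>K. \<forall>n \<eta>. l \<le> n \<longrightarrow> finite (set_pmf \<eta>) \<longrightarrow> set_pmf \<eta> \<subseteq> X \<longrightarrow>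
    real l * measure_pmf.expectation \<eta> (trunc_log \<phi> k n) \<le>
      real n * (measure_pmf.expectation (shift_average n \<eta>) (trunc_log \<phi> k l) + C) + K)"
    using trunc_log_shift_average[OF X \<phi>] ..
  have main: "real l * (v + N.entropy_rate) \<le> (\<integral>x. trunc_log \<phi> j l x \<partial>M) + C + ent M (pre l)"
    if l: "1 \<le> l" for l j
  proof -
    obtain K where K: "\<forall>n \<eta>. l \<le> n \<longrightarrow> finite (set_pmf \<eta>) \<longrightarrow> set_pmf \<eta> \<subseteq> X \<longrightarrow>
      real l * measure_pmf.expectation \<eta> (trunc_log \<phi> j n) \<le>
        real n * (measure_pmf.expectation (shift_average n \<eta>) (trunc_log \<phi> j l) + C) + K"
      using C_all l by blast
    define s where "s = real j * real l"
    \<comment> \<open>Collects the errors that survive division by the length: boundary terms of the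
      energy and of the entropy, the constant \<open>D\<close> of the truncated means, and the 2
      lost in the selection. None depends on the stage \<open>k\<close> or the depth
      \<open>L\<close>.\<close>
    define K' where "K' = K + 3 * real l * (real l * ln CARD('a)) + real l * (D + 2)"
    \<comment> \<open>The cylinder function that majorizes the truncated potential: with the
      identity as factor map, \<open>fiber_nbhd\<close> is the cylinder of depth \<open>L\<close>
      around \<open>x\<close>. Its expectations converge along the sequence, which could fail for
      the merely upper semicontinuous potential.\<close>
    let ?g = "\<lambda>L x. trunc_ln s (word_sum X \<phi> l (fiber_nbhd (\<lambda>a. a) x L))"
    have stage: "real l * (v + N.entropy_rate) \<le>
        measure_pmf.expectation (\<mu> k) (?g L) + C + ent (measure_pmf (\<mu> k)) (pre l) + K' / real (Suc k)"
      if k: "max l j \<le> Suc k" for k L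
    proof -
      let ?n = "Suc k"
      have int: "integrable (measure_pmf (\<eta> k)) f" for f :: "(nat \<Rightarrow> 'a) \<Rightarrow> real"
        by (rule integrable_measure_pmf_finite[OF \<eta>_fin])
      have \<mu>_fin: "finite (set_pmf (\<mu> k))" unfolding \<mu>_def shift_average_def using \<eta>_fin
        by (auto simp: lessThan_empty_iff)
      have "real ?n * v \<le> real ?n * trunc_mean ?\<psi> ?n N" by (intro mult_left_mono v_le) simp
      also have "\<dots> \<le> (\<integral>y. trunc_log ?\<psi> ?n ?n y \<partial>N) + D" by (rule D[rule_format]) simp
      finally have 1: "real ?n * v \<le> (\<integral>y. trunc_log ?\<psi> ?n ?n y \<partial>N) + D" .
      have 2: "N.entropy_rate * real ?n \<le> ent N (pre ?n)" by (rule N.entropy_rate_le) simp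
      have 3: "(\<integral>y. trunc_log ?\<psi> ?n ?n y \<partial>N) + ent N (pre ?n) - 2 \<le>
          measure_pmf.expectation (\<eta> k) (trunc_log \<phi> ?n ?n) + ent (measure_pmf (\<eta> k)) (pre ?n)" using \<eta> by blast
      \<comment> \<open>From level \<open>n\<close> to the fixed level \<open>j\<close>: truncating
        higher only raises the energy, as soon as \<open>j\<close> is at most
        \<open>n\<close>.\<close>
      have 4: "measure_pmf.expectation (\<eta> k) (trunc_log \<phi> ?n ?n) \<le> measure_pmf.expectation (\<eta> k) (trunc_log \<phi> j ?n)"
        using k by (intro integral_mono int trunc_log_antimono) simp
      have "real ?n * (v + N.entropy_rate) - (D + 2) \<le>
          measure_pmf.expectation (\<eta> k) (trunc_log \<phi> j ?n) + ent (measure_pmf (\<eta> k)) (pre ?n)"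
        using 1 2 3 4 by (simp only: distrib_left mult.commute[of N.entropy_rate])
      then have 5: "real l * (real ?n * (v + N.entropy_rate) - (D + 2)) \<le>
          real l * (measure_pmf.expectation (\<eta> k) (trunc_log \<phi> j ?n) + ent (measure_pmf (\<eta> k)) (pre ?n))"
        by (rule mult_left_mono) simp
      have 6: "real l * measure_pmf.expectation (\<eta> k) (trunc_log \<phi> j ?n) \<le>
          real ?n * (measure_pmf.expectation (\<mu> k) (trunc_log \<phi> j l) + C) + K"
        unfolding \<mu>_def using k by (intro K[rule_format] \<eta>_fin \<eta>_X) simp
      have 7: "real l * ent (measure_pmf (\<eta> k)) (pre ?n) \<le>
          real ?n * ent (measure_pmf (\<mu> k)) (pre l) + 3 * real l * (real l * ln CARD('a))"
        unfolding \<mu>_def using k l by (intro ent_shift_average \<eta>_fin) auto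
      have 8: "measure_pmf.expectation (\<mu> k) (trunc_log \<phi> j l) \<le> measure_pmf.expectation (\<mu> k) (?g L)"
      proof (rule integral_mono_AE)
        show "AE x in measure_pmf (\<mu> k). trunc_log \<phi> j l x \<le> ?g L x"
        proof (rule AE_pmfI)
          fix x assume "x \<in> set_pmf (\<mu> k)"
          then have "x \<in> X" using \<mu>_X by blast
          obtain B where "\<forall>x\<in>X. \<phi> l x \<le> ennreal B" using usc_potential_bounded[OF comp \<phi> l] by blast
          then have "word_sum X \<phi> l (fiber_nbhd (\<lambda>a. a) x L) < \<top>" by (intro word_sum_less_top) auto
          moreover have "\<phi> l x \<le> word_sum X \<phi> l (fiber_nbhd (\<lambda>a. a) x L)"
            using \<open>x \<in> X\<close> by (intro le_word_sum) (auto simp: fiber_nbhd_def)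
          ultimately show "trunc_log \<phi> j l x \<le> ?g L x"
            using l by (auto simp: trunc_log_def s_def intro: trunc_ln_mono)
        qed
      qed (rule integrable_measure_pmf_finite[OF \<mu>_fin])+
      have 9: "real ?n * measure_pmf.expectation (\<mu> k) (trunc_log \<phi> j l) \<le> real ?n * measure_pmf.expectation (\<mu> k) (?g L)"
        using 8 by (rule mult_left_mono) simp
      have "real ?n * (real l * (v + N.entropy_rate)) \<le>
          real ?n * (measure_pmf.expectation (\<mu> k) (?g L) + C + ent (measure_pmf (\<mu> k)) (pre l)) + K'"
        using 5 6 7 9
        by (simp only: K'_def distrib_left right_diff_distrib mult.left_commute[of "real ?n" "real l"])
      then show ?thesis by (simp add: field_simps del: of_nat_Suc)
    qed
    have step: "real l * (v + N.entropy_rate) \<le> (\<integral>x. ?g L x \<partial>M) + C + ent M (pre l)" for L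
    proof -
      have "(\<lambda>k. measure_pmf.expectation (\<mu> (r k)) (\<lambda>x. ?g L x)) \<longlonglongrightarrow> (\<integral>x. ?g L x \<partial>M)"
        unfolding fiber_nbhd_def
        by (rule M.expectation_pmf_tendsto[where \<mu>="\<lambda>k. \<mu> (r k)" and l=L and
            v="\<lambda>I. trunc_ln s (word_sum X \<phi> l {z. map (\<lambda>a. a) (pre L z) = I})"]) (erule lim)
      moreover have "(\<lambda>k. ent (measure_pmf (\<mu> (r k))) (pre l)) \<longlonglongrightarrow> ent M (pre l)"
        by (rule M.ent_pmf_tendsto[where \<mu>="\<lambda>k. \<mu> (r k)"]) (erule lim)
      ultimately have "(\<lambda>k. measure_pmf.expectation (\<mu> (r k)) (?g L) + C + ent (measure_pmf (\<mu> (r k))) (pre l) + K' / real (Suc (r k)))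
          \<longlonglongrightarrow> (\<integral>x. ?g L x \<partial>M) + C + ent M (pre l) + 0"
        by (intro tendsto_add tendsto_const div_lim)
      moreover have "\<forall>\<^sub>F k in sequentially. real l * (v + N.entropy_rate) \<le>
          measure_pmf.expectation (\<mu> (r k)) (?g L) + C + ent (measure_pmf (\<mu> (r k))) (pre l) + K' / real (Suc (r k))"
        using r_ge[of "max l j"] by (rule eventually_mono) (rule stage)
      ultimately have "real l * (v + N.entropy_rate) \<le> (\<integral>x. ?g L x \<partial>M) + C + ent M (pre l) + 0"
        by (rule tendsto_lowerbound) simp
      then show ?thesis by simp
    qed
    \<comment> \<open>Now the depth grows with the measure \<open>M\<close> fixed. The fibres of the
      identity are points, so the fibre sum in the limit is the potential itself.\<close>
    have "(\<lambda>L. (\<integral>x. ?g L x \<partial>M) + C + ent M (pre l)) \<longlonglongrightarrow>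
        (\<integral>x. trunc_ln s (fiber_sum X (\<lambda>a. a) \<phi> l x) \<partial>M) + C + ent M (pre l)"
      using M.integral_word_sum_tendsto[where p="\<lambda>a. a" and s=s, OF comp \<phi> l] unfolding M.push_id
      by (intro tendsto_add tendsto_const)
    from LIMSEQ_le_const[OF this] step
    have "real l * (v + N.entropy_rate) \<le> (\<integral>x. trunc_ln s (fiber_sum X (\<lambda>a. a) \<phi> l x) \<partial>M) + C + ent M (pre l)"
      by blast
    also have "(\<integral>x. trunc_ln s (fiber_sum X (\<lambda>a. a) \<phi> l x) \<partial>M) = (\<integral>x. trunc_log \<phi> j l x \<partial>M)"
    proof (rule Bochner_Integration.integral_cong[OF refl])
      fix x assume "x \<in> space M"
      then have x: "x \<in> X" by (simp add: M.space_M)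
      have "(SUP z\<in>X \<inter> ({z. pre l z = I} \<inter> {z. seq_map (\<lambda>a. a) z = x}). \<phi> l z) = (if I = pre l x then \<phi> l x else 0)" for I
      proof -
        have "X \<inter> ({z. pre l z = I} \<inter> {z. seq_map (\<lambda>a. a) z = x}) = (if I = pre l x then {x} else {})"
          using x by (auto simp: seq_map_def)
        then show ?thesis by (cases "I = pre l x") (simp, simp add: bot_ennreal)
      qed
      then have "fiber_sum X (\<lambda>a. a) \<phi> l x = \<phi> l x"
        by (simp add: fiber_sum_def word_sum_def sum.delta finite_words)
      then show "trunc_ln s (fiber_sum X (\<lambda>a. a) \<phi> l x) = trunc_log \<phi> j l x"
        using l by (simp add: trunc_log_def s_def)
    qed
    finally show ?thesis .
  qed
  have mean_ge: "v + N.entropy_rate \<le> trunc_mean \<phi> j M + M.entropy_rate" for j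
  proof -
    have lim1: "(\<lambda>l. (\<integral>x. trunc_log \<phi> j l x \<partial>M) / real l + C / real l + ent M (pre l) / real l)
        \<longlonglongrightarrow> trunc_mean \<phi> j M + 0 + M.entropy_rate"
      by (intro tendsto_add M.trunc_mean_tendsto[OF comp \<phi>] real_div_const_tendsto_0 M.entropy_rate_tendsto)
    have "\<exists>l0. \<forall>l\<ge>l0. v + N.entropy_rate \<le> (\<integral>x. trunc_log \<phi> j l x \<partial>M) / real l + C / real l + ent M (pre l) / real l"
    proof (intro exI[of _ 1] allI impI)
      fix l :: nat assume l: "1 \<le> l"
      from divide_right_mono[OF main[OF l, of j], of "real l"] l
      show "v + N.entropy_rate \<le> (\<integral>x. trunc_log \<phi> j l x \<partial>M) / real l + C / real l + ent M (pre l) / real l"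
        by (simp add: add_divide_distrib)
    qed
    from LIMSEQ_le_const[OF lim1 this] show ?thesis by simp
  qed
  have "ereal (v + N.entropy_rate - M.entropy_rate) \<le> potential_mean \<phi> M"
    unfolding M.potential_mean_usc[OF comp \<phi>]
  proof (rule INF_greatest)
    show "ereal (v + N.entropy_rate - M.entropy_rate) \<le> ereal (trunc_mean \<phi> j M)" for j
      using mean_ge[of j] by simp
  qed
  then have "potential_mean ?\<psi> N + ereal N.entropy_rate \<le> potential_mean \<phi> M + ereal M.entropy_rate"
    unfolding v by (cases "potential_mean \<phi> M") auto
  with push M.seq_invariant_axioms show ?thesis by blast
qed

section \<open>The variational principles\<close>

text \<open>Passing to an approximant within \<open>e / 2\<close> changes either mean by at most
  \<open>e / 2\<close>, since fibre sums preserve \<open>near\<close> with the same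
  constant.\<close>

lemma (in seq_invariant) relative_upper_bound_asymptotic:
  fixes p :: "'a \<Rightarrow> 'd::{finite, discrete_topology}"
  assumes X: "subshift X" and \<phi>: "usc_asymptotically_subadditive X \<phi>"
  shows "potential_mean \<phi> M + ks_entropy M left_shift \<le>
    potential_mean (fiber_sum X p \<phi>) (push p) + ks_entropy (push p) left_shift"
proof -
  interpret N: seq_invariant "seq_map p ` X" "push p" by (rule seq_invariant_push)
  have comp: "compact X" using X by (simp add: subshift_def)
  have compY: "compact (seq_map p ` X)" by (rule compact_continuous_image[OF continuous_on_seq_map comp])
  have \<psi>: "usc_asymptotically_subadditive (seq_map p ` X) (fiber_sum X p \<phi>)"
    by (rule fiber_sum_usc_asymptotically_subadditive[OF X \<phi>])
  show ?thesis
    unfolding ks_entropy_eq N.ks_entropy_eq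
  proof (rule ereal_le_epsilon2)
    fix e :: real assume "0 < e"
    then have e: "0 < e / 2" by simp
    with \<phi> obtain \<theta> where \<theta>: "usc_subadditive_potential X \<theta>" "near (e / 2) X \<phi> \<theta>"
      unfolding usc_asymptotically_subadditive_iff by blast
    have 1: "potential_mean \<phi> M \<le> potential_mean \<theta> M + ereal (e / 2)"
      using e by (intro potential_mean_near(1)[OF comp \<phi> \<theta>]) simp
    have 2: "potential_mean (fiber_sum X p \<theta>) (push p) \<le> potential_mean (fiber_sum X p \<phi>) (push p) + ereal (e / 2)"
      using e by (intro N.potential_mean_near(2)[OF compY \<psi> fiber_sum_usc_subadditive[OF X \<theta>(1)] near_fiber_sum[OF \<theta>(2)]]) simp
    from 1 2 relative_upper_bound[OF X \<theta>(1), of p]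
    show "potential_mean \<phi> M + ereal entropy_rate \<le>
        potential_mean (fiber_sum X p \<phi>) (push p) + ereal N.entropy_rate + ereal e"
      by (cases "potential_mean \<phi> M"; cases "potential_mean \<theta> M";
          cases "potential_mean (fiber_sum X p \<theta>) (push p)"; cases "potential_mean (fiber_sum X p \<phi>) (push p)") auto
  qed
qed

text \<open>The measure supplied by \<open>relative_lower_bound\<close> depends on the approximant
  and so on \<open>e\<close>, which still determines the supremum. When the fibre sum has mean
  -infinity the right side is -infinity as well, because entropy is finite.\<close>

theorem relative_variational_principle:
  fixes X :: "(nat \<Rightarrow> 'a::{finite, discrete_topology}) set" and p :: "'a \<Rightarrow> 'd::{finite, discrete_topology}"
  assumes X: "subshift X" and \<phi>: "usc_asymptotically_subadditive X \<phi>"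
    and N: "seq_invariant (seq_map p ` X) N"
  shows "(SUP M\<in>{M. seq_invariant X M \<and> seq_invariant.push X M p = N}. potential_mean \<phi> M + ks_entropy M left_shift) =
    potential_mean (fiber_sum X p \<phi>) N + ks_entropy N left_shift" (is "?S = ?R")
proof (rule antisym)
  show "?S \<le> ?R"
    by (rule SUP_least) (use seq_invariant.relative_upper_bound_asymptotic[OF _ X \<phi>] in blast)
  interpret N: seq_invariant "seq_map p ` X" N by (rule N)
  have comp: "compact X" using X by (simp add: subshift_def)
  have compY: "compact (seq_map p ` X)" by (rule compact_continuous_image[OF continuous_on_seq_map comp])
  have \<psi>: "usc_asymptotically_subadditive (seq_map p ` X) (fiber_sum X p \<phi>)"
    by (rule fiber_sum_usc_asymptotically_subadditive[OF X \<phi>])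
  show "?R \<le> ?S"
  proof (cases "potential_mean (fiber_sum X p \<phi>) N = - \<infinity>")
    case False
    show ?thesis
    proof (rule ereal_le_epsilon2)
      fix e :: real assume "0 < e"
      then have e: "0 < e / 2" by simp
      with \<phi> obtain \<theta> where \<theta>: "usc_subadditive_potential X \<theta>" "near (e / 2) X \<phi> \<theta>"
        unfolding usc_asymptotically_subadditive_iff by blast
      have 1: "potential_mean (fiber_sum X p \<phi>) N \<le> potential_mean (fiber_sum X p \<theta>) N + ereal (e / 2)"
        using e by (intro N.potential_mean_near(1)[OF compY \<psi> fiber_sum_usc_subadditive[OF X \<theta>(1)] near_fiber_sum[OF \<theta>(2)]]) simp
      with False have "potential_mean (fiber_sum X p \<theta>) N \<noteq> - \<infinity>" by auto
      from relative_lower_bound[OF X N \<theta>(1) this] obtain M where M: "seq_invariant X M" "seq_invariant.push X M p = N"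
        and 2: "potential_mean (fiber_sum X p \<theta>) N + ereal N.entropy_rate \<le>
          potential_mean \<theta> M + ereal (seq_invariant.entropy_rate M)" by blast
      interpret M: seq_invariant X M by (rule M(1))
      have 3: "potential_mean \<theta> M \<le> potential_mean \<phi> M + ereal (e / 2)"
        using e by (intro M.potential_mean_near(2)[OF comp \<phi> \<theta>]) simp
      have "?R \<le> potential_mean \<phi> M + ereal M.entropy_rate + ereal e"
        unfolding N.ks_entropy_eq using 1 2 3
        by (cases "potential_mean \<phi> M"; cases "potential_mean \<theta> M";
          cases "potential_mean (fiber_sum X p \<theta>) N"; cases "potential_mean (fiber_sum X p \<phi>) N") auto
      also have "potential_mean \<phi> M + ereal M.entropy_rate \<le> ?S"
        unfolding M.ks_entropy_eq[symmetric] by (rule SUP_upper) (use M in blast)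
      finally show "?R \<le> ?S + ereal e" by (simp add: add_right_mono)
    qed
  qed (simp add: N.ks_entropy_eq)
qed

lemma ereal_integral_const:
  assumes "prob_space M" "\<And>x. x \<in> space M \<Longrightarrow> f x = c"
  shows "ereal_integral M f = c"
proof -
  interpret prob_space M by fact
  have "(\<integral>\<^sup>+x. e2ennreal (f x) \<partial>M) = (\<integral>\<^sup>+x. e2ennreal c \<partial>M)"
    "(\<integral>\<^sup>+x. e2ennreal (- f x) \<partial>M) = (\<integral>\<^sup>+x. e2ennreal (- c) \<partial>M)"
    by (rule nn_integral_cong, simp add: assms(2))+
  then have "ereal_integral M f = enn2ereal (e2ennreal c) - enn2ereal (e2ennreal (- c))"
    by (simp add: ereal_integral_def emeasure_space_1)
  also have "\<dots> = c"
  proof (cases "0 \<le> c")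
    case True
    then show ?thesis by (simp add: enn2ereal_e2ennreal e2ennreal_neg zero_ennreal.rep_eq)
  next
    case False
    then show ?thesis by (simp add: enn2ereal_e2ennreal e2ennreal_neg zero_ennreal.rep_eq)
  qed
  finally show ?thesis .
qed

text \<open>The absolute variational principle is the relative one over a one-point factor.\<close>

theorem variational_principle:
  fixes Y :: "(nat \<Rightarrow> 'd::{finite, discrete_topology}) set"
  assumes Y: "subshift Y" and \<theta>: "usc_asymptotically_subadditive Y \<theta>"
  shows "(\<lambda>n. eln (word_sum Y \<theta> n UNIV) / ereal (real n)) \<longlonglongrightarrow> pressure Y \<theta>"
proof (cases "Y = {}")
  case True
  \<comment> \<open>For empty \<open>Y\<close> both sides are -infinity: a supremum over no
    measures, and \<open>eln 0\<close>.\<close>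
  have "invariant_measures Y = {}"
  proof -
    have "\<not> seq_invariant Y M" for M
    proof
      assume "seq_invariant Y M"
      then interpret seq_invariant Y M .
      show False using not_empty space_M True by simp
    qed
    then show ?thesis by (auto simp: invariant_measures_iff[OF Y])
  qed
  moreover have "eln (word_sum Y \<theta> n UNIV) / ereal (real n) = - \<infinity>" if "1 \<le> n" for n
    using that True by (simp add: word_sum_def bot_ennreal eln_def ereal_divide_eq)
  then have "\<forall>\<^sub>F n in sequentially. eln (word_sum Y \<theta> n UNIV) / ereal (real n) = - \<infinity>"
    by (intro eventually_sequentiallyI[of 1])
  ultimately show ?thesis by (simp add: pressure_def tendsto_eventually bot_ereal_def)
next
  case False
  \<comment> \<open>Collapsing all letters to one makes the image of \<open>Y\<close> a single fixed
    point of the shift.\<close>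
  define p :: "'d \<Rightarrow> 'd" where "p = (\<lambda>_. undefined)"
  define z :: "nat \<Rightarrow> 'd" where "z = (\<lambda>_. undefined)"
  have p_z: "seq_map p x = z" for x by (simp add: seq_map_def p_def z_def)
  have Z: "seq_map p ` Y = {z}" using False p_z by auto
  have shift_z: "left_shift z = z" by (simp add: left_shift_def z_def)
  \<comment> \<open>There is only one probability measure on a point, so every invariant measure of
    \<open>Y\<close> lies above it and the constraint in the relative principle is void.\<close>
  have uniq: "N = N'" if "seq_prob {z} N" "seq_prob {z} N'" for N N' :: "(nat \<Rightarrow> 'd) measure"
  proof (rule seq_prob_eqI[OF that])
    interpret N: seq_prob "{z}" N by fact
    interpret N': seq_prob "{z}" N' by fact
    fix n and C :: "(nat \<Rightarrow> 'd) set"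
    show "measure N ({z} \<inter> C) = measure N' ({z} \<inter> C)"
      using N.prob_space N'.prob_space by (cases "z \<in> C") (simp_all add: N.space_M N'.space_M)
  qed
  define N where "N = return (restrict_space borel {z}) z"
  have "prob_space N" unfolding N_def by (rule prob_space_return) (simp add: space_restrict_space)
  then interpret N: prob_space N .
  interpret N: seq_prob "{z}" N by unfold_locales (simp add: N_def)
  have inv: "seq_invariant {z} N"
  proof (rule N.seq_invariantI)
    show "N.prob ({z} \<inter> {x. left_shift x \<in> C}) = N.prob ({z} \<inter> C)" for C :: "(nat \<Rightarrow> 'd) set"
      using shift_z by (intro arg_cong[where f=N.prob]) auto
  qed (simp add: shift_z)
  then interpret N: seq_invariant "{z}" N .
  have "N.entropy_rate = 0"
  proof -
    have "ent N (pre n) = 0" for n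
      using N.ent_le_ln_card[OF N.simple_function_pre', of "{pre n z}" n] N.ent_nonneg[of "pre n"]
      by (simp add: N.space_M)
    then show ?thesis using LIMSEQ_unique[OF N.entropy_rate_tendsto, of 0] by simp
  qed
  then have ks: "ks_entropy N left_shift = 0" by (simp add: N.ks_entropy_eq zero_ereal_def)
  have compZ: "compact {z}" by simp
  have push: "seq_invariant.push Y M p = N" if "seq_invariant Y M" for M
  proof -
    interpret P: seq_invariant "seq_map p ` Y" "seq_invariant.push Y M p"
      by (rule seq_invariant.seq_invariant_push[OF that])
    show ?thesis using P.seq_prob_axioms N.seq_prob_axioms unfolding Z by (rule uniq)
  qed
  have "pressure Y \<theta> = (SUP M\<in>{M. seq_invariant Y M \<and> seq_invariant.push Y M p = N}. potential_mean \<theta> M + ks_entropy M left_shift)"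
    unfolding pressure_def by (intro SUP_cong) (auto simp: invariant_measures_iff[OF Y] push)
  also have "\<dots> = potential_mean (fiber_sum Y p \<theta>) N + ks_entropy N left_shift"
    by (rule relative_variational_principle[OF Y \<theta>]) (simp add: Z inv)
  finally have P: "pressure Y \<theta> = potential_mean (fiber_sum Y p \<theta>) N" by (simp add: ks)
  have "(\<lambda>n. ereal_integral N (\<lambda>y. eln (fiber_sum Y p \<theta> n y)) / ereal (real n)) \<longlonglongrightarrow> potential_mean (fiber_sum Y p \<theta>) N"
    by (rule N.potential_mean_tendsto[OF compZ fiber_sum_usc_asymptotically_subadditive[OF Y \<theta>]])
  moreover have "ereal_integral N (\<lambda>y. eln (fiber_sum Y p \<theta> n y)) = eln (word_sum Y \<theta> n UNIV)" for n
    by (rule ereal_integral_const[OF N.prob_space_axioms]) (simp add: N.space_M fiber_sum_def p_z)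
  ultimately show ?thesis by (simp add: P)
qed

lemma ereal_mult_cancel_pos:
  assumes "0 < c" shows "ereal c * (ereal (1 / c) * x) = x" "ereal (1 / c) * (ereal c * x) = x"
  using assms by (cases x; simp)+

text \<open>Fix \<open>M\<close> above \<open>N\<close>, with entropies \<open>h\<close> and
  \<open>g\<close>, and let \<open>u\<close>, \<open>v\<close> be the means of \<open>\<Phi>\<close>
  and \<open>\<psi>\<close>. The relative principle gives \<open>u + h \<le> v + g\<close>, and
  \<open>(a + b) * q = a\<close> turns \<open>a * (v + g) + b * g\<close> into
  \<open>(a + b) * (q * v + g)\<close>. Suprema over \<open>M\<close> and then over \<open>N\<close>
  yield the pressure formula; equality at both stages describes the equilibrium states.\<close>

theorem theorem1p1:
  fixes X :: "(nat \<Rightarrow> 'a::{finite, discrete_topology}) set"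
    and Y :: "(nat \<Rightarrow> 'd::{finite, discrete_topology}) set"
    and \<pi> :: "(nat \<Rightarrow> 'a) \<Rightarrow> (nat \<Rightarrow> 'd)"
    and a b :: real
    and \<phi> :: "'a potential"
    and \<psi> :: "'d potential"
  assumes "subshift X" and "subshift Y"
    and "factor_map X Y \<pi>" and "one_block X \<pi>"
    and "a > 0" and "b \<ge> 0"
    and "asymptotically_subadditive X \<phi>"
    and \<psi>_def: "\<psi> = fiber_potential X \<pi> a \<phi>"
  shows "usc_asymptotically_subadditive Y \<psi> \<and>
         usc_asymptotically_subadditive Y (scale_potential (a / (a + b)) \<psi>) \<and>
         weighted_pressure X Y \<pi> a b \<phi>
           = ereal (a + b) * pressure Y (scale_potential (a / (a + b)) \<psi>) \<and>
         (\<lambda>n. ereal ((a + b) / real n) *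
              eln (\<Sum>J\<in>{J. length J = n}. SUP y\<in>cylinder J \<inter> Y. epowr (\<psi> n y) (a / (a + b))))
           \<longlonglongrightarrow> weighted_pressure X Y \<pi> a b \<phi> \<and>
         (\<forall>\<mu>\<in>invariant_measures X.
           weighted_equilibrium_state X Y \<pi> a b \<phi> \<mu> \<longleftrightarrow>
             equilibrium_state Y (scale_potential (a / (a + b)) \<psi>) (push_measure Y \<pi> \<mu>) \<and>
             conditional_equilibrium_state X Y \<pi> (scale_potential (1 / a) \<phi>)
               (push_measure Y \<pi> \<mu>) \<mu>)"
proof -
  note X = assms(1) and Y = assms(2) and a = assms(5) and b = assms(6)
  have ab: "0 < a + b" using a b by simp
  define q where "q = a / (a + b)"
  have q: "0 < q" "(a + b) * q = a" using a ab by (simp_all add: q_def)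
  obtain p where p: "\<And>x. x \<in> X \<Longrightarrow> \<pi> x = seq_map p x"
    using assms(4) unfolding one_block_def seq_map_def by blast
  have Y_eq: "Y = seq_map p ` X" using assms(3) p unfolding factor_map_def by (metis image_cong)
  have compX: "compact X" and compY: "compact Y" and shiftX: "left_shift ` X \<subseteq> X" and shiftY: "left_shift ` Y \<subseteq> Y"
    using X Y by (auto simp: subshift_def)
  have \<phi>: "usc_asymptotically_subadditive X \<phi>" by (rule usc_asymptotically_subadditive[OF assms(7)])
  define \<Phi> where "\<Phi> = scale_potential (1 / a) \<phi>"
  have \<Phi>: "usc_asymptotically_subadditive X \<Phi>"
    unfolding \<Phi>_def using a by (intro scale_usc_asymptotically_subadditive \<phi> shiftX) simp
  have \<psi>_eq: "\<psi> = fiber_sum X p \<Phi>" unfolding \<psi>_def \<Phi>_def by (rule fiber_potential_eq[OF p])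
  have \<psi>: "usc_asymptotically_subadditive Y \<psi>"
    unfolding \<psi>_eq by (rule fiber_sum_usc_asymptotically_subadditive[OF X \<Phi>])
  define \<Theta> where "\<Theta> = scale_potential q \<psi>"
  have \<Theta>: "usc_asymptotically_subadditive Y \<Theta>"
    unfolding \<Theta>_def by (rule scale_usc_asymptotically_subadditive[OF q(1) \<psi> shiftY])
  note inv_X = invariant_measures_iff[OF X] and inv_Y = invariant_measures_iff[OF Y]

  have push: "push_measure Y \<pi> M = seq_invariant.push X M p" if "seq_invariant X M" for M
  proof -
    interpret seq_invariant X M by (rule that)
    show ?thesis unfolding push_measure_def push_def Y_eq
      by (intro distr_cong) (auto simp: space_M p)
  qed
  have push_inv: "seq_invariant Y (push_measure Y \<pi> M)" if "seq_invariant X M" for M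
    using seq_invariant.seq_invariant_push[OF that, of p] unfolding push[OF that] by (simp add: Y_eq)
  have h_real: "\<exists>h. ks_entropy M left_shift = ereal h" if "seq_invariant Z M"
    for Z :: "(nat \<Rightarrow> 'e::{finite, discrete_topology}) set" and M
    using seq_invariant.ks_entropy_eq[OF that] by blast
  have mean_\<phi>: "potential_mean \<phi> M = ereal a * potential_mean \<Phi> M" if "seq_invariant X M" for M
    using seq_invariant.potential_mean_scale[OF that compX \<phi>, of "1 / a"] a
    by (simp add: \<Phi>_def ereal_mult_cancel_pos(1)[OF a])
  have mean_\<Theta>: "potential_mean \<Theta> N = ereal q * potential_mean \<psi> N" if "seq_invariant Y N" for N
    unfolding \<Theta>_def by (rule seq_invariant.potential_mean_scale[OF that compY \<psi> q(1)])
  \<comment> \<open>Means may be -infinity but never infinity, and entropies are real, so the sums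
    below involve no infinities of opposite sign.\<close>
  have mean_\<Phi>_top: "potential_mean \<Phi> M \<noteq> \<infinity>" if "seq_invariant X M" for M
    using seq_invariant.potential_mean_less_top[OF that compX \<Phi>] by auto
  have mean_\<psi>_top: "potential_mean \<psi> N \<noteq> \<infinity>" if "seq_invariant Y N" for N
    using seq_invariant.potential_mean_less_top[OF that compY \<psi>] by auto
  have fibre_set: "{M \<in> invariant_measures X. push_measure Y \<pi> M = N} = {M. seq_invariant X M \<and> seq_invariant.push X M p = N}" for N
    using push by (auto simp: inv_X)
  have rvp: "(SUP M\<in>{M \<in> invariant_measures X. push_measure Y \<pi> M = N}. potential_mean \<Phi> M + ks_entropy M left_shift) =
      potential_mean \<psi> N + ks_entropy N left_shift" if "seq_invariant Y N" for N
    unfolding fibre_set \<psi>_eq by (rule relative_variational_principle[OF X \<Phi>]) (use that in \<open>simp add: Y_eq\<close>)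
  have rvp_le: "potential_mean \<Phi> M + ks_entropy M left_shift \<le>
      potential_mean \<psi> (push_measure Y \<pi> M) + ks_entropy (push_measure Y \<pi> M) left_shift" if M: "seq_invariant X M" for M
    unfolding rvp[OF push_inv[OF M], symmetric] by (rule SUP_upper) (use M in \<open>simp add: inv_X\<close>)

  define w where "w = weighted_pressure X Y \<pi> a b \<phi>"
  define P where "P = pressure Y \<Theta>"
  have W_le_w: "weighted_functional Y \<pi> a b \<phi> M \<le> w" if "seq_invariant X M" for M
    unfolding w_def weighted_pressure_def by (rule SUP_upper) (use that in \<open>simp add: inv_X\<close>)
  have E_le_P: "potential_mean \<Theta> N + ks_entropy N left_shift \<le> P" if "seq_invariant Y N" for N
    unfolding P_def pressure_def by (rule SUP_upper) (use that in \<open>simp add: inv_Y\<close>)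
  have W_le: "weighted_functional Y \<pi> a b \<phi> M \<le>
      ereal (a + b) * (potential_mean \<Theta> (push_measure Y \<pi> M) + ks_entropy (push_measure Y \<pi> M) left_shift)"
    if M: "seq_invariant X M" for M
  proof -
    let ?N = "push_measure Y \<pi> M"
    obtain h where h: "ks_entropy M left_shift = ereal h" using h_real[OF M] by blast
    obtain g where g: "ks_entropy ?N left_shift = ereal g" using h_real[OF push_inv[OF M]] by blast
    have le: "potential_mean \<Phi> M + ereal h \<le> potential_mean \<psi> ?N + ereal g" using rvp_le[OF M] by (simp add: h g)
    have "a * (u + h) + b * g \<le> (a + b) * (q * v + g)" if "u + h \<le> v + g" for u v
    proof -
      have "a * (u + h) \<le> a * (v + g)" using that a by (intro mult_left_mono) auto
      also have "a * (v + g) = ((a + b) * q) * v + a * g" by (simp add: q(2) distrib_left)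
      finally show ?thesis by (simp add: algebra_simps)
    qed
    with le show ?thesis
      unfolding weighted_functional_def mean_\<phi>[OF M] mean_\<Theta>[OF push_inv[OF M]] h g
      using a q(1) ab mean_\<Phi>_top[OF M] mean_\<psi>_top[OF push_inv[OF M]]
      by (cases "potential_mean \<Phi> M"; cases "potential_mean \<psi> ?N") (auto simp: distrib_left)
  qed
  have w_eq: "w = ereal (a + b) * P"
  proof (rule antisym)
    show "w \<le> ereal (a + b) * P"
      unfolding w_def weighted_pressure_def
    proof (rule SUP_least)
      fix M assume "M \<in> invariant_measures X"
      then have M: "seq_invariant X M" by (simp add: inv_X)
      show "weighted_functional Y \<pi> a b \<phi> M \<le> ereal (a + b) * P"
        using W_le[OF M] ereal_mult_left_mono[OF E_le_P[OF push_inv[OF M]], of "ereal (a + b)"] ab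
        by (simp add: order_trans)
    qed
    \<comment> \<open>The converse fixes \<open>N\<close> and bounds every \<open>M\<close> above it
      by \<open>w\<close>; the relative principle evaluates the supremum over these
      \<open>M\<close>. Solving for the means keeps \<open>w\<close> on the right, where it may
      still be infinite.\<close>
    have "P \<le> ereal (1 / (a + b)) * w"
      unfolding P_def pressure_def
    proof (rule SUP_least)
      fix N assume "N \<in> invariant_measures Y"
      then have N: "seq_invariant Y N" by (simp add: inv_Y)
      obtain g where g: "ks_entropy N left_shift = ereal g" using h_real[OF N] by blast
      have "potential_mean \<psi> N + ks_entropy N left_shift \<le> ereal (1 / a) * (w - ereal (b * g))"
        unfolding rvp[OF N, symmetric]
      proof (rule SUP_least)
        fix M assume "M \<in> {M \<in> invariant_measures X. push_measure Y \<pi> M = N}"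
        then have M: "seq_invariant X M" and MN: "push_measure Y \<pi> M = N" by (simp_all add: inv_X)
        obtain h where h: "ks_entropy M left_shift = ereal h" using h_real[OF M] by blast
        have "ereal a * potential_mean \<Phi> M + ereal a * ereal h + ereal b * ereal g \<le> w"
          using W_le_w[OF M] by (simp add: weighted_functional_def mean_\<phi>[OF M] h g MN)
        then show "potential_mean \<Phi> M + ks_entropy M left_shift \<le> ereal (1 / a) * (w - ereal (b * g))"
          unfolding h using a mean_\<Phi>_top[OF M]
          by (cases "potential_mean \<Phi> M"; cases w) (auto simp: field_simps)
      qed
      moreover have "q * v + g \<le> u / (a + b)" if "v + g \<le> (u - b * g) / a" for u v
      proof -
        have "a * (v + g) \<le> u - b * g" using that a by (simp add: pos_le_divide_eq mult.commute)
        moreover have "(a + b) * (q * v + g) = a * v + (a + b) * g"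
          by (simp add: distrib_left q(2) mult.assoc[symmetric])
        ultimately have "(a + b) * (q * v + g) \<le> u" by (simp add: distrib_left distrib_right)
        then show ?thesis using ab by (simp only: pos_le_divide_eq mult.commute)
      qed
      ultimately show "potential_mean \<Theta> N + ks_entropy N left_shift \<le> ereal (1 / (a + b)) * w"
        unfolding mean_\<Theta>[OF N] g using a ab q(1) mean_\<psi>_top[OF N]
        by (cases "potential_mean \<psi> N"; cases w) auto
    qed
    from ereal_mult_left_mono[OF this, of "ereal (a + b)"] show "ereal (a + b) * P \<le> w"
      using ab by (simp add: ereal_mult_cancel_pos)
  qed

  have limit: "(\<lambda>n. ereal ((a + b) / real n) * eln (\<Sum>J\<in>{J. length J = n}. SUP y\<in>cylinder J \<inter> Y. epowr (\<psi> n y) q)) \<longlonglongrightarrow> w"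
  proof -
    have ws: "(\<Sum>J\<in>{J. length J = n}. SUP y\<in>cylinder J \<inter> Y. epowr (\<psi> n y) q) = word_sum Y \<Theta> n UNIV" for n
      unfolding word_sum_def \<Theta>_def scale_potential_def
    proof (intro sum.cong refl)
      fix J :: "'d list" assume "J \<in> {J. length J = n}"
      then have "cylinder J \<inter> Y = Y \<inter> ({x. pre n x = J} \<inter> UNIV)" by (auto simp: in_cylinder_iff)
      then show "(SUP y\<in>cylinder J \<inter> Y. epowr (\<psi> n y) q) = (SUP y\<in>Y \<inter> ({x. pre n x = J} \<inter> UNIV). epowr (\<psi> n y) q)"
        by simp
    qed
    have "(\<lambda>n. ereal (a + b) * (eln (word_sum Y \<Theta> n UNIV) / ereal (real n))) \<longlonglongrightarrow> ereal (a + b) * P"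
      unfolding P_def by (intro tendsto_cmult_ereal variational_principle[OF Y \<Theta>]) simp
    moreover have "\<forall>\<^sub>F n in sequentially. ereal (a + b) * (eln (word_sum Y \<Theta> n UNIV) / ereal (real n)) =
        ereal ((a + b) / real n) * eln (word_sum Y \<Theta> n UNIV)"
    proof (intro eventually_sequentiallyI[of 1])
      fix n :: nat assume "1 \<le> n"
      then show "ereal (a + b) * (eln (word_sum Y \<Theta> n UNIV) / ereal (real n)) =
          ereal ((a + b) / real n) * eln (word_sum Y \<Theta> n UNIV)"
        using ab by (cases "eln (word_sum Y \<Theta> n UNIV)") auto
    qed
    ultimately show ?thesis unfolding ws w_eq by (rule Lim_transform_eventually)
  qed

  have states: "weighted_equilibrium_state X Y \<pi> a b \<phi> M \<longleftrightarrow>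
      equilibrium_state Y \<Theta> (push_measure Y \<pi> M) \<and>
      conditional_equilibrium_state X Y \<pi> \<Phi> (push_measure Y \<pi> M) M" if "M \<in> invariant_measures X" for M
  proof -
    let ?N = "push_measure Y \<pi> M"
    have M: "seq_invariant X M" using that by (simp add: inv_X)
    note N = push_inv[OF M]
    obtain h where h: "ks_entropy M left_shift = ereal h" using h_real[OF M] by blast
    obtain g where g: "ks_entropy ?N left_shift = ereal g" using h_real[OF N] by blast
    \<comment> \<open>The relative principle with the finite entropy of the base subtracted: the
      conditional supremum is the mean of \<open>\<psi>\<close>.\<close>
    have sup: "(SUP M'\<in>{M' \<in> invariant_measures X. push_measure Y \<pi> M' = ?N}.
        potential_mean \<Phi> M' + ks_entropy M' left_shift - ks_entropy ?N left_shift) = potential_mean \<psi> ?N"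
    proof (rule SUP_eqI)
      fix M' assume "M' \<in> {M' \<in> invariant_measures X. push_measure Y \<pi> M' = ?N}"
      then have M': "seq_invariant X M'" "push_measure Y \<pi> M' = ?N" by (simp_all add: inv_X)
      from rvp_le[OF M'(1)] show "potential_mean \<Phi> M' + ks_entropy M' left_shift - ks_entropy ?N left_shift \<le> potential_mean \<psi> ?N"
        unfolding M'(2) g by (simp add: ereal_minus_le)
    next
      fix u assume u: "\<And>M'. M' \<in> {M' \<in> invariant_measures X. push_measure Y \<pi> M' = ?N} \<Longrightarrow>
        potential_mean \<Phi> M' + ks_entropy M' left_shift - ks_entropy ?N left_shift \<le> u"
      have "potential_mean \<psi> ?N + ks_entropy ?N left_shift \<le> u + ereal g"
        unfolding rvp[OF N, symmetric]
        by (rule SUP_least) (use u in \<open>simp add: g ereal_minus_le\<close>)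
      then show "potential_mean \<psi> ?N \<le> u" unfolding g by (cases "potential_mean \<psi> ?N"; cases u) auto
    qed
    have lhs: "weighted_equilibrium_state X Y \<pi> a b \<phi> M \<longleftrightarrow>
        ereal a * potential_mean \<Phi> M + ereal a * ereal h + ereal b * ereal g = ereal (a + b) * P"
      using that by (simp add: weighted_equilibrium_state_def w_def[symmetric] w_eq weighted_functional_def mean_\<phi>[OF M] h g)
    have rhs1: "equilibrium_state Y \<Theta> ?N \<longleftrightarrow> ereal q * potential_mean \<psi> ?N + ereal g = P"
      using N by (simp add: equilibrium_state_def inv_Y P_def mean_\<Theta>[OF N] g)
    have rhs2: "conditional_equilibrium_state X Y \<pi> \<Phi> ?N M \<longleftrightarrow> potential_mean \<Phi> M + ereal h - ereal g = potential_mean \<psi> ?N"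
      unfolding conditional_equilibrium_state_def sup using that by (simp add: h g)
    have le1: "potential_mean \<Phi> M + ereal h \<le> potential_mean \<psi> ?N + ereal g" using rvp_le[OF M] by (simp add: h g)
    have le2: "ereal q * potential_mean \<psi> ?N + ereal g \<le> P" using E_le_P[OF N] by (simp add: mean_\<Theta>[OF N] g)
    \<comment> \<open>The weighted functional reaches the pressure through two inequalities, one
      within the fibre over the base measure and one on the base. The ends agree exactly when both
      are equalities, because \<open>a\<close> and \<open>a + b\<close> are positive.\<close>
    have real: "a * u + a * h + b * g = (a + b) * s \<longleftrightarrow> q * v + g = s \<and> u + h - g = v"
      if 1: "u + h \<le> v + g" and 2: "q * v + g \<le> s" for u v s
    proof -
      have 3: "(a + b) * (q * v + g) = a * v + (a + b) * g" by (simp add: distrib_left q(2) mult.assoc[symmetric])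
      have 4: "a * (u + h) \<le> a * (v + g)" using 1 a by (intro mult_left_mono) auto
      have 5: "(a + b) * (q * v + g) \<le> (a + b) * s" using 2 ab by (intro mult_left_mono) auto
      show ?thesis
      proof
        assume eq: "a * u + a * h + b * g = (a + b) * s"
        have "a * (u + h) = a * (v + g)" "(a + b) * (q * v + g) = (a + b) * s"
          using eq 3 4 5 by (simp_all only: distrib_left distrib_right)
        then show "q * v + g = s \<and> u + h - g = v" using a ab by auto
      next
        assume "q * v + g = s \<and> u + h - g = v"
        then have v: "v = u + h - g" and s: "s = q * v + g" by auto
        have "(a + b) * s = a * v + (a + b) * g" unfolding s by (rule 3)
        then show "a * u + a * h + b * g = (a + b) * s" unfolding v by (simp add: algebra_simps)
      qed
    qed
    \<comment> \<open>The infinite cases agree as well: if \<open>P\<close> is -infinity all three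
      conditions hold, and if \<open>P\<close> is finite a mean -infinity of \<open>\<Phi>\<close>
      violates both sides.\<close>
    show ?thesis
      unfolding lhs rhs1 rhs2
      using le1 le2 a ab q(1) mean_\<Phi>_top[OF M] mean_\<psi>_top[OF N] real
      by (cases "potential_mean \<Phi> M"; cases "potential_mean \<psi> ?N"; cases P) auto
  qed
  from \<psi> \<Theta> w_eq limit states show ?thesis
    unfolding w_def P_def \<Theta>_def \<Phi>_def q_def by blast
qed

end
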